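(* Let $N$ be a finitely generated nilpotent group, $U=\{u_1<u_2<\dots\}$ a set of reals $>1/2$ that is a semigroup under addition, and $\mathcal I$ a $U$-indexed descending central series of $N$ satisfying the conditions in the context, with sets $\Xi_{u_i}\subset I_{u_i}$ $(1\le i\le m)$ and function $\mathfrak u$ as defined there. Let $\Xi_0=(\xi_1,\dots,\xi_n)$ be a tuple of elements of $N$ such that $\Xi:=\bigl(\bigsqcup_{i=1}^m\Xi_{u_i}\bigr)\sqcup\Xi_0$ generates $N$, and for $i=1,\dots,n$ take $a_i>1/2$ with $a_i\le\mathfrak u(\xi_i)$. Let $$\mathbf u:=\Bigl(\bigsqcup_{i=1}^m\underbrace{(u_i,\dots,u_i)}_{|\Xi_{u_i}|\text{ times}}\Bigr)\sqcup(a_1,\dots,a_n).$$ If $S$ is a finite tuple generating $N$, $\mathbf v$ is a weight tuple of the same length with entries in $(1/2,\infty)$, and $\mathrm{Red}(\mathcal N_{S,\mathbf v})=\mathcal I$ (as series indexed by weights), then $$\mathcal E_{\mu_{S,1/\mathbf v}}\asymp\mathcal E_{\mu_{\Xi,1/\mathbf u}}.$$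
   Context: Conditions on $\mathcal I$. $\mathcal I=\{I_{u_1}\supset\dots\supset I_{u_m}\supset\mathrm{Tor}(N)=I_{u_{m+1}}\supseteq\{e\}=I_{u_{m+2}}=\dots\}$ is a central series of subgroups of $N$ indexed by $U$ such that: $[I_{u_i},I_{u_j}]\subseteq I_{u_i+u_j}$ for all $i,j$; $I_{u_1}$ has finite index in $N$; for $1\le i\le m$, $I_{u_i}/I_{u_{i+1}}$ is nontrivial and torsion-free. Define $\mathfrak u(s)=\infty$ if $s\in\mathrm{Tor}(N)$ and $\mathfrak u(s)=\max\{u_i:1\le i\le m,\ s\in I_{u_i}\}$ otherwise (with $\max\emptyset=-\infty$). For $1\le i\le m$ let $C_{u_i}$ be the subgroup generated by all $[I_{u_a},I_{u_b}]$ with $u_a+u_b=u_i$, $a,b<i$, so $C_{u_i}\subseteq I_{u_i}$, and let $\Xi_{u_i}\subset I_{u_i}$ be a finite subset whose image generates $(I_{u_i}/I_{u_{i+1}})\big/\bigl((C_{u_i}I_{u_{i+1}})/I_{u_{i+1}}\bigr)$. Reduced series of $(S,\mathbf v)$, $S=(s_1,\dots,s_k)$. $\mathcal C(S)$ is the set of formal commutators over the formal alphabet $S\cup S^{-1}$ (each letter is one; $[c_1,c_2]$ is one if $c_1,c_2$ are), with $w(s_i^{\pm1})=v_i$, $w([c_1,c_2])=w(c_1)+w(c_2)$. Let $w_1<w_2<\dots$ be the distinct values of $w$, $N_{w_i}$ the subgroup generated by evaluations of all $c$ with $w(c)\ge w_i$, and $j_*$ minimal with $N_{w_{j_*+1}}=\{e\}$;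 $\mathcal N_{S,\mathbf v}$ is the series $(N_{w_i})$. For $K\le N$, $I(K)=\{g\in N:\exists n\ge1,\ g^n\in K\}$, a subgroup. In $I(N_{w_1})\supseteq\dots\supseteq I(N_{w_{j_*}})\supseteq I(\{e\})=\mathrm{Tor}(N)$, among identical subgroups keep only the last occurrence; the result is $\mathrm{Red}(\mathcal N_{S,\mathbf v})=\{I(N_{w_{l_1}})\supset\dots\supset I(N_{w_{l_r}})\supset\mathrm{Tor}(N)\}$, with remaining weights $(w_{l_1},\dots,w_{l_r})$. The equality $\mathrm{Red}(\mathcal N_{S,\mathbf v})=\mathcal I$ means $r=m$, $w_{l_i}=u_i$ and $I(N_{w_{l_i}})=I_{u_i}$ for $1\le i\le m$. Dirichlet forms. For a tuple $T=(t_1,\dots,t_q)$ and $\boldsymbol\alpha\in(0,2)^q$, $\mu_{T,\boldsymbol\alpha}$ is any symmetric probability measure with $\mu_{T,\boldsymbol\alpha}(g)\asymp\sum_{j=1}^q\sum_{a\in\mathbb Z}\mathbf 1_{\{t_j^a\}}(g)(1+|a|)^{-1-\alpha_j}$; $1/\mathbf v$ denotes componentwise reciprocals. $\mathcal E_\mu(f,f)=\frac12\sum_{g,h\in N}|f(gh)-f(g)|^2\mu(h)$. $\asymp$ means two-sided comparison up to positive finite constants; for Dirichlet forms, over all finitely supported $f:N\to\mathbb R$. *)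

theory Defs
  imports "HOL-Algebra.Generated_Groups" "HOL-Algebra.Elementary_Groups" "HOL-Probability.Probability"
begin

section \<open>Nilpotent groups, torsion, isolators\<close>

definition commutator :: "('a, 'b) monoid_scheme \<Rightarrow> 'a \<Rightarrow> 'a \<Rightarrow> 'a" where
  "commutator G x y = x \<otimes>\<^bsub>G\<^esub> y \<otimes>\<^bsub>G\<^esub> inv\<^bsub>G\<^esub> x \<otimes>\<^bsub>G\<^esub> inv\<^bsub>G\<^esub> y"

definition commutator_subgroup :: "('a, 'b) monoid_scheme \<Rightarrow> 'a set \<Rightarrow> 'a set \<Rightarrow> 'a set" where
  "commutator_subgroup G H K = generate G {commutator G h k | h k. h \<in> H \<and> k \<in> K}"

primrec lower_central_series :: "('a, 'b) monoid_scheme \<Rightarrow> nat \<Rightarrow> 'a set" where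
  "lower_central_series G 0 = carrier G"
| "lower_central_series G (Suc n) = commutator_subgroup G (carrier G) (lower_central_series G n)"

definition nilpotent_group :: "('a, 'b) monoid_scheme \<Rightarrow> bool" where
  "nilpotent_group G \<longleftrightarrow> group G \<and> (\<exists>n. lower_central_series G n = {\<one>\<^bsub>G\<^esub>})"

definition finitely_generated_group :: "('a, 'b) monoid_scheme \<Rightarrow> bool" where
  "finitely_generated_group G \<longleftrightarrow>
     group G \<and> (\<exists>A. finite A \<and> A \<subseteq> carrier G \<and> generate G A = carrier G)"

definition isolator :: "('a, 'b) monoid_scheme \<Rightarrow> 'a set \<Rightarrow> 'a set" where
  "isolator G K = {g \<in> carrier G. \<exists>n::nat. n \<ge> 1 \<and> g [^]\<^bsub>G\<^esub> n \<in> K}"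

definition torsion :: "('a, 'b) monoid_scheme \<Rightarrow> 'a set" where
  "torsion G = {g \<in> carrier G. \<exists>n::nat. n \<ge> 1 \<and> g [^]\<^bsub>G\<^esub> n = \<one>\<^bsub>G\<^esub>}"

definition torsion_free_group :: "('a, 'b) monoid_scheme \<Rightarrow> bool" where
  "torsion_free_group G \<longleftrightarrow> group G \<and> torsion G = {\<one>\<^bsub>G\<^esub>}"


section \<open>Central series indexed by a semigroup of weights\<close>

text \<open>Sequences of weights are indexed from 1; the value of \<open>u\<close> at 0 is irrelevant.
  The index set is \<open>U = u ` {1..}\<close>, and a \<open>U\<close>-indexed series is a function on the reals that is
  only used at points of \<open>U\<close>.\<close>

definition weight_semigroup :: "(nat \<Rightarrow> real) \<Rightarrow> bool" where
  "weight_semigroup u \<longleftrightarrow>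
     strict_mono_on {1..} u \<and>
     (\<forall>i\<ge>1. u i > 1 / 2) \<and>
     (\<forall>x\<in>u ` {1..}. \<forall>y\<in>u ` {1..}. x + y \<in> u ` {1..})"

definition central_series :: "('a, 'b) monoid_scheme \<Rightarrow> (nat \<Rightarrow> 'a set) \<Rightarrow> bool" where
  "central_series G H \<longleftrightarrow>
     (\<forall>i\<ge>1. subgroup (H i) G \<and> H (i + 1) \<subseteq> H i \<and>
             commutator_subgroup G (carrier G) (H i) \<subseteq> H (i + 1))"

definition admissible_series ::
    "('a, 'b) monoid_scheme \<Rightarrow> (nat \<Rightarrow> real) \<Rightarrow> nat \<Rightarrow> (real \<Rightarrow> 'a set) \<Rightarrow> bool" where
  "admissible_series G u m I \<longleftrightarrow>
     central_series G (\<lambda>i. I (u i)) \<and>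
     (\<forall>i\<in>{1..m}. I (u (i + 1)) \<subset> I (u i)) \<and>
     I (u (m + 1)) = torsion G \<and>
     (\<forall>i\<ge>m + 2. I (u i) = {\<one>\<^bsub>G\<^esub>}) \<and>
     (\<forall>i\<ge>1. \<forall>j\<ge>1. commutator_subgroup G (I (u i)) (I (u j)) \<subseteq> I (u i + u j)) \<and>
     finite (rcosets\<^bsub>G\<^esub> (I (u 1))) \<and>
     (\<forall>i\<in>{1..m}.
        let Q = (G\<lparr>carrier := I (u i)\<rparr>) Mod I (u (i + 1))
        in \<not> trivial_group Q \<and> torsion_free_group Q)"

text \<open>In \<open>ereal\<close> the supremum of the empty set is \<open>-\<infinity>\<close>; otherwise the supremum below is a maximum
  over a finite set.\<close>

definition series_weight ::
    "('a, 'b) monoid_scheme \<Rightarrow> (nat \<Rightarrow> real) \<Rightarrow> nat \<Rightarrow> (real \<Rightarrow> 'a set) \<Rightarrow> 'a \<Rightarrow> ereal" where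
  "series_weight G u m I s =
     (if s \<in> torsion G then \<infinity> else (SUP i\<in>{i\<in>{1..m}. s \<in> I (u i)}. ereal (u i)))"

definition series_commutators ::
    "('a, 'b) monoid_scheme \<Rightarrow> (nat \<Rightarrow> real) \<Rightarrow> (real \<Rightarrow> 'a set) \<Rightarrow> nat \<Rightarrow> 'a set" where
  "series_commutators G u I i =
     generate G (\<Union>{commutator_subgroup G (I (u a)) (I (u b)) | a b.
                     a \<in> {1..<i} \<and> b \<in> {1..<i} \<and> u a + u b = u i})"

text \<open>The image of \<open>X\<close> generates \<open>(H / J) / (C J / J)\<close>.\<close>

definition generates_double_quotient ::
    "('a, 'b) monoid_scheme \<Rightarrow> 'a set \<Rightarrow> 'a set \<Rightarrow> 'a set \<Rightarrow> 'a set \<Rightarrow> bool" where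
  "generates_double_quotient G H J C X \<longleftrightarrow>
     (let Q = (G\<lparr>carrier := H\<rparr>) Mod J;
          \<pi> = (\<lambda>x. J #>\<^bsub>G\<^esub> x);
          K = \<pi> ` (C <#>\<^bsub>G\<^esub> J)
      in generate (Q Mod K) ((\<lambda>x. K #>\<^bsub>Q\<^esub> \<pi> x) ` X) = carrier (Q Mod K))"

text \<open>A finite subset of \<open>I (u i)\<close> is given as a duplicate-free list, which fixes the order in which
  its elements enter the tuples below.\<close>

definition layer_generators ::
    "('a, 'b) monoid_scheme \<Rightarrow> (nat \<Rightarrow> real) \<Rightarrow> nat \<Rightarrow> (real \<Rightarrow> 'a set) \<Rightarrow> (nat \<Rightarrow> 'a list) \<Rightarrow> bool" where
  "layer_generators G u m I Xi \<longleftrightarrow>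
     (\<forall>i\<in>{1..m}.
        distinct (Xi i) \<and> set (Xi i) \<subseteq> I (u i) \<and>
        generates_double_quotient G (I (u i)) (I (u (i + 1))) (series_commutators G u I i) (set (Xi i)))"


section \<open>Formal commutators and the reduced series of a weighted generating tuple\<close>

text \<open>The letter \<open>(i, True)\<close> stands for the \<open>i\<close>-th entry of the tuple (counted from 0, as usual for
  lists) and \<open>(i, False)\<close> for its formal inverse. Because inverse letters have the same weight, the
  evaluations of a given weight do not depend on the convention chosen in \<open>commutator\<close>.\<close>

datatype 'l formal_commutator =
    Letter 'l
  | Bracket "'l formal_commutator" "'l formal_commutator"

definition formal_commutators :: "'a list \<Rightarrow> (nat \<times> bool) formal_commutator set" where
  "formal_commutators S = {c. set_formal_commutator c \<subseteq> {..<length S} \<times> UNIV}"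

primrec fc_weight :: "real list \<Rightarrow> (nat \<times> bool) formal_commutator \<Rightarrow> real" where
  "fc_weight v (Letter l) = v ! fst l"
| "fc_weight v (Bracket c d) = fc_weight v c + fc_weight v d"

primrec fc_eval ::
    "('a, 'b) monoid_scheme \<Rightarrow> 'a list \<Rightarrow> (nat \<times> bool) formal_commutator \<Rightarrow> 'a" where
  "fc_eval G S (Letter l) = (if snd l then S ! fst l else inv\<^bsub>G\<^esub> (S ! fst l))"
| "fc_eval G S (Bracket c d) = commutator G (fc_eval G S c) (fc_eval G S d)"

definition weight_values :: "'a list \<Rightarrow> real list \<Rightarrow> real set" where
  "weight_values S v = fc_weight v ` formal_commutators S"

text \<open>For positive weights this enumerates \<open>weight_values S v\<close> increasingly from index 1 on;
  the value 0 at index 0 is a sentinel below all weights.\<close>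

primrec weight_enum :: "'a list \<Rightarrow> real list \<Rightarrow> nat \<Rightarrow> real" where
  "weight_enum S v 0 = 0"
| "weight_enum S v (Suc j) = (LEAST x. x \<in> weight_values S v \<and> x > weight_enum S v j)"

definition weight_subgroup ::
    "('a, 'b) monoid_scheme \<Rightarrow> 'a list \<Rightarrow> real list \<Rightarrow> real \<Rightarrow> 'a set" where
  "weight_subgroup G S v w =
     generate G (fc_eval G S ` {c \<in> formal_commutators S. fc_weight v c \<ge> w})"

definition last_index :: "('a, 'b) monoid_scheme \<Rightarrow> 'a list \<Rightarrow> real list \<Rightarrow> nat" where
  "last_index G S v = (LEAST j. weight_subgroup G S v (weight_enum S v (j + 1)) = {\<one>\<^bsub>G\<^esub>})"

text \<open>The list of remaining pairs (weight, subgroup). The final term \<open>torsion G\<close>, which carries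
  no weight, is left implicit.\<close>

definition reduced_series ::
    "('a, 'b) monoid_scheme \<Rightarrow> 'a list \<Rightarrow> real list \<Rightarrow> (real \<times> 'a set) list" where
  "reduced_series G S v =
     (let w = weight_enum S v;
          k = last_index G S v;
          J = (\<lambda>j. isolator G (weight_subgroup G S v (w j)))
      in map (\<lambda>j. (w j, J j))
           (filter (\<lambda>j. (\<forall>j'\<in>{j<..k}. J j' \<noteq> J j) \<and> isolator G {\<one>\<^bsub>G\<^esub>} \<noteq> J j) [1..<k + 1]))"


section \<open>Dirichlet forms of stable-like measures\<close>

definition comparable_on :: "'c set \<Rightarrow> ('c \<Rightarrow> real) \<Rightarrow> ('c \<Rightarrow> real) \<Rightarrow> bool" where
  "comparable_on X p q \<longleftrightarrow>
     (\<exists>c C. 0 < c \<and> 0 < C \<and> (\<forall>x\<in>X. c * q x \<le> p x \<and> p x \<le> C * q x))"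

definition power_law ::
    "('a, 'b) monoid_scheme \<Rightarrow> 'a list \<Rightarrow> real list \<Rightarrow> 'a \<Rightarrow> real" where
  "power_law G T \<alpha> g =
     (\<Sum>j<length T. \<Sum>\<^sub>\<infinity>a\<in>(UNIV :: int set).
        indicat_real {T ! j [^]\<^bsub>G\<^esub> a} g * (1 + \<bar>real_of_int a\<bar>) powr (- 1 - \<alpha> ! j))"

definition is_stable_like ::
    "('a, 'b) monoid_scheme \<Rightarrow> 'a list \<Rightarrow> real list \<Rightarrow> 'a pmf \<Rightarrow> bool" where
  "is_stable_like G T \<alpha> \<mu> \<longleftrightarrow>
     set_pmf \<mu> \<subseteq> carrier G \<and>
     (\<forall>g\<in>carrier G. pmf \<mu> (inv\<^bsub>G\<^esub> g) = pmf \<mu> g) \<and>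
     comparable_on (carrier G) (pmf \<mu>) (power_law G T \<alpha>)"

definition dirichlet_form ::
    "('a, 'b) monoid_scheme \<Rightarrow> 'a pmf \<Rightarrow> ('a \<Rightarrow> real) \<Rightarrow> real" where
  "dirichlet_form G \<mu> f =
     1 / 2 * (\<Sum>\<^sub>\<infinity>(g, h)\<in>carrier G \<times> carrier G. \<bar>f (g \<otimes>\<^bsub>G\<^esub> h) - f g\<bar>\<^sup>2 * pmf \<mu> h)"

definition finitely_supported :: "('a, 'b) monoid_scheme \<Rightarrow> ('a \<Rightarrow> real) set" where
  "finitely_supported G = {f. finite {g \<in> carrier G. f g \<noteq> 0}}"

end

theory Submission
  imports Defs
begin

text \<open>
  For a finitely supported \<open>f\<close> let \<open>D g\<close> be the squared \<open>\<ell>\<^sup>2\<close>-norm of \<open>f(\<sqdot> g) - f\<close>. The Dirichlet form of a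
  measure with power laws of exponents \<open>1 / w\<^sub>j\<close> along the powers of \<open>t\<^sub>j\<close> is comparable to
  \<open>\<Sum>\<^sub>j \<Sum>\<^sub>a D (t\<^sub>j ^ a) (1 + \<bar>a\<bar>) powr (- 1 - 1 / w\<^sub>j)\<close> (\<open>dirichlet_form_power_energy\<close>). Hence two such forms are compared one
  element at a time, and the theorem follows from one principle (\<open>power_energy_comparison\<close>): if some power
  of \<open>g\<close> lies in the subgroup generated by the commutators of weight at least \<open>w\<close> in \<open>(S, v)\<close>, then the
  contribution of \<open>g\<close> with weight \<open>w\<close> is dominated by the form of \<open>(S, v)\<close>.

  The principle rests on a geometric fact (\<open>isolator_powers\<close>): for such \<open>g\<close>, every power \<open>g ^ a\<close> is a product
  of at most \<open>M\<close> powers \<open>s\<^sub>i ^ b\<close> with \<open>\<bar>b\<bar> \<le> M (1 + \<bar>a\<bar>) powr (v\<^sub>i / w)\<close>, where \<open>M\<close> does not depend on \<open>a\<close>.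
  The function \<open>D\<close> is subadditive up to constants, and \<open>D (s\<^sub>i ^ b)\<close> is at most a constant times the average of
  \<open>D (s\<^sub>i ^ k)\<close> over \<open>\<bar>k\<bar>\<close> up to the order of \<open>b\<close>; summing over \<open>a\<close> and interchanging the sums turns the
  exponents \<open>1 / w\<close> into \<open>1 / v\<^sub>i\<close> (\<open>sum_powr_weighted_swap\<close>).

  The geometric fact is a quantitative collection process. Each letter has a scale \<open>\<ge> 1\<close>, each formal
  commutator the product of the scales of its letters, and a power is admissible if its exponent is at most
  a constant times the scale. Descending induction on the length of commutators (\<open>collapsible_and_commutes\<close>)
  shows, with constants independent of the scales, that a commutator of admissible powers is a bounded word
  in admissible powers of longer commutators, its leading term being the expected power of the bracket, and
  that a word of \<open>n\<close> factors with exponents \<open>n\<close> times below their scales is a bounded admissible word.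
  Reading the leading term backwards expresses admissible powers of commutators by admissible powers of
  letters (\<open>words_in_letters\<close>).

  It remains to place each element of one tuple in an isolator for the other. The equality of the reduced
  series with \<open>I\<close> says that \<open>I (u i)\<close> is the isolator of the weight subgroup of \<open>(S, v)\<close> at \<open>u i\<close>, which
  handles the elements of \<open>\<Xi>\<close>; torsion elements lie in every isolator. Conversely each entry of \<open>S\<close> is torsion
  or lies in some \<open>I (u i)\<close> with \<open>u i\<close> at least its own weight (\<open>reduced_series_covers\<close>), and \<open>I (u i)\<close> is
  contained in the isolator of the weight subgroup of \<open>\<Xi>\<close> at \<open>u i\<close> (\<open>series_subset_isolator\<close>): modulo the
  next layer it is generated by the formal commutators in \<open>\<Xi>\<close> of weight exactly \<open>u i\<close>, and the torsion left at
  the end is central.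
\<close>

section \<open>Products of boundedly many factors\<close>

context group
begin

lemma cancel_left:
  "\<lbrakk>x \<in> carrier G; y \<in> carrier G\<rbrakk> \<Longrightarrow> x \<otimes> (inv x \<otimes> y) = y"
  "\<lbrakk>x \<in> carrier G; y \<in> carrier G\<rbrakk> \<Longrightarrow> inv x \<otimes> (x \<otimes> y) = y"
  by (simp_all flip: m_assoc)

text \<open>A normalisation of words: products are associated to the right, inverses pushed to the letters, and
  adjacent inverse pairs cancelled. It proves the commutator identities below.\<close>

lemmas word_simps = commutator_def m_assoc inv_mult_group cancel_left

lemma commutator_closed [simp]:
  "\<lbrakk>x \<in> carrier G; y \<in> carrier G\<rbrakk> \<Longrightarrow> commutator G x y \<in> carrier G"
  by (simp add: commutator_def)

lemma commutator_one [simp]: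
  "x \<in> carrier G \<Longrightarrow> commutator G x \<one> = \<one>" "x \<in> carrier G \<Longrightarrow> commutator G \<one> x = \<one>"
  by (simp_all add: commutator_def)

lemma inv_commutator:
  "\<lbrakk>x \<in> carrier G; y \<in> carrier G\<rbrakk> \<Longrightarrow> inv (commutator G x y) = commutator G y x"
  by (simp add: word_simps)

lemma conj_eq_commutator_mult:
  "\<lbrakk>x \<in> carrier G; y \<in> carrier G\<rbrakk> \<Longrightarrow> x \<otimes> y \<otimes> inv x = commutator G x y \<otimes> y"
  by (simp add: word_simps)

text \<open>The length bound is a real number, so that it can be multiplied by scales and slacks without
  rounding.\<close>

definition short_products :: "'a set \<Rightarrow> real \<Rightarrow> 'a set" where
  "short_products A L = {foldr (\<otimes>) gs \<one> | gs. set gs \<subseteq> A \<and> real (length gs) \<le> L}"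

lemma foldr_closed: "set gs \<subseteq> carrier G \<Longrightarrow> foldr (\<otimes>) gs \<one> \<in> carrier G"
  by (induction gs) auto

lemma foldr_append:
  "\<lbrakk>set gs \<subseteq> carrier G; set hs \<subseteq> carrier G\<rbrakk> \<Longrightarrow>
    foldr (\<otimes>) (gs @ hs) \<one> = foldr (\<otimes>) gs \<one> \<otimes> foldr (\<otimes>) hs \<one>"
  by (induction gs) (auto simp: m_assoc foldr_closed)

lemma short_products_closed: "\<lbrakk>A \<subseteq> carrier G; g \<in> short_products A L\<rbrakk> \<Longrightarrow> g \<in> carrier G"
  by (auto simp: short_products_def intro: foldr_closed)

lemma short_products_mono: "\<lbrakk>A \<subseteq> B; L \<le> L'\<rbrakk> \<Longrightarrow> short_products A L \<subseteq> short_products B L'"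
  by (force simp: short_products_def)

lemma one_in_short_products: "0 \<le> L \<Longrightarrow> \<one> \<in> short_products A L"
  by (auto simp: short_products_def intro!: exI[of _ "[]"])

lemma single_in_short_products:
  "\<lbrakk>A \<subseteq> carrier G; g \<in> A; 1 \<le> L\<rbrakk> \<Longrightarrow> g \<in> short_products A L"
  by (auto simp: short_products_def intro!: exI[of _ "[g]"])

lemma mult_in_short_products:
  assumes "A \<subseteq> carrier G" "g \<in> short_products A L" "h \<in> short_products A L'"
  shows "g \<otimes> h \<in> short_products A (L + L')"
proof -
  from assms obtain gs hs where
    "g = foldr (\<otimes>) gs \<one>" "set gs \<subseteq> A" "real (length gs) \<le> L"
    "h = foldr (\<otimes>) hs \<one>" "set hs \<subseteq> A" "real (length hs) \<le> L'"
    by (auto simp: short_products_def)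
  thus ?thesis using assms(1) unfolding short_products_def
    by (auto intro!: exI[of _ "gs @ hs"] simp: foldr_append[symmetric] simp del: List.foldr_append)
qed

text \<open>Replacing each factor by at most \<open>M\<close> new ones multiplies the length bound by \<open>M\<close>. The two
  instances that matter are the identity (words in words) and conjugation.\<close>

lemma short_products_hom_bound:
  assumes B: "B \<subseteq> carrier G" and M: "0 \<le> M" and g: "g \<in> short_products A L" "A \<subseteq> carrier G"
    and one: "\<phi> \<one> = \<one>"
    and mult: "\<And>x y. x \<in> carrier G \<Longrightarrow> y \<in> carrier G \<Longrightarrow> \<phi> (x \<otimes> y) = \<phi> x \<otimes> \<phi> y"
    and \<phi>: "\<And>a. a \<in> A \<Longrightarrow> \<phi> a \<in> short_products B M"
  shows "\<phi> g \<in> short_products B (L * M)"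
proof -
  from g obtain gs where gs: "g = foldr (\<otimes>) gs \<one>" "set gs \<subseteq> A" "real (length gs) \<le> L"
    by (auto simp: short_products_def)
  have "\<phi> (foldr (\<otimes>) gs \<one>) \<in> short_products B (real (length gs) * M)"
    using gs(2)
  proof (induction gs)
    case Nil thus ?case by (simp add: one one_in_short_products)
  next
    case (Cons a gs)
    have "\<phi> (foldr (\<otimes>) (a # gs) \<one>) = \<phi> a \<otimes> \<phi> (foldr (\<otimes>) gs \<one>)"
      using Cons.prems g(2) by (auto intro!: mult foldr_closed)
    also have "\<dots> \<in> short_products B (M + real (length gs) * M)"
      using Cons by (intro mult_in_short_products B \<phi>) auto
    finally show ?case by (simp add: algebra_simps)
  qed
  moreover have "real (length gs) * M \<le> L * M" using gs(3) M by (rule mult_right_mono)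
  ultimately show ?thesis using short_products_mono[of B B "real (length gs) * M" "L * M"] gs(1) by auto
qed

lemma short_products_nested:
  assumes "B \<subseteq> carrier G" "0 \<le> M" "g \<in> short_products A L" "A \<subseteq> short_products B M"
  shows "g \<in> short_products B (L * M)"
  using short_products_hom_bound[of B M g A L "\<lambda>x. x"] assms short_products_closed by blast

lemma short_products_conj:
  assumes "B \<subseteq> carrier G" "0 \<le> M" "g \<in> short_products A L" "A \<subseteq> carrier G" "x \<in> carrier G"
    "\<And>a. a \<in> A \<Longrightarrow> x \<otimes> a \<otimes> inv x \<in> short_products B M"
  shows "x \<otimes> g \<otimes> inv x \<in> short_products B (L * M)"
  using short_products_hom_bound[of B M g A L "\<lambda>y. x \<otimes> y \<otimes> inv x"] assms
  by (simp add: word_simps)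

lemma inv_in_short_products:
  assumes A: "A \<subseteq> carrier G" "\<And>a. a \<in> A \<Longrightarrow> inv a \<in> A" and g: "g \<in> short_products A L"
  shows "inv g \<in> short_products A L"
proof -
  from g obtain gs where gs: "g = foldr (\<otimes>) gs \<one>" "set gs \<subseteq> A" "real (length gs) \<le> L"
    by (auto simp: short_products_def)
  have "inv (foldr (\<otimes>) gs \<one>) \<in> short_products A (real (length gs))"
    using gs(2)
  proof (induction gs)
    case Nil thus ?case by (simp add: one_in_short_products)
  next
    case (Cons a gs)
    have "inv (foldr (\<otimes>) (a # gs) \<one>) = inv (foldr (\<otimes>) gs \<one>) \<otimes> inv a"
      using Cons.prems A(1) by (auto intro!: inv_mult_group foldr_closed)
    also have "\<dots> \<in> short_products A (real (length gs) + 1)"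
      using mult_in_short_products[OF A(1) Cons.IH single_in_short_products[OF A(1), of "inv a" 1]]
        Cons.prems A(2) by auto
    finally show ?case by (simp add: algebra_simps)
  qed
  thus ?thesis using short_products_mono[of A A "real (length gs)" L] gs(1,3) by auto
qed

text \<open>The basic collection step. All powers of \<open>z\<close> are moved to the right end; the factor \<open>h i\<close> is
  thereby conjugated by the power of \<open>z\<close> accumulated before it. Only the conjugated factors have to be
  controlled, and the exponents of \<open>z\<close> simply add up.\<close>

lemma collect_powers:
  fixes \<beta> :: "nat \<Rightarrow> int"
  assumes A: "A \<subseteq> carrier G" and z: "z \<in> carrier G" and h: "\<And>i. i < n \<Longrightarrow> h i \<in> carrier G"
    and F0: "F 0 = \<one>" and FS: "\<And>i. i < n \<Longrightarrow> F (Suc i) = F i \<otimes> h i \<otimes> z [^] \<beta> i"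
    and conj: "\<And>i. i < n \<Longrightarrow>
      z [^] (\<Sum>j<i. \<beta> j) \<otimes> h i \<otimes> inv (z [^] (\<Sum>j<i. \<beta> j)) \<in> short_products A L"
  shows "\<exists>g \<in> short_products A (real n * L). F n = g \<otimes> z [^] (\<Sum>j<n. \<beta> j)"
  using h FS conj
proof (induction n)
  case 0
  show ?case using F0 by (intro bexI[of _ \<one>]) (auto intro: one_in_short_products)
next
  case (Suc n)
  then obtain g where g: "g \<in> short_products A (real n * L)" "F n = g \<otimes> z [^] (\<Sum>j<n. \<beta> j)"
    by auto
  let ?s = "\<Sum>j<n. \<beta> j"
  let ?g = "g \<otimes> (z [^] ?s \<otimes> h n \<otimes> inv (z [^] ?s))"
  have gc: "g \<in> carrier G" using g(1) A short_products_closed by blast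
  have "?g \<in> short_products A (real n * L + L)"
    by (intro mult_in_short_products A g Suc.prems) auto
  hence "?g \<in> short_products A (real (Suc n) * L)" by (simp add: algebra_simps)
  moreover have "F (Suc n) = g \<otimes> z [^] ?s \<otimes> h n \<otimes> z [^] \<beta> n" using Suc.prems(2)[of n] g(2) by simp
  moreover have "\<dots> = ?g \<otimes> z [^] (\<Sum>j<Suc n. \<beta> j)"
    using gc z Suc.prems(1)[of n] by (simp add: int_pow_mult m_assoc cancel_left)
  ultimately show ?case by auto
qed

lemma lower_central_series_closed: "lower_central_series G n \<subseteq> carrier G"
proof (induction n)
  case (Suc n)
  thus ?case unfolding lower_central_series.simps commutator_subgroup_def
    by (intro generate_incl) auto
qed auto

lemma fc_eval_closed:
  "\<lbrakk>set S \<subseteq> carrier G; c \<in> formal_commutators S\<rbrakk> \<Longrightarrow> fc_eval G S c \<in> carrier G"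
proof (induction c)
  case (Letter l)
  hence "S ! fst l \<in> set S" by (cases l) (auto simp: formal_commutators_def)
  thus ?case using Letter by auto
qed (simp add: formal_commutators_def)

end

section \<open>Length and scale of formal commutators\<close>

primrec fc_length :: "'l formal_commutator \<Rightarrow> nat" where
  "fc_length (Letter l) = 1"
| "fc_length (Bracket c d) = fc_length c + fc_length d"

text \<open>The multiplicative counterpart of the weight: if the letter \<open>i\<close> has scale \<open>R powr (v ! i)\<close>, then a
  commutator \<open>c\<close> has scale \<open>R powr (fc_weight v c)\<close>. The collection argument does not see \<open>R\<close> and \<open>v\<close>,
  only arbitrary scales \<open>\<ge> 1\<close> of the letters.\<close>

primrec fc_scale :: "(nat \<Rightarrow> real) \<Rightarrow> (nat \<times> bool) formal_commutator \<Rightarrow> real" where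
  "fc_scale \<rho> (Letter l) = \<rho> (fst l)"
| "fc_scale \<rho> (Bracket c d) = fc_scale \<rho> c * fc_scale \<rho> d"

lemma fc_length_pos: "1 \<le> fc_length c"
  by (induction c) auto

lemma fc_scale_ge_1: "(\<And>i. 1 \<le> \<rho> i) \<Longrightarrow> 1 \<le> fc_scale \<rho> c"
proof (induction c)
  case (Bracket c d)
  thus ?case using mult_mono[of 1 "fc_scale \<rho> c" 1 "fc_scale \<rho> d"] by simp
qed auto

lemma Bracket_in_formal_commutators [simp]:
  "Bracket c d \<in> formal_commutators S \<longleftrightarrow> c \<in> formal_commutators S \<and> d \<in> formal_commutators S"
  by (simp add: formal_commutators_def)

lemma finite_formal_commutators_length: "finite {c \<in> formal_commutators S. fc_length c \<le> k}"
proof (induction k)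
  case 0
  have [simp]: "fc_length c \<noteq> 0" for c :: "(nat \<times> bool) formal_commutator"
    using fc_length_pos[of c] by linarith
  show ?case by simp
next
  case (Suc k)
  let ?F = "{c \<in> formal_commutators S. fc_length c \<le> k}"
  have "c \<in> Letter ` ({..<length S} \<times> UNIV) \<union> (\<lambda>(c, d). Bracket c d) ` (?F \<times> ?F)"
    if c: "c \<in> formal_commutators S" "fc_length c \<le> Suc k" for c
  proof (cases c)
    case (Letter l) thus ?thesis using c by (auto simp: formal_commutators_def)
  next
    case (Bracket x y)
    thus ?thesis using c fc_length_pos[of x] fc_length_pos[of y] by auto
  qed
  hence "{c \<in> formal_commutators S. fc_length c \<le> Suc k} \<subseteq>
      Letter ` ({..<length S} \<times> UNIV) \<union> (\<lambda>(c, d). Bracket c d) ` (?F \<times> ?F)" by auto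
  thus ?case by (rule finite_subset) (use Suc in auto)
qed

text \<open>A binary tree with more than \<open>2 ^ k\<close> leaves has height greater than \<open>k\<close>, and each level of
  brackets descends one step in the lower central series. The exponential bound is crude, but it needs
  only \<open>[G, \<gamma>\<^sub>n] \<subseteq> \<gamma>\<^sub>n\<^sub>+\<^sub>1\<close> and not the inclusion \<open>[\<gamma>\<^sub>i, \<gamma>\<^sub>j] \<subseteq> \<gamma>\<^sub>i\<^sub>+\<^sub>j\<close>.\<close>

lemma (in group) fc_eval_in_lower_central_series:
  assumes S: "set S \<subseteq> carrier G"
  shows "\<lbrakk>c \<in> formal_commutators S; 2 ^ k < fc_length c\<rbrakk> \<Longrightarrow>
    fc_eval G S c \<in> lower_central_series G (Suc k)"
proof (induction c arbitrary: k)
  case (Bracket c d)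
  have cl: "fc_eval G S c \<in> carrier G" "fc_eval G S d \<in> carrier G"
    using Bracket.prems fc_eval_closed[OF S] by auto
  have *: "commutator G x y \<in> lower_central_series G (Suc n)"
    if "x \<in> carrier G" "y \<in> lower_central_series G n" for x y n
    using that by (auto simp: commutator_subgroup_def intro!: generate.incl)
  have **: "commutator G y x \<in> lower_central_series G (Suc n)"
    if "x \<in> carrier G" "y \<in> lower_central_series G n" for x y n
  proof -
    have "y \<in> carrier G" using that lower_central_series_closed by blast
    hence "commutator G y x = inv (commutator G x y)" using that by (simp add: inv_commutator)
    thus ?thesis using that by (auto simp: commutator_subgroup_def intro!: generate.inv)
  qed
  show ?case
  proof (cases k)
    case 0
    thus ?thesis using *[of "fc_eval G S c" "fc_eval G S d" 0] cl by simp
  next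
    case (Suc k')
    hence "2 ^ k' < fc_length c \<or> 2 ^ k' < fc_length d" using Bracket.prems by auto
    thus ?thesis
    proof
      assume "2 ^ k' < fc_length c"
      hence "fc_eval G S c \<in> lower_central_series G (Suc k')" using Bracket by simp
      from **[OF cl(2) this] show ?thesis by (simp add: Suc del: lower_central_series.simps)
    next
      assume "2 ^ k' < fc_length d"
      hence "fc_eval G S d \<in> lower_central_series G (Suc k')" using Bracket by simp
      from *[OF cl(1) this] show ?thesis by (simp add: Suc del: lower_central_series.simps)
    qed
  qed
qed auto

lemma (in group) fc_eval_long:
  assumes S: "set S \<subseteq> carrier G" and n: "lower_central_series G n = {\<one>}"
    and c: "c \<in> formal_commutators S" "2 ^ n < fc_length c"
  shows "fc_eval G S c = \<one>"
proof -
  have "lower_central_series G (Suc n) \<subseteq> {\<one>}"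
    unfolding lower_central_series.simps n commutator_subgroup_def
    by (intro generate_subgroup_incl triv_subgroup) auto
  thus ?thesis using fc_eval_in_lower_central_series[OF S c] by auto
qed

section \<open>Collection of commutators\<close>

definition admissible_scale :: "(nat \<Rightarrow> real) \<Rightarrow> bool" where
  "admissible_scale \<rho> \<longleftrightarrow> (\<forall>i. 1 \<le> \<rho> i)"

lemma scale_ge_1: "admissible_scale \<rho> \<Longrightarrow> 1 \<le> fc_scale \<rho> c"
  using fc_scale_ge_1 by (auto simp: admissible_scale_def)

text \<open>Nilpotency enters only through the vanishing of long formal commutators, which makes descending
  induction on the length possible. All constants below depend on the tuple and on \<open>\<kappa>\<close>, but never on the
  scales: this uniformity is the whole point.\<close>

locale nilpotent_words = group G for G (structure) +
  fixes S :: "'a list" and \<kappa> :: nat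
  assumes S_closed: "set S \<subseteq> carrier G"
    and long_trivial: "\<lbrakk>c \<in> formal_commutators S; \<kappa> < fc_length c\<rbrakk> \<Longrightarrow> fc_eval G S c = \<one>"
begin

abbreviation "cval \<equiv> fc_eval G S"

definition tail :: "nat \<Rightarrow> (nat \<times> bool) formal_commutator set" where
  "tail k = {c \<in> formal_commutators S. k \<le> fc_length c}"

text \<open>Powers of commutators from \<open>X\<close> whose exponent is at most \<open>q\<close> times the scale. A slack \<open>q < 1\<close>
  leaves room for raising to a power of size \<open>1 / q\<close> later.\<close>

definition powers :: "(nat \<Rightarrow> real) \<Rightarrow> (nat \<times> bool) formal_commutator set \<Rightarrow> real \<Rightarrow> 'a set" where
  "powers \<rho> X q = {cval c [^] b | c b. c \<in> X \<and> \<bar>real_of_int b\<bar> \<le> q * fc_scale \<rho> c}"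

abbreviation words ::
    "(nat \<Rightarrow> real) \<Rightarrow> (nat \<times> bool) formal_commutator set \<Rightarrow> real \<Rightarrow> real \<Rightarrow> 'a set" where
  "words \<rho> X q L \<equiv> short_products (powers \<rho> X q) L"

lemma cval_closed [simp]: "c \<in> formal_commutators S \<Longrightarrow> cval c \<in> carrier G"
  using fc_eval_closed[OF S_closed] .

lemma tail_mono: "j \<le> k \<Longrightarrow> tail k \<subseteq> tail j"
  by (auto simp: tail_def)

lemma tail_subset: "tail k \<subseteq> formal_commutators S"
  by (auto simp: tail_def)

lemma powers_closed: "X \<subseteq> formal_commutators S \<Longrightarrow> powers \<rho> X q \<subseteq> carrier G"
  by (auto simp: powers_def)

lemma powersI: "\<lbrakk>c \<in> X; \<bar>real_of_int b\<bar> \<le> q * fc_scale \<rho> c\<rbrakk> \<Longrightarrow> cval c [^] b \<in> powers \<rho> X q"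
  by (auto simp: powers_def)

lemma powers_inv: "\<lbrakk>X \<subseteq> formal_commutators S; g \<in> powers \<rho> X q\<rbrakk> \<Longrightarrow> inv g \<in> powers \<rho> X q"
  by (force simp: powers_def int_pow_neg[symmetric])

lemma powers_mono:
  "\<lbrakk>admissible_scale \<rho>; X \<subseteq> Y; q \<le> q'\<rbrakk> \<Longrightarrow> powers \<rho> X q \<subseteq> powers \<rho> Y q'"
proof
  fix g assume a: "admissible_scale \<rho>" "X \<subseteq> Y" "q \<le> q'" and "g \<in> powers \<rho> X q"
  then obtain c b where "g = cval c [^] b" "c \<in> X" "\<bar>real_of_int b\<bar> \<le> q * fc_scale \<rho> c"
    by (auto simp: powers_def)
  moreover have "q * fc_scale \<rho> c \<le> q' * fc_scale \<rho> c"
    using a scale_ge_1[of \<rho> c] by (intro mult_right_mono) auto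
  ultimately show "g \<in> powers \<rho> Y q'" using a by (auto intro!: powersI)
qed

lemma words_mono:
  "\<lbrakk>admissible_scale \<rho>; X \<subseteq> Y; q \<le> q'; L \<le> L'\<rbrakk> \<Longrightarrow> words \<rho> X q L \<subseteq> words \<rho> Y q' L'"
  by (intro short_products_mono powers_mono)

lemma words_monoD:
  "\<lbrakk>g \<in> words \<rho> X q L; admissible_scale \<rho>; X \<subseteq> Y; q \<le> q'; L \<le> L'\<rbrakk> \<Longrightarrow> g \<in> words \<rho> Y q' L'"
  using words_mono by blast

lemma words_closed: "\<lbrakk>g \<in> words \<rho> X q L; X \<subseteq> formal_commutators S\<rbrakk> \<Longrightarrow> g \<in> carrier G"
  using short_products_closed powers_closed by blast

lemma words_mult:
  "\<lbrakk>g \<in> words \<rho> X q L; h \<in> words \<rho> X q L'; X \<subseteq> formal_commutators S\<rbrakk> \<Longrightarrow>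
    g \<otimes> h \<in> words \<rho> X q (L + L')"
  by (intro mult_in_short_products powers_closed)

lemma words_inv:
  "\<lbrakk>g \<in> words \<rho> X q L; X \<subseteq> formal_commutators S\<rbrakk> \<Longrightarrow> inv g \<in> words \<rho> X q L"
  by (intro inv_in_short_products powers_closed powers_inv)

lemma words_single:
  "\<lbrakk>c \<in> X; \<bar>real_of_int b\<bar> \<le> q * fc_scale \<rho> c; X \<subseteq> formal_commutators S; 1 \<le> L\<rbrakk> \<Longrightarrow>
    cval c [^] b \<in> words \<rho> X q L"
  by (intro single_in_short_products powers_closed powersI)

text \<open>A word of about \<open>n\<close> factors, each with slack \<open>p\<close>, is a word of boundedly many factors with slack
  \<open>n * p\<close>, as long as \<open>n * p \<le> 1\<close>. This discrete integration replaces the Hall--Petrescu formula for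
  powers of products.\<close>

definition collapse_bound :: "(nat \<times> bool) formal_commutator set \<Rightarrow> real \<Rightarrow> real \<Rightarrow> bool" where
  "collapse_bound X M M' \<longleftrightarrow> (\<forall>\<rho> n p g. g \<in> words \<rho> X (M * p) (M * n) \<longrightarrow> admissible_scale \<rho> \<longrightarrow>
     0 < n \<longrightarrow> 0 < p \<longrightarrow> p \<le> 1 \<longrightarrow> n * p \<le> 1 \<longrightarrow> g \<in> words \<rho> X (M' * (n * p)) M')"

definition collapsible :: "(nat \<times> bool) formal_commutator set \<Rightarrow> bool" where
  "collapsible X \<longleftrightarrow> (\<forall>M\<ge>1. \<exists>M'\<ge>1. collapse_bound X M M')"

text \<open>The commutator of two powers with slacks \<open>q1\<close> and \<open>q2\<close> is a bounded word with slack \<open>q1 * q2\<close> in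
  commutators at least as long as the formal bracket.\<close>

definition commutator_bound :: "nat \<Rightarrow> real \<Rightarrow> real \<Rightarrow> bool" where
  "commutator_bound k M M' \<longleftrightarrow> (\<forall>\<rho> c d q1 q2 (a::int) (b::int). admissible_scale \<rho> \<longrightarrow>
     c \<in> formal_commutators S \<longrightarrow> d \<in> formal_commutators S \<longrightarrow> k \<le> fc_length c + fc_length d \<longrightarrow>
     0 < q1 \<longrightarrow> q1 \<le> 1 \<longrightarrow> 0 < q2 \<longrightarrow> q2 \<le> 1 \<longrightarrow>
     \<bar>real_of_int a\<bar> \<le> M * q1 * fc_scale \<rho> c \<longrightarrow> \<bar>real_of_int b\<bar> \<le> M * q2 * fc_scale \<rho> d \<longrightarrow>
     commutator G (cval c [^] a) (cval d [^] b)
       \<in> words \<rho> (tail (fc_length c + fc_length d)) (M' * (q1 * q2)) M')"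

definition commutes_from :: "nat \<Rightarrow> bool" where
  "commutes_from k \<longleftrightarrow> (\<forall>M\<ge>1. \<exists>M'\<ge>1. commutator_bound k M M')"

definition conj_bound :: "nat \<Rightarrow> real \<Rightarrow> real \<Rightarrow> bool" where
  "conj_bound k M M' \<longleftrightarrow> (\<forall>\<rho> c q1 q2 j L g (a::int). g \<in> words \<rho> (tail j) (M * q2) L \<longrightarrow>
     admissible_scale \<rho> \<longrightarrow> c \<in> formal_commutators S \<longrightarrow> k \<le> fc_length c + j \<longrightarrow>
     0 < q1 \<longrightarrow> q1 \<le> 1 \<longrightarrow> 0 < q2 \<longrightarrow> q2 \<le> 1 \<longrightarrow> \<bar>real_of_int a\<bar> \<le> M * q1 * fc_scale \<rho> c \<longrightarrow>
     cval c [^] a \<otimes> g \<otimes> inv (cval c [^] a) \<in> words \<rho> (tail j) (M' * q2) (L * M'))"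

lemmas collapse_boundD = collapse_bound_def[THEN iffD1, rule_format]
  and commutator_boundD = commutator_bound_def[THEN iffD1, rule_format]
  and conj_boundD = conj_bound_def[THEN iffD1, rule_format]

lemma collapsibleE:
  assumes "collapsible X" "1 \<le> M"
  obtains M' where "1 \<le> M'" "collapse_bound X M M'"
  using assms unfolding collapsible_def by blast

lemma commutes_fromE:
  assumes "commutes_from k" "1 \<le> M"
  obtains M' where "1 \<le> M'" "commutator_bound k M M'"
  using assms unfolding commutes_from_def by blast

lemma words_trivial:
  assumes "X \<subseteq> formal_commutators S" "\<And>c. c \<in> X \<Longrightarrow> cval c = \<one>"
  shows "words \<rho> X q L \<subseteq> {\<one>}"
proof -
  have "foldr (\<otimes>) gs \<one> = \<one>" if "set gs \<subseteq> powers \<rho> X q" for gs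
    using that by (induction gs) (auto simp: powers_def assms)
  thus ?thesis by (auto simp: short_products_def)
qed

lemma collapsible_trivial: "\<kappa> < k \<Longrightarrow> collapsible (tail k)"
proof -
  assume "\<kappa> < k"
  hence triv: "words \<rho> (tail k) q L \<subseteq> {\<one>}" for \<rho> q L
    using long_trivial by (intro words_trivial) (auto simp: tail_def)
  have "collapse_bound (tail k) M 1" for M
    unfolding collapse_bound_def using triv one_in_short_products[of 1] by fastforce
  thus ?thesis unfolding collapsible_def by (intro allI impI exI[of _ 1]) simp
qed

lemma commutes_from_trivial: "2 * \<kappa> < k \<Longrightarrow> commutes_from k"
proof -
  assume k: "2 * \<kappa> < k"
  have *: "commutator G (cval c [^] a) (cval d [^] b) = \<one>"
    if "c \<in> formal_commutators S" "d \<in> formal_commutators S" "k \<le> fc_length c + fc_length d"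
    for c d and a b :: int
  proof -
    have "\<kappa> < fc_length c \<or> \<kappa> < fc_length d" using that k by linarith
    thus ?thesis using that long_trivial by auto
  qed
  have "commutator_bound k M 1" for M
    unfolding commutator_bound_def using * one_in_short_products[of 1] by auto
  thus ?thesis unfolding commutes_from_def by (intro allI impI exI[of _ 1]) simp
qed

text \<open>Conjugating a factor produces the factor itself and a commutator with it, so a commutator bound
  becomes a bound for conjugation.\<close>

lemma conj_words:
  assumes K: "commutes_from k" and M: "1 \<le> M"
  obtains M' where "1 \<le> M'" "conj_bound k M M'"
proof -
  obtain M2 where M2: "1 \<le> M2" "commutator_bound k M M2"
    using commutes_fromE[OF K M] by blast
  define M' where "M' = max M M2 + 1"
  have M': "1 \<le> M'" "M \<le> M'" "M2 \<le> M'" "M2 + 1 \<le> M'" using M by (auto simp: M'_def)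
  have "conj_bound k M M'"
    unfolding conj_bound_def
  proof (intro allI impI)
    fix \<rho> c q1 q2 j L g and a :: int
    assume g: "g \<in> words \<rho> (tail j) (M * q2) L" and \<rho>: "admissible_scale \<rho>"
      and c: "c \<in> formal_commutators S" and k: "k \<le> fc_length c + j"
      and q: "0 < q1" "q1 \<le> 1" "0 < q2" "q2 \<le> 1" and a: "\<bar>real_of_int a\<bar> \<le> M * q1 * fc_scale \<rho> c"
    show "cval c [^] a \<otimes> g \<otimes> inv (cval c [^] a) \<in> words \<rho> (tail j) (M' * q2) (L * M')"
    proof (rule short_products_conj[OF powers_closed[OF tail_subset] _ g powers_closed[OF tail_subset]])
      fix h assume "h \<in> powers \<rho> (tail j) (M * q2)"
      then obtain d b where d: "h = cval d [^] b" "d \<in> tail j" "\<bar>real_of_int b\<bar> \<le> M * q2 * fc_scale \<rho> d"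
        by (auto simp: powers_def)
      have dF: "d \<in> formal_commutators S" "j \<le> fc_length d" using d by (auto simp: tail_def)
      have "commutator G (cval c [^] a) h \<in> words \<rho> (tail (fc_length c + fc_length d)) (M2 * (q1 * q2)) M2"
        unfolding d using k q a d(3) dF c by (intro commutator_boundD[OF M2(2)] \<rho>) auto
      moreover have "M2 * (q1 * q2) \<le> M' * q2"
        using mult_mono[of M2 M' "q1 * q2" q2] M' M2(1) q mult_right_mono[of q1 1 q2] by simp
      ultimately have "commutator G (cval c [^] a) h \<in> words \<rho> (tail j) (M' * q2) M2"
        by (elim words_monoD) (use dF in \<open>auto intro!: \<rho> tail_mono\<close>)
      moreover have "M * q2 * fc_scale \<rho> d \<le> M' * q2 * fc_scale \<rho> d"
        using M' q scale_ge_1[OF \<rho>, of d] by (intro mult_right_mono) auto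
      hence "h \<in> words \<rho> (tail j) (M' * q2) 1" unfolding d
        by (intro words_single tail_subset d) (use d(3) in auto)
      ultimately have "commutator G (cval c [^] a) h \<otimes> h \<in> words \<rho> (tail j) (M' * q2) (M2 + 1)"
        by (intro words_mult tail_subset)
      hence "cval c [^] a \<otimes> h \<otimes> inv (cval c [^] a) \<in> words \<rho> (tail j) (M' * q2) (M2 + 1)"
        using c dF by (simp add: conj_eq_commutator_mult d)
      thus "cval c [^] a \<otimes> h \<otimes> inv (cval c [^] a) \<in> words \<rho> (tail j) (M' * q2) M'"
        by (rule words_monoD) (use \<rho> M' in auto)
    qed (use M' c in auto)
  qed
  thus thesis by (rule that[OF M'(1)])
qed

text \<open>One shortest commutator \<open>c\<close> is collected to the right. The accumulated exponent of \<open>c\<close> is of order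
  \<open>n * p\<close> times its scale. Every other factor is conjugated by such a power, which costs commutators of
  length greater than \<open>k\<close> with slack \<open>(n * p) * p \<le> p\<close>. Hence the remaining word still has order \<open>n\<close>
  factors of slack \<open>p\<close> and no longer contains \<open>c\<close>.\<close>

lemma collapsible_insert:
  assumes K: "commutes_from (Suc k)" and k: "1 \<le> k" and X: "collapsible X"
    and Xl: "tail (Suc k) \<subseteq> X" and Xu: "X \<subseteq> tail k"
    and c: "c \<in> formal_commutators S" "fc_length c = k"
  shows "collapsible (insert c X)"
  unfolding collapsible_def
proof (intro allI impI)
  fix M :: real assume M: "1 \<le> M"
  have MM: "M \<le> M * M" "1 \<le> M * M" using M mult_mono[of 1 M 1 M] by auto
  obtain M2 where M2: "1 \<le> M2" "commutator_bound (Suc k) (M * M) M2"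
    using commutes_fromE[OF K MM(2)] by blast
  define M4 where "M4 = max M2 (M * (M2 + 1))"
  have "M * 1 \<le> M * (M2 + 1)" using M2(1) M by (intro mult_left_mono) auto
  hence M4: "1 \<le> M4" "M2 \<le> M4" "M * (M2 + 1) \<le> M4" "M \<le> M4"
    using M2(1) by (auto simp: M4_def le_max_iff_disj)
  obtain M5 where M5: "1 \<le> M5" "collapse_bound X M4 M5"
    using collapsibleE[OF X M4(1)] by blast
  define M' where "M' = max (M5 + 1) (M * M)"
  have XF: "X \<subseteq> formal_commutators S" using Xu tail_subset by blast
  have "collapse_bound (insert c X) M M'"
    unfolding collapse_bound_def
  proof (intro allI impI)
    fix \<rho> and n p :: real and g0
    assume \<rho>: "admissible_scale \<rho>" and n: "0 < n" and p: "0 < p" "p \<le> 1" and np: "n * p \<le> 1"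
      and g0: "g0 \<in> words \<rho> (insert c X) (M * p) (M * n)"
    have sc: "1 \<le> fc_scale \<rho> d" for d using scale_ge_1[OF \<rho>] .
    have np0: "0 < n * p" using n p by simp
    obtain gs where gs: "g0 = foldr (\<otimes>) gs \<one>" "set gs \<subseteq> powers \<rho> (insert c X) (M * p)"
      "real (length gs) \<le> M * n"
      using g0 by (auto simp: short_products_def)
    \<comment> \<open>every factor is either taken from \<open>X\<close> or a power of \<open>c\<close>; the other part is trivial\<close>
    have "\<exists>h \<beta>. gs ! i = h \<otimes> cval c [^] (\<beta>::int) \<and> \<bar>real_of_int \<beta>\<bar> \<le> M * p * fc_scale \<rho> c \<and>
        (h = \<one> \<or> h \<in> powers \<rho> X (M * p))" if i: "i < length gs" for i
    proof -
      have "gs ! i \<in> powers \<rho> (insert c X) (M * p)" using i gs(2) nth_mem by blast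
      then obtain d b where d: "gs ! i = cval d [^] b" "d = c \<or> d \<in> X" "\<bar>real_of_int b\<bar> \<le> M * p * fc_scale \<rho> d"
        by (auto simp: powers_def)
      from d(2) show ?thesis
      proof
        assume "d = c" thus ?thesis using d c by (intro exI[of _ \<one>] exI[of _ b]) auto
      next
        assume "d \<in> X"
        moreover have "0 \<le> M * p * fc_scale \<rho> c" using M p sc[of c] by simp
        ultimately show ?thesis using d XF
          by (intro exI[of _ "gs ! i"] exI[of _ 0]) (auto intro: powersI)
      qed
    qed
    then obtain h \<beta> where h: "\<And>i. i < length gs \<Longrightarrow> gs ! i = h i \<otimes> cval c [^] (\<beta> i :: int)"
        "\<And>i. i < length gs \<Longrightarrow> \<bar>real_of_int (\<beta> i)\<bar> \<le> M * p * fc_scale \<rho> c"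
        "\<And>i. i < length gs \<Longrightarrow> h i = \<one> \<or> h i \<in> powers \<rho> X (M * p)"
      by metis
    have hc: "h i \<in> carrier G" if "i < length gs" for i
      using h(3)[OF that] powers_closed[OF XF] by auto
    have sum_bound: "\<bar>real_of_int (\<Sum>j<i. \<beta> j)\<bar> \<le> M * M * (n * p) * fc_scale \<rho> c" if "i \<le> length gs" for i
    proof -
      have "\<bar>real_of_int (\<Sum>j<i. \<beta> j)\<bar> \<le> (\<Sum>j<i. \<bar>real_of_int (\<beta> j)\<bar>)" by (simp add: sum_abs)
      also have "\<dots> \<le> (\<Sum>j<i. M * p * fc_scale \<rho> c)" by (intro sum_mono h) (use that in auto)
      also have "\<dots> = real i * (M * p * fc_scale \<rho> c)" by simp
      also have "\<dots> \<le> M * n * (M * p * fc_scale \<rho> c)"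
        by (intro mult_right_mono) (use that gs(3) M p sc[of c] in auto)
      finally show ?thesis by (simp add: algebra_simps)
    qed
    define F where "F i = foldr (\<otimes>) (take i gs) \<one>" for i
    have gsc: "set gs \<subseteq> carrier G" using gs(2) powers_closed[of "insert c X"] XF c by blast
    have "\<exists>g \<in> short_products (powers \<rho> X (M4 * p)) (real (length gs) * (M2 + 1)).
        F (length gs) = g \<otimes> cval c [^] (\<Sum>j<length gs. \<beta> j)"
    proof (rule collect_powers[where h = h])
      fix i assume i: "i < length gs"
      show "F (Suc i) = F i \<otimes> h i \<otimes> cval c [^] \<beta> i"
      proof -
        have sub: "set (take i gs) \<subseteq> carrier G" "set [gs ! i] \<subseteq> carrier G"
          using gsc set_take_subset[of i gs] nth_mem[OF i] by auto
        have "F (Suc i) = F i \<otimes> gs ! i" unfolding F_def take_Suc_conv_app_nth[OF i] foldr_append[OF sub]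
          using sub by simp
        moreover have "F i \<in> carrier G" unfolding F_def using sub by (intro foldr_closed)
        ultimately show ?thesis using h(1)[OF i] hc[OF i] c by (simp add: m_assoc)
      qed
      let ?s = "\<Sum>j<i. \<beta> j"
      from h(3)[OF i] show "cval c [^] ?s \<otimes> h i \<otimes> inv (cval c [^] ?s) \<in> words \<rho> X (M4 * p) (M2 + 1)"
      proof
        assume "h i = \<one>"
        thus ?thesis using c M2(1) by (auto intro: one_in_short_products)
      next
        assume hi: "h i \<in> powers \<rho> X (M * p)"
        then obtain d b where d: "h i = cval d [^] b" "d \<in> X" "\<bar>real_of_int b\<bar> \<le> M * p * fc_scale \<rho> d"
          by (auto simp: powers_def)
        have dF: "d \<in> formal_commutators S" "1 \<le> fc_length d" using d XF fc_length_pos by auto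
        have "M * p * fc_scale \<rho> d \<le> M * M * p * fc_scale \<rho> d"
          using MM p sc[of d] by (intro mult_right_mono) auto
        hence "commutator G (cval c [^] ?s) (h i)
            \<in> words \<rho> (tail (fc_length c + fc_length d)) (M2 * ((n * p) * p)) M2"
          unfolding d(1) using d(3) i dF c by (intro commutator_boundD[OF M2(2)] \<rho> sum_bound np np0 p) auto
        moreover have "M2 * ((n * p) * p) \<le> M4 * p"
          using mult_mono[of M2 M4 "(n * p) * p" p] mult_right_mono[of "n * p" 1 p] M4 M2(1) p np np0
          by simp
        moreover have "tail (fc_length c + fc_length d) \<subseteq> X"
          using tail_mono[of "Suc k" "fc_length c + fc_length d"] Xl dF c by auto
        ultimately have "commutator G (cval c [^] ?s) (h i) \<in> words \<rho> X (M4 * p) M2"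
          by (elim words_monoD) (auto intro!: \<rho>)
        moreover have "h i \<in> words \<rho> X (M4 * p) 1"
          unfolding d(1) using d(2,3) M4 p sc[of d] XF
          by (intro words_single order_trans[OF d(3)] mult_right_mono) auto
        ultimately have "commutator G (cval c [^] ?s) (h i) \<otimes> h i \<in> words \<rho> X (M4 * p) (M2 + 1)"
          by (intro words_mult XF)
        thus ?thesis using c dF by (simp add: conj_eq_commutator_mult d(1))
      qed
    qed (use c hc powers_closed[OF XF] in \<open>auto simp: F_def\<close>)
    then obtain g where g: "g \<in> words \<rho> X (M4 * p) (real (length gs) * (M2 + 1))"
      "g0 = g \<otimes> cval c [^] (\<Sum>j<length gs. \<beta> j)"
      by (auto simp: F_def gs(1))
    have "real (length gs) * (M2 + 1) \<le> (M * n) * (M2 + 1)"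
      using gs(3) M2(1) by (intro mult_right_mono) auto
    also have "\<dots> \<le> M4 * n" using mult_right_mono[OF M4(3), of n] n by (simp add: algebra_simps)
    finally have "g \<in> words \<rho> X (M4 * p) (M4 * n)"
      by (intro words_monoD[OF g(1)]) (use \<rho> in auto)
    hence "g \<in> words \<rho> X (M5 * (n * p)) M5" by (intro collapse_boundD[OF M5(2)] \<rho> n p np)
    hence g': "g \<in> words \<rho> (insert c X) (M' * (n * p)) M5"
      by (rule words_monoD) (use \<rho> np0 in \<open>auto simp: M'_def intro!: mult_right_mono\<close>)
    have "M * M * (n * p) * fc_scale \<rho> c \<le> M' * (n * p) * fc_scale \<rho> c"
      using np0 sc[of c] by (intro mult_right_mono) (auto simp: M'_def)
    hence "cval c [^] (\<Sum>j<length gs. \<beta> j) \<in> words \<rho> (insert c X) (M' * (n * p)) 1"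
      by (intro words_single order_trans[OF sum_bound]) (use XF c in auto)
    hence "g0 \<in> words \<rho> (insert c X) (M' * (n * p)) (M5 + 1)"
      unfolding g(2) by (intro words_mult g') (use XF c in auto)
    thus "g0 \<in> words \<rho> (insert c X) (M' * (n * p)) M'"
      by (rule words_monoD) (use \<rho> in \<open>auto simp: M'_def\<close>)
  qed
  moreover have "1 \<le> M'" using MM by (auto simp: M'_def)
  ultimately show "\<exists>M'\<ge>1. collapse_bound (insert c X) M M'" by blast
qed

lemma collapsible_step:
  assumes K: "commutes_from (Suc k)" and k: "1 \<le> k" and X: "collapsible (tail (Suc k))"
  shows "collapsible (tail k)"
proof -
  let ?Y = "{c \<in> formal_commutators S. fc_length c = k}"
  have "finite ?Y" by (rule finite_subset[OF _ finite_formal_commutators_length[of S k]]) auto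
  hence "collapsible (tail (Suc k) \<union> Y)" if "Y \<subseteq> ?Y" for Y
  proof -
    have "finite Y" using that \<open>finite ?Y\<close> finite_subset by blast
    thus ?thesis using that
    proof induction
      case (insert c Y)
      have "collapsible (insert c (tail (Suc k) \<union> Y))"
        by (rule collapsible_insert[OF K k]) (use insert in \<open>auto simp: tail_def\<close>)
      thus ?case by simp
    qed (use X in simp)
  qed
  from this[of ?Y] show ?thesis by (rule back_subst[of collapsible]) (auto simp: tail_def)
qed

section \<open>Powers inside commutators\<close>

text \<open>The intermediate statement in which only the second argument is raised to a power; in
  \<open>bracket_power_bound\<close> both are, and the leading term is the expected power of the bracket.\<close>

definition right_power_bound :: "nat \<Rightarrow> real \<Rightarrow> real \<Rightarrow> bool" where
  "right_power_bound k M M' \<longleftrightarrow> (\<forall>\<rho> c d q (b::nat). admissible_scale \<rho> \<longrightarrow>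
     c \<in> formal_commutators S \<longrightarrow> d \<in> formal_commutators S \<longrightarrow> fc_length c + fc_length d = k \<longrightarrow>
     0 < q \<longrightarrow> q \<le> 1 \<longrightarrow> real b \<le> M * q * fc_scale \<rho> d \<longrightarrow>
     (\<exists>g \<in> words \<rho> (tail (Suc k)) (M' * (q / fc_scale \<rho> c)) M'.
       commutator G (cval c) (cval d [^] int b) = g \<otimes> cval (Bracket c d) [^] int b))"

definition bracket_power_bound :: "nat \<Rightarrow> real \<Rightarrow> real \<Rightarrow> bool" where
  "bracket_power_bound k M M' \<longleftrightarrow> (\<forall>\<rho> c d q1 q2 (a::nat) (b::nat). admissible_scale \<rho> \<longrightarrow>
     c \<in> formal_commutators S \<longrightarrow> d \<in> formal_commutators S \<longrightarrow> fc_length c + fc_length d = k \<longrightarrow>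
     0 < q1 \<longrightarrow> q1 \<le> 1 \<longrightarrow> 0 < q2 \<longrightarrow> q2 \<le> 1 \<longrightarrow>
     real a \<le> M * q1 * fc_scale \<rho> c \<longrightarrow> real b \<le> M * q2 * fc_scale \<rho> d \<longrightarrow>
     (\<exists>g \<in> words \<rho> (tail (Suc k)) (M' * (q1 * q2)) M'.
       commutator G (cval c [^] int a) (cval d [^] int b) = g \<otimes> cval (Bracket c d) [^] int (a * b)))"

lemmas right_power_boundD = right_power_bound_def[THEN iffD1, rule_format]
  and bracket_power_boundD = bracket_power_bound_def[THEN iffD1, rule_format]

text \<open>With \<open>z = [x, y]\<close>, the commutator \<open>[x, y ^ b]\<close> is the product of the conjugates of \<open>z\<close> by
  \<open>y ^ j\<close> for \<open>j < b\<close>, that is, of the elements \<open>[y ^ j, z] z\<close>. Collecting the \<open>z\<close> on the right leaves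
  about \<open>b\<close> words in longer commutators, whose product collapses.\<close>

lemma commutator_power_right:
  assumes K: "commutes_from (Suc k)" and X: "collapsible (tail (Suc k))" and M: "1 \<le> M"
  obtains M' where "1 \<le> M'" "right_power_bound k M M'"
proof -
  obtain M1 where M1: "1 \<le> M1" "commutator_bound (Suc k) M M1"
    using commutes_fromE[OF K M] by blast
  define N1 where "N1 = max M M1"
  have N1: "1 \<le> N1" "M \<le> N1" "M1 \<le> N1" using M by (auto simp: N1_def)
  obtain M2 where M2: "1 \<le> M2" "conj_bound (Suc k) N1 M2"
    using conj_words[OF K N1(1)] by blast
  define N2 where "N2 = max M2 (M * (M1 * M2))"
  have N2: "1 \<le> N2" "M2 \<le> N2" "M * (M1 * M2) \<le> N2" using M2(1) by (auto simp: N2_def)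
  obtain M3 where M3: "1 \<le> M3" "collapse_bound (tail (Suc k)) N2 M3"
    using collapsibleE[OF X N2(1)] by blast
  have "right_power_bound k M M3"
    unfolding right_power_bound_def
  proof (intro allI impI)
    fix \<rho> c d and q :: real and b :: nat
    assume \<rho>: "admissible_scale \<rho>"
      and c: "c \<in> formal_commutators S" and d: "d \<in> formal_commutators S"
      and k: "fc_length c + fc_length d = k"
      and q: "0 < q" "q \<le> 1" and b: "real b \<le> M * q * fc_scale \<rho> d"
    define z where "z = Bracket c d"
    have z: "z \<in> formal_commutators S" "fc_length z = k" "fc_scale \<rho> z = fc_scale \<rho> c * fc_scale \<rho> d"
      "cval z = commutator G (cval c) (cval d)"
      using c d k by (auto simp: z_def)
    have sc: "1 \<le> fc_scale \<rho> e" for e using scale_ge_1[OF \<rho>] .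
    have sc0: "0 < fc_scale \<rho> e" for e using sc[of e] by linarith
    have len: "1 \<le> fc_length e" for e :: "(nat \<times> bool) formal_commutator" by (rule fc_length_pos)
    let ?y = "cval d" and ?p = "1 / fc_scale \<rho> z"
    have p: "0 < ?p" "?p \<le> 1" using sc0[of z] sc[of z] by auto
    have qc: "0 < q / fc_scale \<rho> c" "q / fc_scale \<rho> c \<le> 1"
      using q sc0[of c] sc[of c] by auto
    have h: "commutator G (?y [^] int j) (cval z) \<in> words \<rho> (tail (Suc k)) (M1 * ?p) M1"
      if j: "j \<le> b" for j
    proof -
      have "commutator G (?y [^] int j) (cval z [^] (1::int))
          \<in> words \<rho> (tail (fc_length d + fc_length z)) (M1 * (q * ?p)) M1"
        using j b k z len[of d] q p sc0[of z] M by (intro commutator_boundD[OF M1(2) \<rho> d z(1)]) auto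
      moreover have "M1 * (q * ?p) \<le> M1 * ?p"
        using M1(1) q p mult_right_mono[of q 1 ?p] by (intro mult_left_mono) auto
      ultimately show ?thesis
        using z c d len[of d] by (simp, elim words_monoD) (auto intro!: tail_mono \<rho>)
    qed
    \<comment> \<open>the words \<open>[y ^ j, z]\<close> after all earlier copies of \<open>z\<close> have passed over them\<close>
    have hj: "cval z [^] int j \<otimes> commutator G (?y [^] int j) (cval z) \<otimes> inv (cval z [^] int j)
        \<in> words \<rho> (tail (Suc k)) (M2 * ?p) (M1 * M2)" if j: "j \<le> b" for j
    proof (rule conj_boundD[OF M2(2), where ?q1.0 = "q / fc_scale \<rho> c"])
      show "commutator G (?y [^] int j) (cval z) \<in> words \<rho> (tail (Suc k)) (N1 * ?p) M1"
        using h[OF j] by (rule words_monoD) (use \<rho> N1 p in \<open>auto intro!: divide_right_mono\<close>)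
      have "real j \<le> M * q * fc_scale \<rho> d" using j b by linarith
      also have "\<dots> = M * (q / fc_scale \<rho> c) * fc_scale \<rho> z" using sc0[of c] by (simp add: z)
      also have "\<dots> \<le> N1 * (q / fc_scale \<rho> c) * fc_scale \<rho> z"
        using N1 sc0[of z] qc by (intro mult_right_mono) auto
      finally show "\<bar>real_of_int (int j)\<bar> \<le> N1 * (q / fc_scale \<rho> c) * fc_scale \<rho> z" by simp
    qed (use \<rho> z qc p in auto)
    define F where "F i = commutator G (cval c) (?y [^] int i)" for i
    have "\<exists>g \<in> words \<rho> (tail (Suc k)) (M2 * ?p) (real b * (M1 * M2)).
        F b = g \<otimes> cval z [^] (\<Sum>j<b. (1::int))"
    proof (rule collect_powers[where h = "\<lambda>i. commutator G (?y [^] int i) (cval z)"])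
      fix i assume "i < b"
      have step: "F (Suc i) = F i \<otimes> (?y [^] int i \<otimes> cval z \<otimes> inv (?y [^] int i))"
      proof -
        have "?y [^] int (Suc i) = ?y [^] int i \<otimes> ?y"
          using d int_pow_mult[of ?y "int i" 1] by (simp add: add.commute)
        thus ?thesis unfolding F_def z(4) using c d by (simp add: word_simps)
      qed
      have conj: "?y [^] int i \<otimes> cval z \<otimes> inv (?y [^] int i) = commutator G (?y [^] int i) (cval z) \<otimes> cval z"
        using d z(1) by (intro conj_eq_commutator_mult) auto
      show "F (Suc i) = F i \<otimes> commutator G (?y [^] int i) (cval z) \<otimes> cval z [^] (1::int)"
        unfolding step conj using c d z(1) by (simp add: F_def m_assoc)
    next
      fix i assume "i < b"
      thus "cval z [^] (\<Sum>j<i. (1::int)) \<otimes> commutator G (?y [^] int i) (cval z)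
          \<otimes> inv (cval z [^] (\<Sum>j<i. (1::int))) \<in> words \<rho> (tail (Suc k)) (M2 * ?p) (M1 * M2)"
        using hj[of i] by simp
    qed (use c d z powers_closed[OF tail_subset] in \<open>auto simp: F_def\<close>)
    then obtain g where g: "g \<in> words \<rho> (tail (Suc k)) (M2 * ?p) (real b * (M1 * M2))"
      "F b = g \<otimes> cval z [^] int b" by auto
    have "real b * (M1 * M2) \<le> (M * q * fc_scale \<rho> d) * (M1 * M2)"
      using b M1(1) M2(1) by (intro mult_right_mono) auto
    also have "\<dots> = M * (M1 * M2) * (q * fc_scale \<rho> d)" by simp
    also have "\<dots> \<le> N2 * (q * fc_scale \<rho> d)"
      using N2 q sc0[of d] by (intro mult_right_mono) auto
    finally have g': "g \<in> words \<rho> (tail (Suc k)) (N2 * ?p) (N2 * (q * fc_scale \<rho> d))"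
      by (intro words_monoD[OF g(1)] mult_right_mono N2) (use \<rho> p in auto)
    have eq: "q * fc_scale \<rho> d * ?p = q / fc_scale \<rho> c"
      using sc0[of c] sc0[of d] by (simp add: z)
    have "g \<in> words \<rho> (tail (Suc k)) (M3 * (q * fc_scale \<rho> d * ?p)) M3"
      using q sc0[of d] p qc by (intro collapse_boundD[OF M3(2) g' \<rho>]) (simp_all only: eq mult_pos_pos)
    thus "\<exists>g \<in> words \<rho> (tail (Suc k)) (M3 * (q / fc_scale \<rho> c)) M3.
        commutator G (cval c) (?y [^] int b) = g \<otimes> cval (Bracket c d) [^] int b"
      using g(2) unfolding eq F_def z_def[symmetric] by (intro bexI[of _ g])
  qed
  thus thesis by (rule that[OF M3(1)])
qed

text \<open>The same argument in the first variable: with \<open>Y = y ^ b\<close>, the commutator \<open>[Y, x ^ a]\<close> is the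
  product of the conjugates of \<open>[Y, x]\<close> by \<open>x ^ i\<close> for \<open>i < a\<close>, and \<open>[Y, x]\<close> is known up to longer
  commutators. The chain of constants \<open>M1\<close>, \<open>N1\<close>, ... only records that each estimate is applied to the
  output of the previous one.\<close>

lemma commutator_powers:
  assumes K: "commutes_from (Suc k)" and X: "collapsible (tail (Suc k))" and M: "1 \<le> M"
  obtains M' where "1 \<le> M'" "bracket_power_bound k M M'"
proof -
  have MM: "1 \<le> M * M" "M \<le> M * M" using M mult_mono[of 1 M 1 M] by auto
  obtain M1 where M1: "1 \<le> M1" "right_power_bound k M M1"
    using commutator_power_right[OF K X M] by blast
  define N1 where "N1 = max (M * M) M1"
  have N1: "1 \<le> N1" "M * M \<le> N1" "M \<le> N1" "M1 \<le> N1" using MM by (auto simp: N1_def)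
  obtain M2 where M2: "1 \<le> M2" "conj_bound (Suc k) N1 M2"
    using conj_words[OF K N1(1)] by blast
  define N2 where "N2 = max N1 M2"
  have N2: "1 \<le> N2" "N1 \<le> N2" "M2 \<le> N2" using N1 by (auto simp: N2_def)
  obtain M3 where M3: "1 \<le> M3" "conj_bound (Suc k) N2 M3"
    using conj_words[OF K N2(1)] by blast
  obtain M4 where M4: "1 \<le> M4" "commutator_bound (Suc k) M M4"
    using commutes_fromE[OF K M] by blast
  define N3 where "N3 = max (max M3 M4) N1"
  define L3 where "L3 = M1 * M2 * M3 + M4"
  have N3: "1 \<le> N3" "M3 \<le> N3" "M4 \<le> N3" "N1 \<le> N3" using N1 by (auto simp: N3_def)
  have L3: "0 \<le> L3" unfolding L3_def using M1(1) M2(1) M3(1) M4(1) by simp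
  obtain M5 where M5: "1 \<le> M5" "conj_bound (Suc k) N3 M5"
    using conj_words[OF K N3(1)] by blast
  define N5 where "N5 = max M5 (M * (L3 * M5))"
  have N5: "1 \<le> N5" "M5 \<le> N5" "M * (L3 * M5) \<le> N5" using M5(1) by (auto simp: N5_def)
  obtain M6 where M6: "1 \<le> M6" "collapse_bound (tail (Suc k)) N5 M6"
    using collapsibleE[OF X N5(1)] by blast
  define N6 where "N6 = max M6 N1"
  have N6: "1 \<le> N6" "M6 \<le> N6" "N1 \<le> N6" using N1 by (auto simp: N6_def)
  obtain M7 where M7: "1 \<le> M7" "conj_bound (Suc k) N6 M7"
    using conj_words[OF K N6(1)] by blast
  have M67: "1 \<le> M6 * M7" "M7 \<le> M6 * M7" using M6(1) M7(1) mult_mono[of 1 M6 1 M7] by auto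
  have "bracket_power_bound k M (M6 * M7)"
    unfolding bracket_power_bound_def
  proof (intro allI impI)
    fix \<rho> c d and q1 q2 :: real and a b :: nat
    assume \<rho>: "admissible_scale \<rho>"
      and c: "c \<in> formal_commutators S" and d: "d \<in> formal_commutators S"
      and k: "fc_length c + fc_length d = k"
      and q: "0 < q1" "q1 \<le> 1" "0 < q2" "q2 \<le> 1"
      and a: "real a \<le> M * q1 * fc_scale \<rho> c" and b: "real b \<le> M * q2 * fc_scale \<rho> d"
    define z where "z = Bracket c d"
    have z: "z \<in> formal_commutators S" "fc_length z = k" "fc_scale \<rho> z = fc_scale \<rho> c * fc_scale \<rho> d"
      "cval z = commutator G (cval c) (cval d)"
      using c d k by (auto simp: z_def)
    have sc: "1 \<le> fc_scale \<rho> e" for e using scale_ge_1[OF \<rho>] .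
    have sc0: "0 < fc_scale \<rho> e" for e using sc[of e] by linarith
    have len: "1 \<le> fc_length e" for e :: "(nat \<times> bool) formal_commutator" by (rule fc_length_pos)
    let ?x = "cval c" and ?p = "q2 / fc_scale \<rho> c"
    define Y where "Y = cval d [^] int b"
    have Y: "Y \<in> carrier G" using d by (simp add: Y_def)
    have p: "0 < ?p" "?p \<le> 1" using q sc0[of c] sc[of c] by auto
    have qq: "0 < q1 * q2" "q1 * q2 \<le> 1" using q by (auto simp: mult_le_one)
    obtain g where g: "g \<in> words \<rho> (tail (Suc k)) (M1 * ?p) M1"
      and gY: "commutator G ?x Y = g \<otimes> cval z [^] int b"
      using right_power_boundD[OF M1(2) \<rho> c d k q(3,4) b] by (auto simp: z_def Y_def)
    have gc: "g \<in> carrier G" using words_closed[OF g tail_subset] .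
    have b': "real b \<le> M * ?p * fc_scale \<rho> z" using b sc0[of c] by (simp add: z)
    have scale_up: "x \<le> N * r * fc_scale \<rho> e" if "x \<le> M * r * fc_scale \<rho> e" "M \<le> N" "0 < r" for x N r e
      by (rule order_trans[OF that(1)]) (use that sc0[of e] in \<open>auto intro!: mult_right_mono\<close>)
    have scale_up': "x \<le> N * r * fc_scale \<rho> e" if "x \<le> (M * M) * r * fc_scale \<rho> e" "M * M \<le> N" "0 < r"
      for x N r e
      by (rule order_trans[OF that(1)]) (use that sc0[of e] in \<open>auto intro!: mult_right_mono\<close>)
    have words_up: "w \<in> words \<rho> (tail (Suc k)) (N' * r) L" if "w \<in> words \<rho> (tail (Suc k)) (N * r) L"
      "N \<le> N'" "0 < r" for w N N' r L
      by (rule words_monoD[OF that(1)]) (use that \<rho> in \<open>auto intro!: mult_right_mono\<close>)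
    \<comment> \<open>the commutator with exchanged arguments, with the power of the bracket on the right\<close>
    define g1 where "g1 = cval z [^] (- int b) \<otimes> inv g \<otimes> inv (cval z [^] (- int b))"
    have g1: "g1 \<in> words \<rho> (tail (Suc k)) (M2 * ?p) (M1 * M2)" unfolding g1_def
    proof (rule conj_boundD[OF M2(2), where ?q1.0 = ?p])
      show "inv g \<in> words \<rho> (tail (Suc k)) (N1 * ?p) M1"
        using words_up[OF words_inv[OF g tail_subset] N1(4) p(1)] .
      show "\<bar>real_of_int (- int b)\<bar> \<le> N1 * ?p * fc_scale \<rho> z"
        using scale_up[OF b' N1(3) p(1)] by simp
    qed (use \<rho> z p in auto)
    have g1c: "g1 \<in> carrier G" using words_closed[OF g1 tail_subset] .
    have gY': "commutator G Y ?x = g1 \<otimes> cval z [^] (- int b)"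
    proof -
      have "commutator G Y ?x = inv (commutator G ?x Y)" using c Y by (simp add: inv_commutator)
      also have "\<dots> = inv (g \<otimes> cval z [^] int b)" by (simp only: gY)
      also have "\<dots> = g1 \<otimes> cval z [^] (- int b)"
        using gc z(1) by (simp add: g1_def int_pow_neg word_simps)
      finally show ?thesis .
    qed
    define h where "h i = (?x [^] int i \<otimes> g1 \<otimes> inv (?x [^] int i)) \<otimes>
        commutator G (?x [^] int i) (cval z [^] (- int b))" for i
    have hc: "h i \<in> carrier G" for i using c z(1) g1c by (simp add: h_def)
    have h: "h i \<in> words \<rho> (tail (Suc k)) (N3 * ?p) L3" if i: "i \<le> a" for i
    proof -
      have i': "\<bar>real_of_int (int i)\<bar> \<le> M * q1 * fc_scale \<rho> c" using i a by simp
      have "?x [^] int i \<otimes> g1 \<otimes> inv (?x [^] int i)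
          \<in> words \<rho> (tail (Suc k)) (M3 * ?p) (M1 * M2 * M3)"
      proof (rule conj_boundD[OF M3(2), where ?q1.0 = q1])
        show "g1 \<in> words \<rho> (tail (Suc k)) (N2 * ?p) (M1 * M2)" using words_up[OF g1 N2(3) p(1)] .
        show "\<bar>real_of_int (int i)\<bar> \<le> N2 * q1 * fc_scale \<rho> c"
          by (rule scale_up[OF i']) (use N1 N2 q in auto)
      qed (use \<rho> c p q in auto)
      moreover have "commutator G (?x [^] int i) (cval z [^] (- int b))
          \<in> words \<rho> (tail (Suc k)) (M4 * ?p) M4"
      proof -
        have "commutator G (?x [^] int i) (cval z [^] (- int b))
          \<in> words \<rho> (tail (fc_length c + fc_length z)) (M4 * (q1 * ?p)) M4"
          using i' b' z len[of c] q p by (intro commutator_boundD[OF M4(2) \<rho> c z(1)]) auto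
        moreover have "M4 * (q1 * ?p) \<le> M4 * ?p"
          using M4(1) q p mult_right_mono[of q1 1 ?p] by (intro mult_left_mono) auto
        ultimately show ?thesis using z len[of c] by (elim words_monoD) (auto intro!: tail_mono \<rho>)
      qed
      ultimately show ?thesis unfolding h_def L3_def
        by (intro words_mult tail_subset) (erule words_up[OF _ N3(2) p(1)], erule words_up[OF _ N3(3) p(1)])
    qed
    have ab: "\<bar>real_of_int (- int (i * b))\<bar> \<le> (M * M) * (q1 * q2) * fc_scale \<rho> z" if i: "i \<le> a" for i
    proof -
      have "real i * real b \<le> (M * q1 * fc_scale \<rho> c) * (M * q2 * fc_scale \<rho> d)"
        using a b i by (intro mult_mono) auto
      thus ?thesis by (simp add: z algebra_simps)
    qed
    define F where "F i = commutator G Y (?x [^] int i)" for i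
    have sumb: "(\<Sum>j<i. - int b) = - int (i * b)" for i by simp
    have "\<exists>g \<in> words \<rho> (tail (Suc k)) (M5 * ?p) (real a * (L3 * M5)).
        F a = g \<otimes> cval z [^] (\<Sum>j<a. - int b)"
    proof (rule collect_powers[where h = h])
      fix i assume "i < a"
      have "F (Suc i) = F i \<otimes> (?x [^] int i \<otimes> commutator G Y ?x \<otimes> inv (?x [^] int i))"
      proof -
        have "?x [^] int (Suc i) = ?x [^] int i \<otimes> ?x"
          using c int_pow_mult[of ?x "int i" 1] by (simp add: add.commute)
        thus ?thesis unfolding F_def using c Y by (simp add: word_simps)
      qed
      also have "\<dots> = F i \<otimes> h i \<otimes> cval z [^] (- int b)"
        unfolding gY' using c Y z(1) g1c by (simp add: h_def F_def word_simps)
      finally show "F (Suc i) = F i \<otimes> h i \<otimes> cval z [^] (- int b)" .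
    next
      fix i assume i: "i < a"
      show "cval z [^] (\<Sum>j<i. - int b) \<otimes> h i \<otimes> inv (cval z [^] (\<Sum>j<i. - int b))
          \<in> words \<rho> (tail (Suc k)) (M5 * ?p) (L3 * M5)"
        unfolding sumb
      proof (rule conj_boundD[OF M5(2), where ?q1.0 = "q1 * q2"])
        show "\<bar>real_of_int (- int (i * b))\<bar> \<le> N3 * (q1 * q2) * fc_scale \<rho> z"
          by (rule scale_up'[OF ab]) (use i N1 N3 qq in auto)
      qed (use i h[of i] \<rho> z p qq in auto)
    qed (use c z(1) hc Y powers_closed[OF tail_subset] in \<open>auto simp: F_def\<close>)
    then obtain g2 where g2: "g2 \<in> words \<rho> (tail (Suc k)) (M5 * ?p) (real a * (L3 * M5))"
      "F a = g2 \<otimes> cval z [^] (- int (a * b))" unfolding sumb by auto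
    have g2c: "g2 \<in> carrier G" using words_closed[OF g2(1) tail_subset] .
    have "real a * (L3 * M5) \<le> (M * q1 * fc_scale \<rho> c) * (L3 * M5)"
      using a L3 M5(1) by (intro mult_right_mono) auto
    also have "\<dots> = M * (L3 * M5) * (q1 * fc_scale \<rho> c)" by simp
    also have "\<dots> \<le> N5 * (q1 * fc_scale \<rho> c)"
      using N5 q sc0[of c] by (intro mult_right_mono) auto
    finally have g2': "g2 \<in> words \<rho> (tail (Suc k)) (N5 * ?p) (N5 * (q1 * fc_scale \<rho> c))"
      by (intro words_monoD[OF g2(1)] mult_right_mono N5) (use \<rho> p in auto)
    have eq: "q1 * fc_scale \<rho> c * ?p = q1 * q2" using sc0[of c] by simp
    have "g2 \<in> words \<rho> (tail (Suc k)) (M6 * (q1 * fc_scale \<rho> c * ?p)) M6"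
      using q sc0[of c] p qq by (intro collapse_boundD[OF M6(2) g2' \<rho>]) (simp_all only: eq mult_pos_pos)
    hence g2'': "inv g2 \<in> words \<rho> (tail (Suc k)) (M6 * (q1 * q2)) M6"
      unfolding eq by (intro words_inv tail_subset)
    define g3 where "g3 = cval z [^] int (a * b) \<otimes> inv g2 \<otimes> inv (cval z [^] int (a * b))"
    have "g3 \<in> words \<rho> (tail (Suc k)) (M7 * (q1 * q2)) (M6 * M7)" unfolding g3_def
    proof (rule conj_boundD[OF M7(2), where ?q1.0 = "q1 * q2"])
      show "inv g2 \<in> words \<rho> (tail (Suc k)) (N6 * (q1 * q2)) M6" using words_up[OF g2'' N6(2) qq(1)] .
      show "\<bar>real_of_int (int (a * b))\<bar> \<le> N6 * (q1 * q2) * fc_scale \<rho> z"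
        using scale_up'[OF ab[of a], of N6] N1 N6 qq by simp
    qed (use \<rho> z qq in auto)
    hence "g3 \<in> words \<rho> (tail (Suc k)) (M6 * M7 * (q1 * q2)) (M6 * M7)"
      by (rule words_up) (use M67 qq in auto)
    moreover have "commutator G (?x [^] int a) Y = g3 \<otimes> cval z [^] int (a * b)"
    proof -
      have "commutator G (?x [^] int a) Y = inv (F a)" using c Y by (simp add: F_def inv_commutator)
      also have "\<dots> = g3 \<otimes> cval z [^] int (a * b)"
        unfolding g2(2) g3_def using g2c z(1) by (simp add: int_pow_neg word_simps del: of_nat_mult)
      finally show ?thesis .
    qed
    ultimately show "\<exists>g \<in> words \<rho> (tail (Suc k)) (M6 * M7 * (q1 * q2)) (M6 * M7).
      commutator G (cval c [^] int a) (cval d [^] int b) = g \<otimes> cval (Bracket c d) [^] int (a * b)"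
      unfolding z_def[symmetric] Y_def[symmetric] by (intro bexI[of _ g3])
  qed
  thus thesis by (rule that[OF M67(1)])
qed

lemma commutes_from_step:
  assumes K: "commutes_from (Suc k)" and X: "collapsible (tail (Suc k))"
  shows "commutes_from k"
  unfolding commutes_from_def
proof (intro allI impI)
  fix M :: real assume M: "1 \<le> M"
  have MM: "1 \<le> M * M" "M \<le> M * M" using M mult_mono[of 1 M 1 M] by auto
  obtain M1 where M1: "1 \<le> M1" "bracket_power_bound k M M1"
    using commutator_powers[OF K X M] by blast
  obtain M0 where M0: "1 \<le> M0" "commutator_bound (Suc k) M M0"
    using commutes_fromE[OF K M] by blast
  define N1 where "N1 = max (M1 + 1) (M * M)"
  have N1: "1 \<le> N1" "M1 \<le> N1" "M * M \<le> N1" "M1 + 1 \<le> N1" "M \<le> N1"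
    using MM by (simp_all add: N1_def le_max_iff_disj)
  obtain M2 where M2: "1 \<le> M2" "conj_bound (Suc k) N1 M2"
    using conj_words[OF K N1(1)] by blast
  define N2 where "N2 = max (N1 * M2) N1"
  have N2: "1 \<le> N2" "N1 \<le> N2" "N1 * M2 \<le> N2" "M2 \<le> N2"
    using N1(1) M2(1) mult_right_mono[of 1 N1 M2] mult_mono[of 1 N1 1 M2] by (auto simp: N2_def le_max_iff_disj)
  obtain M3 where M3: "1 \<le> M3" "conj_bound (Suc k) N2 M3"
    using conj_words[OF K N2(1)] by blast
  define M' where "M' = max M0 (max N2 (N2 * M3))"
  have M': "1 \<le> M'" "M0 \<le> M'" "N2 \<le> M'" "N2 * M3 \<le> M'" "M3 \<le> M'"
    using M0(1) N2(1) M3(1) mult_right_mono[of 1 N2 M3] mult_mono[of 1 N2 1 M3] by (auto simp: M'_def le_max_iff_disj)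
  have "commutator_bound k M M'"
    unfolding commutator_bound_def
  proof (intro allI impI)
    fix \<rho> c d and q1 q2 :: real and a b :: int
    assume \<rho>: "admissible_scale \<rho>"
      and c: "c \<in> formal_commutators S" and d: "d \<in> formal_commutators S"
      and k: "k \<le> fc_length c + fc_length d"
      and q: "0 < q1" "q1 \<le> 1" "0 < q2" "q2 \<le> 1"
      and a: "\<bar>real_of_int a\<bar> \<le> M * q1 * fc_scale \<rho> c" and b: "\<bar>real_of_int b\<bar> \<le> M * q2 * fc_scale \<rho> d"
    have sc0: "0 < fc_scale \<rho> e" for e using scale_ge_1[OF \<rho>, of e] by linarith
    have len: "1 \<le> fc_length e" for e :: "(nat \<times> bool) formal_commutator" by (rule fc_length_pos)
    have qq: "0 < q1 * q2" "q1 * q2 \<le> 1" using q by (auto simp: mult_le_one)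
    have words_up: "w \<in> words \<rho> (tail j) (N' * r) L'" if "w \<in> words \<rho> (tail j) (N * r) L"
      "N \<le> N'" "L \<le> L'" "0 < r" for w N N' r L L' j
      by (rule words_monoD[OF that(1)]) (use that \<rho> in \<open>auto intro!: mult_right_mono\<close>)
    have scale_up: "x \<le> N * r * fc_scale \<rho> e" if "x \<le> M * r * fc_scale \<rho> e" "M \<le> N" "0 < r" for x N r e
      by (rule order_trans[OF that(1)]) (use that sc0[of e] in \<open>auto intro!: mult_right_mono\<close>)
    show "commutator G (cval c [^] a) (cval d [^] b)
       \<in> words \<rho> (tail (fc_length c + fc_length d)) (M' * (q1 * q2)) M'"
    proof (cases "fc_length c + fc_length d = k")
      case False
      hence "commutator G (cval c [^] a) (cval d [^] b)
          \<in> words \<rho> (tail (fc_length c + fc_length d)) (M0 * (q1 * q2)) M0"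
        using k by (intro commutator_boundD[OF M0(2) \<rho> c d _ q a b]) auto
      thus ?thesis by (rule words_up) (use M' qq in auto)
    next
      case kk: True
      \<comment> \<open>nonnegative exponents first; a sign is moved out of the commutator by a conjugation\<close>
      have nn: "commutator G (cval c [^] int i) (cval d [^] int j) \<in> words \<rho> (tail k) (N1 * (q1 * q2)) N1"
        if ij: "real i \<le> M * q1 * fc_scale \<rho> c" "real j \<le> M * q2 * fc_scale \<rho> d" for i j
      proof -
        obtain g where g: "g \<in> words \<rho> (tail (Suc k)) (M1 * (q1 * q2)) M1"
          "commutator G (cval c [^] int i) (cval d [^] int j) = g \<otimes> cval (Bracket c d) [^] int (i * j)"
          using bracket_power_boundD[OF M1(2) \<rho> c d kk q ij] by blast
        have g': "g \<in> words \<rho> (tail k) (N1 * (q1 * q2)) M1"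
          by (rule words_monoD[OF g(1)]) (use \<rho> N1 qq in \<open>auto intro!: tail_mono mult_right_mono\<close>)
        have "real i * real j \<le> (M * q1 * fc_scale \<rho> c) * (M * q2 * fc_scale \<rho> d)"
          using ij by (intro mult_mono) auto
        hence "\<bar>real_of_int (int (i * j))\<bar> \<le> (M * M) * (q1 * q2) * fc_scale \<rho> (Bracket c d)"
          by (simp add: algebra_simps)
        also have "\<dots> \<le> N1 * (q1 * q2) * fc_scale \<rho> (Bracket c d)"
          using N1 qq sc0[of "Bracket c d"] by (intro mult_right_mono) auto
        finally have "cval (Bracket c d) [^] int (i * j) \<in> words \<rho> (tail k) (N1 * (q1 * q2)) 1"
          using c d kk by (intro words_single tail_subset) (auto simp: tail_def)
        with g' have "g \<otimes> cval (Bracket c d) [^] int (i * j) \<in> words \<rho> (tail k) (N1 * (q1 * q2)) (M1 + 1)"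
          by (intro words_mult tail_subset)
        thus ?thesis unfolding g(2) by (rule words_monoD) (use \<rho> N1 in auto)
      qed
      define i where "i = nat \<bar>a\<bar>"
      have i: "real i \<le> M * q1 * fc_scale \<rho> c" "a = int i \<or> a = - int i" using a by (auto simp: i_def)
      define Y where "Y = cval d [^] b"
      have Y: "Y \<in> carrier G" using d by (simp add: Y_def)
      have *: "commutator G (cval c [^] int i) Y \<in> words \<rho> (tail k) (N2 * (q1 * q2)) N2"
      proof (cases "0 \<le> b")
        case True
        hence "commutator G (cval c [^] int i) Y \<in> words \<rho> (tail k) (N1 * (q1 * q2)) N1"
          using nn[of i "nat b"] i b by (simp add: Y_def)
        thus ?thesis by (rule words_up) (use N2 qq in auto)
      next
        case False
        define y where "y = cval d [^] (- b)"
        have y: "y \<in> carrier G" "Y = inv y" using d by (auto simp: y_def Y_def int_pow_neg)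
        have "commutator G (cval c [^] int i) y \<in> words \<rho> (tail k) (N1 * (q1 * q2)) N1"
          using nn[of i "nat (- b)"] i b False by (simp add: y_def)
        hence "inv (commutator G (cval c [^] int i) y) \<in> words \<rho> (tail k) (N1 * (q1 * q2)) N1"
          by (intro words_inv tail_subset)
        hence "Y \<otimes> inv (commutator G (cval c [^] int i) y) \<otimes> inv Y
            \<in> words \<rho> (tail k) (M2 * (q1 * q2)) (N1 * M2)"
          unfolding Y_def
          by (rule conj_boundD[OF M2(2), where ?q1.0 = q2]) (use \<rho> d q qq len[of d] scale_up[OF b N1(5)] in auto)
        also have "Y \<otimes> inv (commutator G (cval c [^] int i) y) \<otimes> inv Y = commutator G (cval c [^] int i) Y"
          using y c by (simp add: word_simps)
        finally show ?thesis by (rule words_up) (use N2 qq in auto)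
      qed
      from i(2) have "commutator G (cval c [^] a) Y \<in> words \<rho> (tail k) (M' * (q1 * q2)) M'"
      proof
        assume "a = int i"
        show ?thesis unfolding \<open>a = int i\<close> by (rule words_up[OF *]) (use M' qq in auto)
      next
        assume ai: "a = - int i"
        define x where "x = cval c [^] int i"
        have x: "x \<in> carrier G" "cval c [^] a = inv x" using c by (auto simp: x_def ai int_pow_neg)
        have "inv (commutator G x Y) \<in> words \<rho> (tail k) (N2 * (q1 * q2)) N2"
          using * unfolding x_def by (intro words_inv tail_subset)
        hence "cval c [^] a \<otimes> inv (commutator G x Y) \<otimes> inv (cval c [^] a)
            \<in> words \<rho> (tail k) (M3 * (q1 * q2)) (N2 * M3)"
          by (rule conj_boundD[OF M3(2), where ?q1.0 = q1])
            (use \<rho> c q qq len[of c] scale_up[OF a, of N2] N1 N2 in auto)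
        also have "cval c [^] a \<otimes> inv (commutator G x Y) \<otimes> inv (cval c [^] a) = commutator G (cval c [^] a) Y"
          unfolding x(2) using x(1) Y by (simp add: word_simps)
        finally show ?thesis by (rule words_up) (use M' qq in auto)
      qed
      thus ?thesis by (simp add: Y_def kk)
    qed
  qed
  thus "\<exists>M'\<ge>1. commutator_bound k M M'" using M'(1) by blast
qed

text \<open>Both properties are proved together by descending induction: collapsing at length \<open>k\<close> needs
  commutators beyond \<open>k\<close>, and commutators of total length \<open>k\<close> need both properties beyond \<open>k\<close>.\<close>

lemma collapsible_and_commutes:
  assumes "1 \<le> k"
  shows "collapsible (tail k) \<and> commutes_from k"
proof -
  have "collapsible (tail k) \<and> commutes_from k" if "1 \<le> k" "k \<le> 2 * \<kappa> + 1" for k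
    using that(2,1)
  proof (induction rule: inc_induct)
    case base
    show ?case using collapsible_trivial commutes_from_trivial by simp
  next
    case (step n)
    thus ?case using collapsible_step commutes_from_step by simp
  qed
  moreover have "collapsible (tail k) \<and> commutes_from k" if "2 * \<kappa> + 1 \<le> k" for k
    using that collapsible_trivial commutes_from_trivial by simp
  ultimately show ?thesis using assms by (cases "k \<le> 2 * \<kappa> + 1") auto
qed

end

section \<open>From commutators to letters\<close>

lemma (in group) short_products_Suc:
  assumes "g \<in> short_products A (real (Suc n))"
  shows "g \<in> short_products A (real n) \<or> (\<exists>a\<in>A. \<exists>g'\<in>short_products A (real n). g = a \<otimes> g')"
proof -
  obtain gs where gs: "g = foldr (\<otimes>) gs \<one>" "set gs \<subseteq> A" "real (length gs) \<le> real (Suc n)"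
    using assms by (auto simp: short_products_def)
  show ?thesis
  proof (cases gs)
    case Nil
    thus ?thesis using gs one_in_short_products[of "real n" A] by auto
  next
    case (Cons a hs)
    hence "foldr (\<otimes>) hs \<one> \<in> short_products A (real n)" "a \<in> A"
      using gs by (auto simp: short_products_def)
    thus ?thesis using gs(1) Cons by auto
  qed
qed

lemma (in group) short_products_0: "short_products A 0 = {\<one>}"
  by (auto simp: short_products_def)

lemma (in group) nat_pow_in_short_products:
  assumes "A \<subseteq> carrier G" "g \<in> short_products A L"
  shows "g [^] (k::nat) \<in> short_products A (real k * L)"
proof (induction k)
  case (Suc k)
  have "g [^] Suc k \<in> short_products A (real k * L + L)"
    unfolding nat_pow_Suc by (intro mult_in_short_products Suc assms)
  thus ?case by (simp add: algebra_simps)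
qed (simp add: one_in_short_products)

lemma (in group) generate_short_product:
  assumes e: "e ` D \<subseteq> carrier G" and x: "x \<in> generate G (e ` D)"
  shows "\<exists>L\<ge>1. x \<in> short_products {e c [^] b | c b. c \<in> D \<and> \<bar>b::int\<bar> \<le> 1} L"
    (is "\<exists>L\<ge>1. x \<in> short_products ?A L")
proof -
  have A: "?A \<subseteq> carrier G" using e by auto
  from x show ?thesis
  proof induction
    case one
    show ?case by (intro exI[of _ 1]) (simp add: one_in_short_products)
  next
    case (incl h)
    then obtain c where c: "c \<in> D" "h = e c" by auto
    hence "e c [^] (1::int) \<in> ?A" by force
    moreover have "e c [^] (1::int) = h" using c e by auto
    ultimately have "h \<in> ?A" by simp
    thus ?case using single_in_short_products[OF A, of h 1] by auto
  next
    case (inv h)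
    then obtain c where c: "c \<in> D" "h = e c" by auto
    hence "e c [^] (-1::int) \<in> ?A" by force
    moreover have "e c [^] (-1::int) = inv h" using c e int_pow_neg[of "e c" 1] by (auto simp: image_subset_iff)
    ultimately have "inv h \<in> ?A" by simp
    thus ?case using single_in_short_products[OF A, of "inv h" 1] by auto
  next
    case (eng h1 h2)
    then obtain L1 L2 where "1 \<le> L1" "h1 \<in> short_products ?A L1" "1 \<le> L2" "h2 \<in> short_products ?A L2"
      by auto
    thus ?case using mult_in_short_products[OF A, of h1 L1 h2 L2] by (intro exI[of _ "L1 + L2"]) auto
  qed
qed

context nilpotent_words
begin

text \<open>The passage from commutators to letters works with slack \<open>1\<close> throughout: words have bounded length
  and exponents bounded by the scales.\<close>

lemma conj_words_unit:
  assumes M: "1 \<le> M"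
  obtains M' where "1 \<le> M'" "\<And>\<rho> i j L a g. \<lbrakk>g \<in> words \<rho> (tail j) M L; admissible_scale \<rho>;
    a \<in> powers \<rho> (tail i) M\<rbrakk> \<Longrightarrow> a \<otimes> g \<otimes> inv a \<in> words \<rho> (tail j) M' (L * M')"
proof -
  have K: "commutes_from 1" using collapsible_and_commutes[of 1] by simp
  obtain M' where M': "1 \<le> M'" "conj_bound 1 M M'"
    using conj_words[OF K M] by blast
  show thesis
  proof (rule that[OF M'(1)])
    fix \<rho> i j L a g
    assume g: "g \<in> words \<rho> (tail j) M L" and \<rho>: "admissible_scale \<rho>" and "a \<in> powers \<rho> (tail i) M"
    then obtain c b where c: "a = cval c [^] b" "c \<in> formal_commutators S"
      "\<bar>real_of_int b\<bar> \<le> M * fc_scale \<rho> c"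
      by (auto simp: powers_def tail_def)
    show "a \<otimes> g \<otimes> inv a \<in> words \<rho> (tail j) M' (L * M')"
      unfolding c(1) using conj_boundD[OF M'(2), of g \<rho> j 1 L c 1 b] g \<rho> c fc_length_pos[of c] by simp
  qed
qed

text \<open>Induction on the number of factors, by \<open>[a, b g] = [a, b] (b [a, g] b\<^sup>-\<^sup>1)\<close>.\<close>

lemma commutator_power_word:
  "\<forall>M\<ge>1. \<exists>M'\<ge>1. \<forall>\<rho> i j a g. admissible_scale \<rho> \<longrightarrow> a \<in> powers \<rho> (tail i) M \<longrightarrow>
     g \<in> words \<rho> (tail j) M (real n) \<longrightarrow> commutator G a g \<in> words \<rho> (tail (i + j)) M' M'"
proof (induction n)
  case 0
  have "commutator G a \<one> \<in> words \<rho> (tail (i + j)) 1 1" if "a \<in> powers \<rho> (tail i) M" for \<rho> i j a M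
    using that powers_closed[OF tail_subset] one_in_short_products[of 1] by (auto simp: subset_iff)
  thus ?case by (intro allI impI exI[of _ 1] conjI) (auto simp: short_products_0)
next
  case (Suc n)
  show ?case
  proof (intro allI impI)
    fix M :: real assume M: "1 \<le> M"
    obtain M1 where M1: "1 \<le> M1" "\<And>\<rho> i j a g. \<lbrakk>admissible_scale \<rho>; a \<in> powers \<rho> (tail i) M;
      g \<in> words \<rho> (tail j) M (real n)\<rbrakk> \<Longrightarrow> commutator G a g \<in> words \<rho> (tail (i + j)) M1 M1"
      using Suc[rule_format, OF M] by (elim exE conjE) (rule that, assumption, simp)
    have K: "commutes_from 1" using collapsible_and_commutes[of 1] by simp
    obtain M2 where M2: "1 \<le> M2" "commutator_bound 1 M M2"
      using commutes_fromE[OF K M] by blast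
    define N where "N = max M M1"
    have N: "1 \<le> N" "M \<le> N" "M1 \<le> N" using M by (auto simp: N_def)
    obtain M3 where M3: "1 \<le> M3" "\<And>\<rho> i j L a g. \<lbrakk>g \<in> words \<rho> (tail j) N L; admissible_scale \<rho>;
      a \<in> powers \<rho> (tail i) N\<rbrakk> \<Longrightarrow> a \<otimes> g \<otimes> inv a \<in> words \<rho> (tail j) M3 (L * M3)"
      using conj_words_unit[OF N(1)] by blast
    define M' where "M' = M1 + M2 + M3 + M1 * M3"
    have M': "1 \<le> M'" "M1 \<le> M'" "M2 \<le> M'" "M3 \<le> M'" "M2 + M1 * M3 \<le> M'"
      using M1(1) M2(1) M3(1) by (auto simp: M'_def add_increasing add_increasing2)
    show "\<exists>M'\<ge>1. \<forall>\<rho> i j a g. admissible_scale \<rho> \<longrightarrow> a \<in> powers \<rho> (tail i) M \<longrightarrow>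
      g \<in> words \<rho> (tail j) M (real (Suc n)) \<longrightarrow> commutator G a g \<in> words \<rho> (tail (i + j)) M' M'"
    proof (intro exI[of _ M'] conjI allI impI M'(1))
      fix \<rho> i j a g assume \<rho>: "admissible_scale \<rho>" and a: "a \<in> powers \<rho> (tail i) M"
        and g: "g \<in> words \<rho> (tail j) M (real (Suc n))"
      have ac: "a \<in> carrier G" using a powers_closed[OF tail_subset] by blast
      from short_products_Suc[OF g] show "commutator G a g \<in> words \<rho> (tail (i + j)) M' M'"
      proof (elim disjE bexE)
        assume "g \<in> words \<rho> (tail j) M (real n)"
        from M1(2)[OF \<rho> a this] show ?thesis by (rule words_monoD) (use \<rho> M' in auto)
      next
        fix b g' assume b: "b \<in> powers \<rho> (tail j) M" and g': "g' \<in> words \<rho> (tail j) M (real n)"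
          and g: "g = b \<otimes> g'"
        have bc: "b \<in> carrier G" using b powers_closed[OF tail_subset] by blast
        have g'c: "g' \<in> carrier G" using words_closed[OF g' tail_subset] .
        obtain c k where c: "a = cval c [^] k" "c \<in> tail i" "\<bar>real_of_int k\<bar> \<le> M * fc_scale \<rho> c"
          using a by (auto simp: powers_def)
        obtain d l where d: "b = cval d [^] l" "d \<in> tail j" "\<bar>real_of_int l\<bar> \<le> M * fc_scale \<rho> d"
          using b by (auto simp: powers_def)
        have "commutator G a b \<in> words \<rho> (tail (fc_length c + fc_length d)) (M2 * (1 * 1)) M2"
          unfolding c(1) d(1) using c d fc_length_pos[of c] by (intro commutator_boundD[OF M2(2) \<rho>]) (auto simp: tail_def)
        hence 1: "commutator G a b \<in> words \<rho> (tail (i + j)) M' M2"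
          by (rule words_monoD) (use \<rho> M' c d in \<open>auto intro!: tail_mono simp: tail_def\<close>)
        have "commutator G a g' \<in> words \<rho> (tail (i + j)) N M1"
          using M1(2)[OF \<rho> a g'] by (rule words_monoD) (use \<rho> N in auto)
        moreover have "b \<in> powers \<rho> (tail j) N" using b powers_mono[OF \<rho> _ N(2)] by blast
        ultimately have "b \<otimes> commutator G a g' \<otimes> inv b \<in> words \<rho> (tail (i + j)) M3 (M1 * M3)"
          using M3(2) \<rho> by blast
        hence 2: "b \<otimes> commutator G a g' \<otimes> inv b \<in> words \<rho> (tail (i + j)) M' (M1 * M3)"
          by (rule words_monoD) (use \<rho> M' in auto)
        have "commutator G a g = commutator G a b \<otimes> (b \<otimes> commutator G a g' \<otimes> inv b)"
          unfolding g using ac bc g'c by (simp add: word_simps)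
        also have "\<dots> \<in> words \<rho> (tail (i + j)) M' (M2 + M1 * M3)"
          by (intro words_mult 1 2 tail_subset)
        finally show ?thesis by (rule words_monoD) (use \<rho> M' in auto)
      qed
    qed
  qed
qed

lemma commutator_words_aux:
  "\<forall>M\<ge>1. \<exists>M'\<ge>1. \<forall>\<rho> i j g h. admissible_scale \<rho> \<longrightarrow> g \<in> words \<rho> (tail i) M (real n) \<longrightarrow>
     h \<in> words \<rho> (tail j) M M \<longrightarrow> commutator G g h \<in> words \<rho> (tail (i + j)) M' M'"
proof (induction n)
  case 0
  have "commutator G \<one> h \<in> words \<rho> (tail (i + j)) 1 1" if "h \<in> words \<rho> (tail j) M M" for \<rho> i j h M
    using words_closed[OF that tail_subset] one_in_short_products[of 1] by auto
  thus ?case by (intro allI impI exI[of _ 1] conjI) (auto simp: short_products_0)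
next
  case (Suc n)
  show ?case
  proof (intro allI impI)
    fix M :: real assume M: "1 \<le> M"
    obtain M1 where M1: "1 \<le> M1" "\<And>\<rho> i j g h. \<lbrakk>admissible_scale \<rho>; g \<in> words \<rho> (tail i) M (real n);
      h \<in> words \<rho> (tail j) M M\<rbrakk> \<Longrightarrow> commutator G g h \<in> words \<rho> (tail (i + j)) M1 M1"
      using Suc[rule_format, OF M] by (elim exE conjE) (rule that, assumption, simp)
    obtain M2 where M2: "1 \<le> M2" "\<And>\<rho> i j a g. \<lbrakk>admissible_scale \<rho>; a \<in> powers \<rho> (tail i) M;
      g \<in> words \<rho> (tail j) M (real (nat \<lceil>M\<rceil>))\<rbrakk> \<Longrightarrow> commutator G a g \<in> words \<rho> (tail (i + j)) M2 M2"
      using commutator_power_word[of "nat \<lceil>M\<rceil>", rule_format, OF M]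
      by (elim exE conjE) (rule that, assumption, simp)
    define N where "N = max M M1"
    have N: "1 \<le> N" "M \<le> N" "M1 \<le> N" using M by (auto simp: N_def)
    obtain M3 where M3: "1 \<le> M3" "\<And>\<rho> i j L a g. \<lbrakk>g \<in> words \<rho> (tail j) N L; admissible_scale \<rho>;
      a \<in> powers \<rho> (tail i) N\<rbrakk> \<Longrightarrow> a \<otimes> g \<otimes> inv a \<in> words \<rho> (tail j) M3 (L * M3)"
      using conj_words_unit[OF N(1)] by blast
    define M' where "M' = M1 + M2 + M3 + M1 * M3"
    have M': "1 \<le> M'" "M1 \<le> M'" "M2 \<le> M'" "M3 \<le> M'" "M1 * M3 + M2 \<le> M'"
      using M1(1) M2(1) M3(1) by (auto simp: M'_def add_increasing add_increasing2)
    show "\<exists>M'\<ge>1. \<forall>\<rho> i j g h. admissible_scale \<rho> \<longrightarrow> g \<in> words \<rho> (tail i) M (real (Suc n)) \<longrightarrow>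
      h \<in> words \<rho> (tail j) M M \<longrightarrow> commutator G g h \<in> words \<rho> (tail (i + j)) M' M'"
    proof (intro exI[of _ M'] conjI allI impI M'(1))
      fix \<rho> i j g h assume \<rho>: "admissible_scale \<rho>" and h: "h \<in> words \<rho> (tail j) M M"
        and g: "g \<in> words \<rho> (tail i) M (real (Suc n))"
      have hc: "h \<in> carrier G" using words_closed[OF h tail_subset] .
      from short_products_Suc[OF g] show "commutator G g h \<in> words \<rho> (tail (i + j)) M' M'"
      proof (elim disjE bexE)
        assume "g \<in> words \<rho> (tail i) M (real n)"
        from M1(2)[OF \<rho> this h] show ?thesis by (rule words_monoD) (use \<rho> M' in auto)
      next
        fix a g' assume a: "a \<in> powers \<rho> (tail i) M" and g': "g' \<in> words \<rho> (tail i) M (real n)"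
          and g: "g = a \<otimes> g'"
        have ac: "a \<in> carrier G" using a powers_closed[OF tail_subset] by blast
        have g'c: "g' \<in> carrier G" using words_closed[OF g' tail_subset] .
        have "h \<in> words \<rho> (tail j) M (real (nat \<lceil>M\<rceil>))"
          using h by (rule words_monoD) (use \<rho> M in \<open>auto simp: real_nat_ceiling_ge\<close>)
        from M2(2)[OF \<rho> a this] have 1: "commutator G a h \<in> words \<rho> (tail (i + j)) M' M2"
          by (rule words_monoD) (use \<rho> M' in auto)
        have "commutator G g' h \<in> words \<rho> (tail (i + j)) N M1"
          using M1(2)[OF \<rho> g' h] by (rule words_monoD) (use \<rho> N in auto)
        moreover have "a \<in> powers \<rho> (tail i) N" using a powers_mono[OF \<rho> _ N(2)] by blast
        ultimately have "a \<otimes> commutator G g' h \<otimes> inv a \<in> words \<rho> (tail (i + j)) M3 (M1 * M3)"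
          using M3(2) \<rho> by blast
        hence 2: "a \<otimes> commutator G g' h \<otimes> inv a \<in> words \<rho> (tail (i + j)) M' (M1 * M3)"
          by (rule words_monoD) (use \<rho> M' in auto)
        have "commutator G g h = (a \<otimes> commutator G g' h \<otimes> inv a) \<otimes> commutator G a h"
          unfolding g using ac hc g'c by (simp add: word_simps)
        also have "\<dots> \<in> words \<rho> (tail (i + j)) M' (M1 * M3 + M2)"
          by (intro words_mult 1 2 tail_subset)
        finally show ?thesis by (rule words_monoD) (use \<rho> M' in auto)
      qed
    qed
  qed
qed

lemma commutator_words:
  assumes M: "1 \<le> M"
  obtains M' where "1 \<le> M'" "\<And>\<rho> i j g h. \<lbrakk>admissible_scale \<rho>; g \<in> words \<rho> (tail i) M M;
     h \<in> words \<rho> (tail j) M M\<rbrakk> \<Longrightarrow> commutator G g h \<in> words \<rho> (tail (i + j)) M' M'"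
proof -
  obtain M' where M': "1 \<le> M'" "\<And>\<rho> i j g h. \<lbrakk>admissible_scale \<rho>;
     g \<in> words \<rho> (tail i) M (real (nat \<lceil>M\<rceil>)); h \<in> words \<rho> (tail j) M M\<rbrakk> \<Longrightarrow>
     commutator G g h \<in> words \<rho> (tail (i + j)) M' M'"
    using commutator_words_aux[of "nat \<lceil>M\<rceil>", rule_format, OF M]
    by (elim exE conjE) (rule that, assumption, simp)
  show thesis
  proof (rule that[OF M'(1)])
    fix \<rho> i j g h assume "admissible_scale \<rho>" "g \<in> words \<rho> (tail i) M M" "h \<in> words \<rho> (tail j) M M"
    moreover have "g \<in> words \<rho> (tail i) M (real (nat \<lceil>M\<rceil>))"
      using calculation(2) by (rule words_monoD) (use calculation M in \<open>auto simp: real_nat_ceiling_ge\<close>)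
    ultimately show "commutator G g h \<in> words \<rho> (tail (i + j)) M' M'" using M'(2) by blast
  qed
qed

text \<open>Families of group elements, indexed by a scale and further parameters, that are words of uniformly
  bounded complexity. They are closed under the group operations, and calculating with them hides the
  constants.\<close>

definition bounded_family ::
    "'t set \<Rightarrow> ('t \<Rightarrow> nat \<Rightarrow> real) \<Rightarrow> (nat \<times> bool) formal_commutator set \<Rightarrow> ('t \<Rightarrow> 'a) \<Rightarrow> bool" where
  "bounded_family T \<rho> X F \<longleftrightarrow>
     (\<forall>t\<in>T. admissible_scale (\<rho> t)) \<and> (\<exists>M\<ge>1. \<forall>t\<in>T. F t \<in> words (\<rho> t) X M M)"

lemma bounded_familyI:
  "\<lbrakk>\<And>t. t \<in> T \<Longrightarrow> admissible_scale (\<rho> t); \<And>t. t \<in> T \<Longrightarrow> F t \<in> words (\<rho> t) X q L\<rbrakk> \<Longrightarrow>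
    bounded_family T \<rho> X F"
  unfolding bounded_family_def
  by (intro conjI exI[of _ "max 1 (max q L)"] ballI) (auto intro: words_monoD[of _ _ X q L])

lemma bounded_family_cong:
  "(\<And>t. t \<in> T \<Longrightarrow> F t = H t) \<Longrightarrow> bounded_family T \<rho> X F \<longleftrightarrow> bounded_family T \<rho> X H"
  by (simp add: bounded_family_def)

lemma bounded_familyD:
  assumes "bounded_family T \<rho> X F"
  obtains M where "1 \<le> M" "\<And>t. t \<in> T \<Longrightarrow> F t \<in> words (\<rho> t) X M M"
    "\<And>t N. \<lbrakk>t \<in> T; M \<le> N\<rbrakk> \<Longrightarrow> F t \<in> words (\<rho> t) X N N" "\<And>t. t \<in> T \<Longrightarrow> admissible_scale (\<rho> t)"
proof -
  from assms[unfolded bounded_family_def] obtain M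
    where adm: "\<forall>t\<in>T. admissible_scale (\<rho> t)" and M: "1 \<le> M" "\<forall>t\<in>T. F t \<in> words (\<rho> t) X M M"
    by (elim conjE exE)
  show thesis
  proof (rule that[OF M(1)])
    fix t N assume t: "t \<in> T" and N: "M \<le> N"
    from M(2) t have "F t \<in> words (\<rho> t) X M M" by simp
    moreover from adm t have "admissible_scale (\<rho> t)" by simp
    ultimately show "F t \<in> words (\<rho> t) X N N" using order.refl N N by (rule words_monoD)
  qed (simp_all add: M(2) adm)
qed

lemma bounded_family_mono:
  assumes "bounded_family T \<rho> X F" "X \<subseteq> Y"
  shows "bounded_family T \<rho> Y F"
proof (rule bounded_familyD[OF assms(1)])
  fix M assume M: "\<And>t. t \<in> T \<Longrightarrow> F t \<in> words (\<rho> t) X M M" "\<And>t. t \<in> T \<Longrightarrow> admissible_scale (\<rho> t)"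
  show ?thesis
  proof (rule bounded_familyI[OF M(2)])
    fix t assume t: "t \<in> T"
    show "F t \<in> words (\<rho> t) Y M M" using M(1)[OF t] M(2)[OF t] assms(2) by (rule words_monoD) simp_all
  qed
qed

lemma bounded_family_mult:
  assumes X: "X \<subseteq> formal_commutators S" and F: "bounded_family T \<rho> X F" and H: "bounded_family T \<rho> X H"
  shows "bounded_family T \<rho> X (\<lambda>t. F t \<otimes> H t)"
proof (rule bounded_familyD[OF F], rule bounded_familyD[OF H])
  fix M M'
  assume M: "\<And>t N. \<lbrakk>t \<in> T; M \<le> N\<rbrakk> \<Longrightarrow> F t \<in> words (\<rho> t) X N N" "\<And>t. t \<in> T \<Longrightarrow> admissible_scale (\<rho> t)"
    and M': "\<And>t N. \<lbrakk>t \<in> T; M' \<le> N\<rbrakk> \<Longrightarrow> H t \<in> words (\<rho> t) X N N"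
  show ?thesis
  proof (rule bounded_familyI[OF M(2)])
    fix t assume t: "t \<in> T"
    have "F t \<in> words (\<rho> t) X (max M M') (max M M')" using t by (rule M(1)) simp
    moreover have "H t \<in> words (\<rho> t) X (max M M') (max M M')" using t by (rule M') simp
    ultimately show "F t \<otimes> H t \<in> words (\<rho> t) X (max M M') (max M M' + max M M')"
      using X by (rule words_mult)
  qed
qed

lemma bounded_family_inv:
  assumes X: "X \<subseteq> formal_commutators S" and F: "bounded_family T \<rho> X F"
  shows "bounded_family T \<rho> X (\<lambda>t. inv (F t))"
proof (rule bounded_familyD[OF F])
  fix M assume M: "\<And>t. t \<in> T \<Longrightarrow> F t \<in> words (\<rho> t) X M M" "\<And>t. t \<in> T \<Longrightarrow> admissible_scale (\<rho> t)"
  show ?thesis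
  proof (rule bounded_familyI[OF M(2)])
    fix t assume t: "t \<in> T"
    show "inv (F t) \<in> words (\<rho> t) X M M" using M(1)[OF t] X by (rule words_inv)
  qed
qed

lemma bounded_family_commutator:
  assumes F: "bounded_family T \<rho> (tail i) F" and H: "bounded_family T \<rho> (tail j) H"
  shows "bounded_family T \<rho> (tail (i + j)) (\<lambda>t. commutator G (F t) (H t))"
proof (rule bounded_familyD[OF F], rule bounded_familyD[OF H])
  fix M M'
  assume M: "1 \<le> M" "\<And>t N. \<lbrakk>t \<in> T; M \<le> N\<rbrakk> \<Longrightarrow> F t \<in> words (\<rho> t) (tail i) N N"
      "\<And>t. t \<in> T \<Longrightarrow> admissible_scale (\<rho> t)"
    and M': "\<And>t N. \<lbrakk>t \<in> T; M' \<le> N\<rbrakk> \<Longrightarrow> H t \<in> words (\<rho> t) (tail j) N N"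
  define N where "N = max M M'"
  have N: "1 \<le> N" "M \<le> N" "M' \<le> N" using M(1) by (auto simp: N_def)
  obtain M2 where "1 \<le> M2" and M2: "\<And>\<rho> i j g h. \<lbrakk>admissible_scale \<rho>; g \<in> words \<rho> (tail i) N N;
     h \<in> words \<rho> (tail j) N N\<rbrakk> \<Longrightarrow> commutator G g h \<in> words \<rho> (tail (i + j)) M2 M2"
    using commutator_words[OF N(1)] by blast
  show ?thesis
  proof (rule bounded_familyI[OF M(3)])
    fix t assume t: "t \<in> T"
    show "commutator G (F t) (H t) \<in> words (\<rho> t) (tail (i + j)) M2 M2"
      using M(3)[OF t] M(2)[OF t N(2)] M'[OF t N(3)] by (rule M2)
  qed
qed

lemma bounded_family_closed:
  assumes "bounded_family T \<rho> X F" "X \<subseteq> formal_commutators S" "t \<in> T"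
  shows "F t \<in> carrier G"
proof (rule bounded_familyD[OF assms(1)])
  fix M assume "\<And>t. t \<in> T \<Longrightarrow> F t \<in> words (\<rho> t) X M M"
  from words_closed[OF this[OF assms(3)] assms(2)] show ?thesis .
qed

definition letters :: "(nat \<times> bool) formal_commutator set" where
  "letters = {c \<in> formal_commutators S. fc_length c = 1}"

lemma letters_subset: "letters \<subseteq> formal_commutators S" "letters \<subseteq> tail 1"
  by (auto simp: letters_def tail_def)

text \<open>If powers of \<open>c\<close> and \<open>d\<close> are words \<open>h1\<close>, \<open>h2\<close> in letters up to longer commutators, then the power
  \<open>i * j\<close> of the bracket is \<open>[h1, h2]\<close> up to longer commutators: it agrees with the commutator of the two
  powers, and commutators are bilinear up to longer ones.\<close>

lemma bracket_leading_term:
  assumes k: "fc_length c + fc_length d = k" and c: "c \<in> formal_commutators S" and d: "d \<in> formal_commutators S"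
    and \<rho>: "\<And>t. t \<in> T \<Longrightarrow> admissible_scale (\<rho> t)"
    and M: "1 \<le> M" "\<And>t. t \<in> T \<Longrightarrow> real (i t) \<le> M * fc_scale (\<rho> t) c"
      "\<And>t. t \<in> T \<Longrightarrow> real (j t) \<le> M * fc_scale (\<rho> t) d"
    and c_lead: "\<And>t. t \<in> T \<Longrightarrow> cval c [^] int (i t) = g1 t \<otimes> h1 t"
      "bounded_family T \<rho> (tail (Suc (fc_length c))) g1" "bounded_family T \<rho> letters h1"
    and d_lead: "\<And>t. t \<in> T \<Longrightarrow> cval d [^] int (j t) = g2 t \<otimes> h2 t"
      "bounded_family T \<rho> (tail (Suc (fc_length d))) g2" "bounded_family T \<rho> letters h2"
  obtains g h where "\<And>t. t \<in> T \<Longrightarrow> cval (Bracket c d) [^] int (i t * j t) = g t \<otimes> h t"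
    "bounded_family T \<rho> (tail (Suc k)) g" "bounded_family T \<rho> letters h"
proof -
  note cl = bounded_family_closed[OF c_lead(2) tail_subset] bounded_family_closed[OF d_lead(2) tail_subset]
    bounded_family_closed[OF c_lead(3) letters_subset(1)] bounded_family_closed[OF d_lead(3) letters_subset(1)]
  have KX: "commutes_from (Suc k)" "collapsible (tail (Suc k))"
    using collapsible_and_commutes[of "Suc k"] by auto
  obtain M1 where M1: "1 \<le> M1" "bracket_power_bound k M M1"
    using commutator_powers[OF KX M(1)] by blast
  let ?x = "\<lambda>t. cval c [^] int (i t)" and ?y = "\<lambda>t. cval d [^] int (j t)"
    and ?z = "\<lambda>t. cval (Bracket c d) [^] int (i t * j t)"
  have "\<forall>t\<in>T. \<exists>g. g \<in> words (\<rho> t) (tail (Suc k)) M1 M1 \<and> commutator G (?x t) (?y t) = g \<otimes> ?z t"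
  proof
    fix t assume "t \<in> T"
    thus "\<exists>g. g \<in> words (\<rho> t) (tail (Suc k)) M1 M1 \<and> commutator G (?x t) (?y t) = g \<otimes> ?z t"
      using bracket_power_boundD[OF M1(2) \<rho> c d k, of t 1 1 "i t" "j t"] M(2,3) by auto
  qed
  from bchoice[OF this] obtain e where e: "\<And>t. t \<in> T \<Longrightarrow> e t \<in> words (\<rho> t) (tail (Suc k)) M1 M1"
      "\<And>t. t \<in> T \<Longrightarrow> commutator G (?x t) (?y t) = e t \<otimes> ?z t"
    by blast
  have be: "bounded_family T \<rho> (tail (Suc k)) e" by (rule bounded_familyI[OF \<rho> e(1)])
  have bx: "bounded_family T \<rho> (tail (fc_length c)) ?x"
    by (rule bounded_familyI[OF \<rho>, where q = M and L = 1]) (use M c in \<open>auto intro!: words_single tail_subset simp: tail_def\<close>)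
  have by': "bounded_family T \<rho> (tail (fc_length d)) ?y"
    by (rule bounded_familyI[OF \<rho>, where q = M and L = 1]) (use M d in \<open>auto intro!: words_single tail_subset simp: tail_def\<close>)
  have lead_h: "bounded_family T \<rho> (tail n) h"
    if "bounded_family T \<rho> (tail n) x" "bounded_family T \<rho> (tail (Suc n)) g" "\<And>t. t \<in> T \<Longrightarrow> x t = g t \<otimes> h t"
      "\<And>t. t \<in> T \<Longrightarrow> h t \<in> carrier G" for n x g h
  proof -
    have "bounded_family T \<rho> (tail n) (\<lambda>t. inv (g t) \<otimes> x t)"
      by (intro bounded_family_mult bounded_family_inv tail_subset that bounded_family_mono[OF that(2)] tail_mono) auto
    moreover have "inv (g t) \<otimes> x t = h t" if "t \<in> T" for t
      using that \<open>\<And>t. t \<in> T \<Longrightarrow> x t = g t \<otimes> h t\<close> \<open>\<And>t. t \<in> T \<Longrightarrow> h t \<in> carrier G\<close>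
        bounded_family_closed[OF \<open>bounded_family T \<rho> (tail (Suc n)) g\<close> tail_subset]
      by (simp add: cancel_left)
    ultimately show ?thesis by (simp cong: bounded_family_cong)
  qed
  have bh1: "bounded_family T \<rho> (tail (fc_length c)) h1" using lead_h[OF bx c_lead(2,1) cl(3)] .
  have bh2: "bounded_family T \<rho> (tail (fc_length d)) h2" using lead_h[OF by' d_lead(2,1) cl(4)] .
  define p where "p t = commutator G (h1 t) (h2 t)" for t
  have bp: "bounded_family T \<rho> (tail k) p"
    unfolding p_def k[symmetric] by (intro bounded_family_commutator bh1 bh2)
  have bp': "bounded_family T \<rho> letters p"
    unfolding p_def commutator_def
    by (intro bounded_family_mult bounded_family_inv letters_subset c_lead d_lead)
  define q where "q t = commutator G (h1 t) (?y t)" for t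
  have bq: "bounded_family T \<rho> (tail k) q"
    unfolding q_def k[symmetric] by (intro bounded_family_commutator bh1 by')
  have lift: "bounded_family T \<rho> (tail (Suc k)) F" if "bounded_family T \<rho> (tail n) F" "Suc k \<le> n" for F n
    using bounded_family_mono[OF that(1) tail_mono[OF that(2)]] .
  define D where "D t = commutator G (g1 t) (?y t)" for t
  have bD: "bounded_family T \<rho> (tail (Suc k)) D" unfolding D_def
    by (rule lift[OF bounded_family_commutator[OF c_lead(2) by']]) (use k in auto)
  define g where "g t = inv (e t) \<otimes> commutator G (g1 t) (q t) \<otimes> commutator G (h1 t) (g2 t)
      \<otimes> commutator G (g2 t) (p t) \<otimes> (commutator G (p t) (D t) \<otimes> D t)" for t
  have "bounded_family T \<rho> (tail (Suc k)) g" unfolding g_def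
    by (intro bounded_family_mult bounded_family_inv tail_subset be bD
          lift[OF bounded_family_commutator[OF c_lead(2) bq]]
          lift[OF bounded_family_commutator[OF bh1 d_lead(2)]]
          lift[OF bounded_family_commutator[OF d_lead(2) bp]]
          lift[OF bounded_family_commutator[OF bp bD]]) (use k in auto)
  moreover have "?z t = g t \<otimes> p t" if t: "t \<in> T" for t
  proof -
    note in_carrier = cl[OF t] bounded_family_closed[OF be tail_subset t]
    have zc: "?z t \<in> carrier G" using c d by (intro int_pow_closed cval_closed) simp
    have yc: "?y t \<in> carrier G" using d by simp
    have pc: "p t \<in> carrier G" using in_carrier by (simp add: p_def)
    have qc: "q t \<in> carrier G" using in_carrier yc by (simp add: q_def)
    have Dc: "D t \<in> carrier G" using in_carrier yc by (simp add: D_def)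
    have z: "?z t = inv (e t) \<otimes> commutator G (?x t) (?y t)"
      using e(2)[OF t] in_carrier zc by (simp add: cancel_left)
    have xy: "commutator G (?x t) (?y t) = commutator G (g1 t) (q t) \<otimes> q t \<otimes> D t"
      unfolding c_lead(1)[OF t] q_def D_def using in_carrier yc by (simp add: word_simps)
    have q: "q t = commutator G (h1 t) (g2 t) \<otimes> commutator G (g2 t) (p t) \<otimes> p t"
      unfolding q_def p_def d_lead(1)[OF t] using in_carrier by (simp add: word_simps)
    define A where "A = commutator G (g1 t) (q t)"
    have Ac: "A \<in> carrier G" using in_carrier qc by (simp add: A_def)
    have "?z t = inv (e t) \<otimes> (A \<otimes> (commutator G (h1 t) (g2 t) \<otimes> commutator G (g2 t) (p t) \<otimes> p t) \<otimes> D t)"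
      unfolding z xy A_def[symmetric] by (simp only: q[symmetric])
    also have "\<dots> = g t \<otimes> p t"
      unfolding g_def A_def[symmetric] using in_carrier pc Ac Dc
      by (simp add: m_assoc commutator_def[of G "p t" "D t"] cancel_left)
    finally show ?thesis .
  qed
  ultimately show thesis using that bp' by blast
qed

definition leading_bound :: "(nat \<times> bool) formal_commutator \<Rightarrow> real \<Rightarrow> real \<Rightarrow> bool" where
  "leading_bound c M M' \<longleftrightarrow> (\<forall>\<rho> (b::nat). admissible_scale \<rho> \<longrightarrow> real b \<le> M * fc_scale \<rho> c \<longrightarrow>
     (\<exists>g \<in> words \<rho> (tail (Suc (fc_length c))) M' M'. \<exists>h \<in> words \<rho> letters M' M'.
       cval c [^] int b = g \<otimes> h))"

lemmas leading_boundD = leading_bound_def[THEN iffD1, rule_format]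

text \<open>A power of a commutator within its scale is, up to longer commutators, a bounded word in powers of
  letters. For a bracket, the exponent is written as \<open>b1 * b2 + b3\<close> with \<open>b1\<close> the integer part of the scale
  of the first argument, so that every factor is admissible for one of the two arguments.\<close>

lemma leading_term: "c \<in> formal_commutators S \<Longrightarrow> \<forall>M\<ge>1. \<exists>M'\<ge>1. leading_bound c M M'"
proof (induction c)
  case (Letter l)
  have "leading_bound (Letter l) M M" if M: "1 \<le> M" for M
    unfolding leading_bound_def
  proof (intro allI impI)
    fix \<rho> b assume b: "real b \<le> M * fc_scale \<rho> (Letter l)"
    have "\<one> \<in> words \<rho> (tail (Suc (fc_length (Letter l)))) M M"
      using M by (intro one_in_short_products) auto
    moreover have "cval (Letter l) [^] int b \<in> words \<rho> letters M M"
      using b M Letter letters_subset(1) by (intro words_single) (auto simp: letters_def)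
    moreover have "cval (Letter l) [^] int b = \<one> \<otimes> cval (Letter l) [^] int b"
      using cval_closed[OF Letter] by (simp del: fc_eval.simps)
    ultimately show "\<exists>g \<in> words \<rho> (tail (Suc (fc_length (Letter l)))) M M.
        \<exists>h \<in> words \<rho> letters M M. cval (Letter l) [^] int b = g \<otimes> h"
      by blast
  qed
  thus ?case by blast
next
  case (Bracket c d)
  hence cd: "c \<in> formal_commutators S" "d \<in> formal_commutators S" by auto
  show ?case
  proof (intro allI impI)
    fix M :: real assume "1 \<le> M"
    hence M: "1 \<le> 2 * M" by simp
    let ?k = "fc_length c + fc_length d"
    define T where "T = {(\<rho>, i::nat, j::nat). admissible_scale \<rho> \<and> real i \<le> 2 * M * fc_scale \<rho> c \<and>
      real j \<le> 2 * M * fc_scale \<rho> d}"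
    from Bracket.IH(1)[OF cd(1), rule_format, OF M] obtain M1 where M1: "leading_bound c (2 * M) M1"
      by blast
    from Bracket.IH(2)[OF cd(2), rule_format, OF M] obtain M2 where M2: "leading_bound d (2 * M) M2"
      by blast
    have T: "admissible_scale (fst t)" "real (fst (snd t)) \<le> 2 * M * fc_scale (fst t) c"
      "real (snd (snd t)) \<le> 2 * M * fc_scale (fst t) d" if "t \<in> T" for t
      using that by (auto simp: T_def)
    have "\<forall>t\<in>T. \<exists>gh. fst gh \<in> words (fst t) (tail (Suc (fc_length c))) M1 M1 \<and>
        snd gh \<in> words (fst t) letters M1 M1 \<and> cval c [^] int (fst (snd t)) = fst gh \<otimes> snd gh"
    proof
      fix t assume t: "t \<in> T"
      from leading_boundD[OF M1 T(1,2)[OF t]]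
      show "\<exists>gh. fst gh \<in> words (fst t) (tail (Suc (fc_length c))) M1 M1 \<and>
        snd gh \<in> words (fst t) letters M1 M1 \<and> cval c [^] int (fst (snd t)) = fst gh \<otimes> snd gh"
      proof (elim bexE)
        fix g h assume "g \<in> words (fst t) (tail (Suc (fc_length c))) M1 M1" "h \<in> words (fst t) letters M1 M1"
          "cval c [^] int (fst (snd t)) = g \<otimes> h"
        thus ?thesis by (intro exI[of _ "(g, h)"]) simp
      qed
    qed
    from bchoice[OF this] obtain gh1 where gh1: "\<forall>t\<in>T. fst (gh1 t) \<in> words (fst t) (tail (Suc (fc_length c))) M1 M1 \<and>
        snd (gh1 t) \<in> words (fst t) letters M1 M1 \<and> cval c [^] int (fst (snd t)) = fst (gh1 t) \<otimes> snd (gh1 t)"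
      by (elim exE)
    have "\<forall>t\<in>T. \<exists>gh. fst gh \<in> words (fst t) (tail (Suc (fc_length d))) M2 M2 \<and>
        snd gh \<in> words (fst t) letters M2 M2 \<and> cval d [^] int (snd (snd t)) = fst gh \<otimes> snd gh"
    proof
      fix t assume t: "t \<in> T"
      from leading_boundD[OF M2 T(1,3)[OF t]]
      show "\<exists>gh. fst gh \<in> words (fst t) (tail (Suc (fc_length d))) M2 M2 \<and>
        snd gh \<in> words (fst t) letters M2 M2 \<and> cval d [^] int (snd (snd t)) = fst gh \<otimes> snd gh"
      proof (elim bexE)
        fix g h assume "g \<in> words (fst t) (tail (Suc (fc_length d))) M2 M2" "h \<in> words (fst t) letters M2 M2"
          "cval d [^] int (snd (snd t)) = g \<otimes> h"
        thus ?thesis by (intro exI[of _ "(g, h)"]) simp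
      qed
    qed
    from bchoice[OF this] obtain gh2 where gh2: "\<forall>t\<in>T. fst (gh2 t) \<in> words (fst t) (tail (Suc (fc_length d))) M2 M2 \<and>
        snd (gh2 t) \<in> words (fst t) letters M2 M2 \<and> cval d [^] int (snd (snd t)) = fst (gh2 t) \<otimes> snd (gh2 t)"
      by (elim exE)
    have x1: "cval c [^] int (fst (snd t)) = fst (gh1 t) \<otimes> snd (gh1 t)" if "t \<in> T" for t using gh1 that by simp
    have f1: "bounded_family T fst (tail (Suc (fc_length c))) (\<lambda>t. fst (gh1 t))"
      by (rule bounded_familyI[where q = M1 and L = M1]) (use gh1 T in simp_all)
    have k1: "bounded_family T fst letters (\<lambda>t. snd (gh1 t))"
      by (rule bounded_familyI[where q = M1 and L = M1]) (use gh1 T in simp_all)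
    have x2: "cval d [^] int (snd (snd t)) = fst (gh2 t) \<otimes> snd (gh2 t)" if "t \<in> T" for t using gh2 that by simp
    have f2: "bounded_family T fst (tail (Suc (fc_length d))) (\<lambda>t. fst (gh2 t))"
      by (rule bounded_familyI[where q = M2 and L = M2]) (use gh2 T in simp_all)
    have k2: "bounded_family T fst letters (\<lambda>t. snd (gh2 t))"
      by (rule bounded_familyI[where q = M2 and L = M2]) (use gh2 T in simp_all)
    obtain g h where gh: "\<And>t. t \<in> T \<Longrightarrow>
        cval (Bracket c d) [^] int (fst (snd t) * snd (snd t)) = g t \<otimes> h t"
      "bounded_family T fst (tail (Suc ?k)) g" "bounded_family T fst letters h"
      using bracket_leading_term[OF refl cd T(1) M T(2,3) x1 f1 k1 x2 f2 k2] by blast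
    \<comment> \<open>division with remainder by an integer comparable to the scale of \<open>c\<close>\<close>
    define T' where "T' = {(\<rho>, b::nat). admissible_scale \<rho> \<and> real b \<le> M * fc_scale \<rho> (Bracket c d)}"
    define b1 where "b1 \<rho> = nat \<lfloor>fc_scale \<rho> c\<rfloor>" for \<rho>
    \<comment> \<open>\<open>t1\<close> and \<open>t2\<close> are the parameters of the parts \<open>b1 * b2\<close> and \<open>b3 * 1\<close> of the exponent\<close>
    define t1 where "t1 t = (fst t, b1 (fst t), snd t div b1 (fst t))" for t :: "(nat \<Rightarrow> real) \<times> nat"
    define t2 where "t2 t = (fst t, snd t mod b1 (fst t), 1 :: nat)" for t :: "(nat \<Rightarrow> real) \<times> nat"
    have t12: "t1 t \<in> T" "t2 t \<in> T" if "t \<in> T'" for t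
    proof -
      let ?r = "fst t" and ?b = "snd t"
      have r: "admissible_scale ?r" and b: "real ?b \<le> M * (fc_scale ?r c * fc_scale ?r d)"
        using that by (auto simp: T'_def)
      have sc: "1 \<le> fc_scale ?r e" for e using scale_ge_1[OF r] .
      have fl: "1 \<le> \<lfloor>fc_scale ?r c\<rfloor>" using sc[of c] by simp
      have b1: "1 \<le> b1 ?r" "real (b1 ?r) \<le> fc_scale ?r c" "fc_scale ?r c \<le> 2 * real (b1 ?r)"
        unfolding b1_def using fl sc[of c] by linarith+
      have 1: "fc_scale ?r c \<le> 2 * M * fc_scale ?r c"
        using mult_right_mono[of 1 "2 * M" "fc_scale ?r c"] M sc[of c] by simp
      have "real (?b div b1 ?r) * real (b1 ?r) \<le> real ?b"
        by (metis div_times_less_eq_dividend of_nat_le_iff of_nat_mult)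
      also have "\<dots> \<le> M * (2 * real (b1 ?r) * fc_scale ?r d)"
        using b b1(3) sc[of d] \<open>1 \<le> M\<close>
        by (elim order_trans) (intro mult_left_mono mult_right_mono, auto)
      finally have "real (?b div b1 ?r) \<le> 2 * M * fc_scale ?r d"
        using b1(1) by (simp add: mult.commute mult.left_commute)
      thus "t1 t \<in> T" unfolding t1_def T_def using r 1 b1(2) by simp
      have "?b mod b1 ?r < b1 ?r" using b1(1) by simp
      hence "real (?b mod b1 ?r) \<le> fc_scale ?r c" using b1(2) by linarith
      moreover have "1 * 1 \<le> 2 * M * fc_scale ?r d" using M sc[of d] by (intro mult_mono) auto
      ultimately show "t2 t \<in> T" unfolding t2_def T_def using r 1 by simp
    qed
    have pull: "bounded_family T' fst X (\<lambda>t. F (s t))"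
      if "bounded_family T fst X F" "\<And>t. t \<in> T' \<Longrightarrow> s t \<in> T" "\<And>t. fst (s t) = fst t" for X F s
    proof (rule bounded_familyD[OF that(1)])
      fix K assume K: "\<And>t. t \<in> T \<Longrightarrow> F t \<in> words (fst t) X K K"
      show ?thesis
      proof (rule bounded_familyI[where q = K and L = K])
        fix t assume t: "t \<in> T'"
        show "F (s t) \<in> words (fst t) X K K" using K[OF that(2)[OF t]] that(3) by simp
        show "admissible_scale (fst t)" using T(1)[OF that(2)[OF t]] that(3) by simp
      qed
    qed
    have f12: "fst (t1 t) = fst t" "fst (t2 t) = fst t" for t by (simp_all add: t1_def t2_def)
    note g1 = pull[OF gh(2) t12(1) f12(1)] and g2 = pull[OF gh(2) t12(2) f12(2)]
      and h1 = pull[OF gh(3) t12(1) f12(1)] and h2 = pull[OF gh(3) t12(2) f12(2)]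
    define g' where "g' t = g (t1 t) \<otimes> (commutator G (h (t1 t)) (g (t2 t)) \<otimes> g (t2 t))" for t
    have comm: "bounded_family T' fst (tail (Suc ?k)) (\<lambda>t. commutator G (h (t1 t)) (g (t2 t)))"
      using bounded_family_mono[OF bounded_family_commutator[OF bounded_family_mono[OF h1 letters_subset(2)] g2], of "tail (Suc ?k)"]
      by (simp add: tail_mono)
    have g': "bounded_family T' fst (tail (Suc ?k)) g'" unfolding g'_def
      by (intro bounded_family_mult tail_subset g1 g2 comm)
    have h': "bounded_family T' fst letters (\<lambda>t. h (t1 t) \<otimes> h (t2 t))"
      by (intro bounded_family_mult letters_subset h1 h2)
    have eq: "cval (Bracket c d) [^] int (snd t) = g' t \<otimes> (h (t1 t) \<otimes> h (t2 t))" if t: "t \<in> T'" for t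
    proof -
      have z: "cval (Bracket c d) \<in> carrier G" using Bracket.prems by (rule cval_closed)
      have "int (snd t) = int (fst (snd (t1 t)) * snd (snd (t1 t))) + int (fst (snd (t2 t)) * snd (snd (t2 t)))"
        unfolding t1_def t2_def fst_conv snd_conv of_nat_add[symmetric] by simp
      hence "cval (Bracket c d) [^] int (snd t) = (g (t1 t) \<otimes> h (t1 t)) \<otimes> (g (t2 t) \<otimes> h (t2 t))"
        by (simp only: int_pow_mult[OF z] gh(1) t12[OF t])
      also have "\<dots> = g' t \<otimes> (h (t1 t) \<otimes> h (t2 t))"
        unfolding g'_def
        using bounded_family_closed[OF g1 tail_subset t] bounded_family_closed[OF g2 tail_subset t]
          bounded_family_closed[OF h1 letters_subset(1) t] bounded_family_closed[OF h2 letters_subset(1) t]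
        by (simp add: word_simps)
      finally show ?thesis .
    qed
    show "\<exists>M'\<ge>1. leading_bound (Bracket c d) M M'"
    proof (rule bounded_familyD[OF g'], rule bounded_familyD[OF h'])
      fix K L
      assume K: "1 \<le> K" "\<And>t N. \<lbrakk>t \<in> T'; K \<le> N\<rbrakk> \<Longrightarrow> g' t \<in> words (fst t) (tail (Suc ?k)) N N"
        and L: "\<And>t N. \<lbrakk>t \<in> T'; L \<le> N\<rbrakk> \<Longrightarrow> h (t1 t) \<otimes> h (t2 t) \<in> words (fst t) letters N N"
      have "leading_bound (Bracket c d) M (max K L)"
        unfolding leading_bound_def
      proof (intro allI impI bexI)
        fix \<rho> b assume "admissible_scale \<rho>" "real b \<le> M * fc_scale \<rho> (Bracket c d)"
        hence t: "(\<rho>, b) \<in> T'" by (simp add: T'_def)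
        show "cval (Bracket c d) [^] int b = g' (\<rho>, b) \<otimes> (h (t1 (\<rho>, b)) \<otimes> h (t2 (\<rho>, b)))"
          using eq[OF t] by simp
        show "g' (\<rho>, b) \<in> words \<rho> (tail (Suc (fc_length (Bracket c d)))) (max K L) (max K L)"
          using K(2)[OF t, of "max K L"] by simp
        show "h (t1 (\<rho>, b)) \<otimes> h (t2 (\<rho>, b)) \<in> words \<rho> letters (max K L) (max K L)"
          using L[OF t, of "max K L"] by simp
      qed
      moreover have "1 \<le> max K L" using K(1) by simp
      ultimately show ?thesis by blast
    qed
  qed
qed

text \<open>Descending induction on the length: each shortest commutator is replaced by its leading term, and
  the longer ones are covered by the induction hypothesis.\<close>

lemma words_in_letters:
  assumes "1 \<le> j"
  shows "\<forall>M\<ge>1. \<exists>M'\<ge>1. \<forall>\<rho>. admissible_scale \<rho> \<longrightarrow> words \<rho> (tail j) M M \<subseteq> words \<rho> letters M' M'"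
    (is "?P j")
proof -
  have triv: "?P j" if "\<kappa> < j" for j
  proof (intro allI impI)
    fix M :: real
    show "\<exists>M'\<ge>1. \<forall>\<rho>. admissible_scale \<rho> \<longrightarrow> words \<rho> (tail j) M M \<subseteq> words \<rho> letters M' M'"
    proof (intro exI[of _ 1] conjI allI impI)
      fix \<rho>
      have "words \<rho> (tail j) M M \<subseteq> {\<one>}"
        using that long_trivial by (intro words_trivial) (auto simp: tail_def)
      also have "\<dots> \<subseteq> words \<rho> letters 1 1" by (simp add: one_in_short_products)
      finally show "words \<rho> (tail j) M M \<subseteq> words \<rho> letters 1 1" .
    qed simp
  qed
  have down: "?P j" if IH: "?P (Suc j)" and j: "1 \<le> j" for j
  proof (intro allI impI)
    fix M :: real assume M: "1 \<le> M"
    let ?C = "{c \<in> formal_commutators S. fc_length c = j}"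
    have fin: "finite ?C" by (rule finite_subset[OF _ finite_formal_commutators_length[of S j]]) auto
    have "\<forall>c\<in>?C. \<exists>M'. 1 \<le> M' \<and> leading_bound c M M'" using leading_term M by blast
    from bchoice[OF this] obtain Mc where Mc: "\<forall>c\<in>?C. 1 \<le> Mc c \<and> leading_bound c M (Mc c)"
      by (elim exE)
    define M1 where "M1 = M + (\<Sum>c\<in>?C. Mc c)"
    have pos: "0 \<le> Mc c" if "c \<in> ?C" for c
      using conjunct1[OF bspec[OF Mc that]] by linarith
    have M1: "1 \<le> M1" "M \<le> M1" using M sum_nonneg[of ?C Mc, OF pos] by (auto simp: M1_def)
    have McM1: "Mc c \<le> M1" if "c \<in> ?C" for c
    proof -
      have "Mc c \<le> (\<Sum>c\<in>?C. Mc c)" using that pos fin by (intro member_le_sum) auto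
      thus ?thesis using M by (simp add: M1_def)
    qed
    from IH[rule_format, OF M1(1)] obtain M2 where M2: "1 \<le> M2"
      "\<forall>\<rho>. admissible_scale \<rho> \<longrightarrow> words \<rho> (tail (Suc j)) M1 M1 \<subseteq> words \<rho> letters M2 M2"
      by (elim exE conjE)
    define N where "N = M1 + M2"
    have N: "1 \<le> N" "M1 \<le> N" "M2 \<le> N" using M1 M2(1) by (auto simp: N_def)
    show "\<exists>M'\<ge>1. \<forall>\<rho>. admissible_scale \<rho> \<longrightarrow> words \<rho> (tail j) M M \<subseteq> words \<rho> letters M' M'"
    proof (intro exI[of _ "M * N"] conjI allI impI subsetI)
      show MN: "1 \<le> M * N" using M N mult_mono[of 1 M 1 N] by auto
      fix \<rho> w assume \<rho>: "admissible_scale \<rho>" and w: "w \<in> words \<rho> (tail j) M M"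
      have long: "words \<rho> (tail (Suc j)) M1 M1 \<subseteq> words \<rho> letters M2 M2" using M2(2) \<rho> by blast
      have "powers \<rho> (tail j) M \<subseteq> words \<rho> letters N N"
      proof
        fix a assume "a \<in> powers \<rho> (tail j) M"
        then obtain c b where c: "a = cval c [^] b" "c \<in> formal_commutators S" "j \<le> fc_length c"
          "\<bar>real_of_int b\<bar> \<le> M * fc_scale \<rho> c"
          by (auto simp: powers_def tail_def)
        show "a \<in> words \<rho> letters N N"
        proof (cases "fc_length c = j")
          case False
          have "a \<in> words \<rho> (tail (Suc j)) M 1"
            unfolding c(1) using c False by (intro words_single tail_subset) (auto simp: tail_def)
          hence "a \<in> words \<rho> (tail (Suc j)) M1 M1"
            by (rule words_monoD) (use \<rho> M M1 in auto)
          with long have "a \<in> words \<rho> letters M2 M2" by blast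
          thus ?thesis by (rule words_monoD) (use \<rho> N in auto)
        next
          case True
          hence cC: "c \<in> ?C" using c by simp
          have b: "real (nat \<bar>b\<bar>) \<le> M * fc_scale \<rho> c" using c(4) by simp
          from leading_boundD[OF conjunct2[OF bspec[OF Mc cC]] \<rho> b] True obtain g h where gh: "g \<in> words \<rho> (tail (Suc j)) (Mc c) (Mc c)"
            "h \<in> words \<rho> letters (Mc c) (Mc c)" "cval c [^] int (nat \<bar>b\<bar>) = g \<otimes> h"
            by auto
          have "g \<in> words \<rho> (tail (Suc j)) M1 M1"
            using gh(1) by (rule words_monoD) (use \<rho> McM1[OF cC] in auto)
          with long have "g \<in> words \<rho> letters M2 M2" by blast
          hence "g \<in> words \<rho> letters N M2" by (rule words_monoD) (use \<rho> N in auto)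
          moreover have "h \<in> words \<rho> letters N M1"
            using gh(2) by (rule words_monoD) (use \<rho> N McM1[OF cC] in auto)
          ultimately have "g \<otimes> h \<in> words \<rho> letters N (M2 + M1)"
            by (intro words_mult letters_subset)
          hence *: "cval c [^] \<bar>b\<bar> \<in> words \<rho> letters N N" using gh(3) by (simp add: N_def add.commute)
          show ?thesis
          proof (cases "0 \<le> b")
            case False
            have "a = inv (cval c [^] \<bar>b\<bar>)" unfolding c(1) using False c(2) by (simp add: int_pow_neg)
            thus ?thesis using words_inv[OF * letters_subset(1)] by simp
          qed (use * c(1) in simp)
        qed
      qed
      hence "w \<in> words \<rho> letters N (M * N)"
        using N by (intro short_products_nested[OF powers_closed[OF letters_subset(1)] _ w]) auto
      thus "w \<in> words \<rho> letters (M * N) (M * N)"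
        by (rule words_monoD) (use \<rho> M N mult_right_mono[of 1 M N] in auto)
    qed
  qed
  show ?thesis
  proof (cases "\<kappa> < j")
    case False
    hence "j \<le> Suc \<kappa>" by simp
    thus ?thesis using assms
    proof (induction rule: inc_induct)
      case base show ?case by (rule triv) simp
    next
      case (step n)
      show ?case
      proof (rule down)
        show "?P (Suc n)" by (rule step.IH) simp
        show "1 \<le> n" by (rule step.prems)
      qed
    qed
  qed (rule triv)
qed

lemma fc_scale_powr:
  assumes "c \<in> formal_commutators S" "0 < R" "\<And>i. i < length S \<Longrightarrow> \<rho> i = R powr (v ! i)"
  shows "fc_scale \<rho> c = R powr fc_weight v c"
  using assms(1)
proof (induction c)
  case (Letter l)
  thus ?case using assms(3)[of "fst l"] by (cases l) (auto simp: formal_commutators_def)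
qed (use assms in \<open>auto simp: powr_add\<close>)

text \<open>The geometric core. Let \<open>h = g [^] n\<close> lie in the weight subgroup and put \<open>R = (1 + \<bar>a\<bar>) powr (1 / w)\<close>.
  The power \<open>h [^] q\<close> with \<open>\<bar>q\<bar> \<le> \<bar>a\<bar>\<close> is a word with about \<open>R powr w\<close> factors \<open>c [^] (\<plusminus>1)\<close>, where \<open>c\<close> has
  scale at least \<open>R powr w\<close>. The slack is thus the reciprocal of the number of factors, so the word
  collapses, and the result is rewritten in letters.\<close>

lemma isolator_powers:
  assumes gen: "generate G (set S) = carrier G" and v: "length v = length S" "\<And>x. x \<in> set v \<Longrightarrow> 0 < x"
    and w: "0 < w" and g: "g \<in> isolator G (weight_subgroup G S v w)"
  shows "\<exists>M\<ge>1. \<forall>a::int. g [^] a \<in> short_products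
    {S ! i [^] b | i b. i < length S \<and> \<bar>real_of_int b\<bar> \<le> M * (1 + \<bar>real_of_int a\<bar>) powr (v ! i / w)} M"
proof -
  obtain n :: nat where gc: "g \<in> carrier G" and n: "1 \<le> n" "g [^] n \<in> weight_subgroup G S v w"
    using g by (auto simp: isolator_def)
  let ?D = "{c \<in> formal_commutators S. w \<le> fc_weight v c}"
  have D: "cval ` ?D \<subseteq> carrier G" by auto
  from generate_short_product[OF D n(2)[unfolded weight_subgroup_def]]
  obtain L where L: "1 \<le> L" "g [^] n \<in> short_products {cval c [^] b | c b. c \<in> ?D \<and> \<bar>b::int\<bar> \<le> 1} L"
    by (elim exE conjE)
  let ?E = "{(i, True) | i. i < length S}"
  have E: "(\<lambda>l. cval (Letter l)) ` ?E = set S" by (force simp: set_conv_nth)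
  have "\<forall>r::nat. \<exists>L. 1 \<le> L \<and>
      g [^] r \<in> short_products {cval (Letter l) [^] b | l b. l \<in> ?E \<and> \<bar>b::int\<bar> \<le> 1} L"
    by (intro allI generate_short_product) (unfold E gen, use gc S_closed in auto)
  from choice[OF this] obtain Lr where Lr: "\<And>r::nat. 1 \<le> Lr r" "\<And>r::nat. g [^] r
      \<in> short_products {cval (Letter l) [^] b | l b. l \<in> ?E \<and> \<bar>b::int\<bar> \<le> 1} (Lr r)"
    by auto
  define L2 where "L2 = (\<Sum>r<n. Lr r)"
  have L2: "Lr r \<le> L2" if "r < n" for r
    unfolding L2_def using that Lr(1) by (intro member_le_sum) (auto intro: order_trans[OF zero_le_one])
  have L20: "0 \<le> L2" unfolding L2_def using Lr(1) by (intro sum_nonneg) (auto intro: order_trans[OF zero_le_one])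
  have "collapsible (tail 1)" using collapsible_and_commutes[of 1] by simp
  then obtain M1 where M1: "1 \<le> M1" "collapse_bound (tail 1) L M1"
    using collapsibleE[OF _ L(1)] by blast
  from words_in_letters[OF order.refl, rule_format, OF M1(1)] obtain M2 where M2: "1 \<le> M2"
    "\<forall>\<rho>. admissible_scale \<rho> \<longrightarrow> words \<rho> (tail 1) M1 M1 \<subseteq> words \<rho> letters M2 M2"
    by (elim exE conjE)
  define M where "M = M2 + L2"
  have M: "1 \<le> M" "M2 \<le> M" using M2 L20 by (auto simp: M_def)
  show ?thesis
  proof (intro exI[of _ M] conjI allI M(1))
    fix a :: int
    define A where "A = 1 + \<bar>real_of_int a\<bar>"
    define R where "R = A powr (1 / w)"
    define \<rho> where "\<rho> i = (if i < length S then R powr (v ! i) else 1)" for i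
    have A: "1 \<le> A" by (simp add: A_def)
    have R: "1 \<le> R" using A w by (auto simp: R_def ge_one_powr_ge_zero)
    have \<rho>i: "\<rho> i = A powr (v ! i / w)" if "i < length S" for i
      using that by (simp add: \<rho>_def R_def powr_powr)
    have \<rho>: "admissible_scale \<rho>" unfolding admissible_scale_def \<rho>_def
      using R v less_imp_le[OF v(2)[OF nth_mem]] by (auto intro!: ge_one_powr_ge_zero)
    have sc: "A \<le> fc_scale \<rho> c" if "c \<in> ?D" for c
    proof -
      have "fc_scale \<rho> c = R powr fc_weight v c"
        using that R by (intro fc_scale_powr) (auto simp: \<rho>_def)
      moreover have "R powr w \<le> R powr fc_weight v c" using that R by (intro powr_mono) auto
      moreover have "R powr w = A" using A w by (simp add: R_def powr_powr)
      ultimately show ?thesis by simp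
    qed
    define q where "q = a div int n"
    define r where "r = nat (a mod int n)"
    have r: "r < n" "a = int n * q + int r" using n(1) by (auto simp: r_def q_def nat_less_iff)
    have qa: "\<bar>q\<bar> \<le> \<bar>a\<bar>"
    proof (cases "0 \<le> q")
      case True
      have "1 * q \<le> int n * q" using n(1) True by (intro mult_right_mono) auto
      thus ?thesis using True r(2) by linarith
    next
      case False
      have "int n * (q + 1) \<le> 1 * (q + 1)" using n(1) False by (intro mult_right_mono_neg) auto
      hence "int n * q + int n \<le> q + 1" by (simp add: algebra_simps)
      thus ?thesis using False r by linarith
    qed
    have split: "g [^] a = (g [^] n) [^] q \<otimes> g [^] r"
    proof -
      have "g [^] a = g [^] (int n * q) \<otimes> g [^] int r" using gc by (simp add: r(2) int_pow_mult)
      thus ?thesis using int_pow_pow[OF gc, of "int n" q] by (simp add: int_pow_int mult.commute)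
    qed
    \<comment> \<open>a power of an element of the weight subgroup is a long word in unit powers, which collapses\<close>
    have A1: "{cval c [^] b | c b. c \<in> ?D \<and> \<bar>b::int\<bar> \<le> 1} \<subseteq> powers \<rho> (tail 1) (L * (1 / A))"
    proof clarify
      fix c and b :: int assume c: "c \<in> formal_commutators S" "w \<le> fc_weight v c" "\<bar>b\<bar> \<le> 1"
      have "1 * 1 \<le> L * (fc_scale \<rho> c / A)" using L(1) sc[of c] c A by (intro mult_mono) auto
      moreover have "\<bar>real_of_int b\<bar> \<le> 1" using c(3) by linarith
      ultimately show "cval c [^] b \<in> powers \<rho> (tail 1) (L * (1 / A))"
        using c fc_length_pos[of c] by (intro powersI) (auto simp: tail_def)
    qed
    have len: "real (nat \<bar>q\<bar>) * L \<le> L * A"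
      using qa L(1) by (simp add: A_def mult.commute)
    have "(g [^] n) [^] nat \<bar>q\<bar> \<in> short_products {cval c [^] b | c b. c \<in> ?D \<and> \<bar>b::int\<bar> \<le> 1} (real (nat \<bar>q\<bar>) * L)"
      by (rule nat_pow_in_short_products[OF _ L(2)]) auto
    from subsetD[OF short_products_mono[OF A1 len] this]
    have "(g [^] n) [^] nat \<bar>q\<bar> \<in> words \<rho> (tail 1) (M1 * (A * (1 / A))) M1"
      by (rule collapse_boundD[OF M1(2)]) (use \<rho> A in auto)
    hence "(g [^] n) [^] nat \<bar>q\<bar> \<in> words \<rho> (tail 1) M1 M1" using A by simp
    from subsetD[OF M2(2)[rule_format, OF \<rho>] this]
    have hq: "(g [^] n) [^] nat \<bar>q\<bar> \<in> words \<rho> letters M2 M2" .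
    have "(g [^] n) [^] q \<in> words \<rho> letters M2 M2"
    proof (cases "0 \<le> q")
      case True
      hence "(g [^] n) [^] q = (g [^] n) [^] nat \<bar>q\<bar>"
        using int_pow_int[of G "g [^] n" "nat \<bar>q\<bar>"] by simp
      thus ?thesis using hq by simp
    next
      case False
      hence "(g [^] n) [^] q = inv ((g [^] n) [^] nat \<bar>q\<bar>)"
        using int_pow_neg_int[of "g [^] n" "nat \<bar>q\<bar>"] gc by simp
      thus ?thesis using words_inv[OF hq letters_subset(1)] by simp
    qed
    hence 1: "(g [^] n) [^] q \<in> words \<rho> letters M M2"
      by (rule words_monoD) (use \<rho> M in auto)
    have "{cval (Letter l) [^] b | l b. l \<in> ?E \<and> \<bar>b::int\<bar> \<le> 1} \<subseteq> powers \<rho> letters M"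
    proof clarify
      fix i and b :: int assume i: "i < length S" "\<bar>b\<bar> \<le> 1"
      have "1 * 1 \<le> M * \<rho> i" using M \<rho> by (intro mult_mono) (auto simp: admissible_scale_def)
      moreover have "\<bar>real_of_int b\<bar> \<le> 1" using i(2) by linarith
      ultimately show "cval (Letter (i, True)) [^] b \<in> powers \<rho> letters M"
        using i(1) by (intro powersI) (auto simp: letters_def formal_commutators_def)
    qed
    from subsetD[OF short_products_mono[OF this L2[OF r(1)]] Lr(2)]
    have 2: "g [^] r \<in> words \<rho> letters M L2" .
    have 3: "g [^] a \<in> words \<rho> letters M M"
      using words_mult[OF 1 2 letters_subset(1)] unfolding split by (simp add: M_def)
    have "powers \<rho> letters M \<subseteq> {S ! i [^] b | i b. i < length S \<and>
        \<bar>real_of_int b\<bar> \<le> M * (1 + \<bar>real_of_int a\<bar>) powr (v ! i / w)}" (is "_ \<subseteq> ?B")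
    proof
      fix x assume "x \<in> powers \<rho> letters M"
      then obtain c b where c: "x = cval c [^] b" "c \<in> formal_commutators S" "fc_length c = 1"
        "\<bar>real_of_int b\<bar> \<le> M * fc_scale \<rho> c"
        by (auto simp: powers_def letters_def)
      show "x \<in> ?B"
      proof (cases c)
        case (Bracket c1 c2)
        thus ?thesis using c(3) fc_length_pos[of c1] fc_length_pos[of c2] by simp
      next
        case (Letter l)
        then obtain i s where l: "c = Letter (i, s)" "i < length S"
          using c(2) by (cases l) (auto simp: formal_commutators_def)
        have b: "\<bar>real_of_int b\<bar> \<le> M * (1 + \<bar>real_of_int a\<bar>) powr (v ! i / w)"
          using c(4) l \<rho>i[of i] by (simp add: A_def)
        have Si: "S ! i \<in> carrier G" using l(2) S_closed nth_mem by blast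
        show ?thesis
        proof (cases s)
          case True thus ?thesis using c(1) l b by auto
        next
          case False
          hence "x = S ! i [^] (- b)" using c(1) l Si by (simp add: int_pow_inv int_pow_neg)
          thus ?thesis using l(2) b by (intro CollectI exI[of _ i] exI[of _ "- b"]) auto
        qed
      qed
    qed
    from subsetD[OF short_products_mono[OF this order.refl] 3] show "g [^] a \<in> short_products ?B M" .
  qed
qed

end

section \<open>Tails of power sums\<close>

lemma powr_step:
  fixes \<beta> x :: real
  assumes "0 < \<beta>" "1 \<le> x"
  shows "x powr (- 1 - \<beta>) \<le> 2 powr (1 + \<beta>) / \<beta> * (x powr - \<beta> - (x + 1) powr - \<beta>)"
proof -
  have der: "((\<lambda>t. t powr - \<beta>) has_real_derivative - \<beta> * t powr (- \<beta> - 1)) (at t)" if "x \<le> t" for t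
    using that assms by (auto intro!: derivative_eq_intros)
  obtain z where z: "x < z" "z < x + 1"
    "(x + 1) powr - \<beta> - x powr - \<beta> = (x + 1 - x) * (- \<beta> * z powr (- \<beta> - 1))"
    using MVT2[of x "x + 1" "\<lambda>t. t powr - \<beta>" "\<lambda>t. - \<beta> * t powr (- \<beta> - 1)"] der by force
  define X Y Z where "X = x powr - \<beta>" and "Y = (x + 1) powr - \<beta>" and "Z = z powr (- \<beta> - 1)"
  have "x + 1 - x = 1" by simp
  from z(3)[unfolded this mult_1_left] have "Y - X = - \<beta> * Z" unfolding X_def Y_def Z_def .
  hence Z: "Z = (X - Y) / \<beta>" using assms(1) by (simp add: eq_divide_eq mult.commute)
  have "x powr (- 1 - \<beta>) = 2 powr (1 + \<beta>) * (2 * x) powr (- \<beta> - 1)"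
  proof -
    have "2 powr (1 + \<beta>) * (2 powr (- \<beta> - 1) * x powr (- \<beta> - 1)) = 2 powr 0 * x powr (- 1 - \<beta>)"
      unfolding mult.assoc[symmetric] powr_add[symmetric] by (rule arg_cong2[where f = "\<lambda>s t. 2 powr s * x powr t"]) simp_all
    thus ?thesis using assms(2) by (simp add: powr_mult)
  qed
  also have "\<dots> \<le> 2 powr (1 + \<beta>) * Z" unfolding Z_def
    using z assms by (intro mult_left_mono powr_mono2') auto
  also have "\<dots> = 2 powr (1 + \<beta>) / \<beta> * (X - Y)" unfolding Z by simp
  finally show ?thesis unfolding X_def Y_def .
qed

lemma sum_powr_nat_tail:
  fixes \<beta> :: real
  assumes "0 < \<beta>" "1 \<le> m"
  shows "(\<Sum>i=m..n. real i powr (- 1 - \<beta>)) \<le> 2 powr (1 + \<beta>) / \<beta> * real m powr - \<beta>"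
proof (cases "m \<le> n")
  case True
  have "(\<Sum>i=m..n. real i powr (- 1 - \<beta>))
      \<le> 2 powr (1 + \<beta>) / \<beta> * (real m powr - \<beta> - (real n + 1) powr - \<beta>)"
    using True
  proof (induction n rule: dec_induct)
    case base show ?case using powr_step[of \<beta> "real m"] assms by simp
  next
    case (step n)
    have "(\<Sum>i=m..Suc n. real i powr (- 1 - \<beta>))
        = (\<Sum>i=m..n. real i powr (- 1 - \<beta>)) + real (Suc n) powr (- 1 - \<beta>)"
      using step by simp
    also have "\<dots> \<le> 2 powr (1 + \<beta>) / \<beta> * (real m powr - \<beta> - (real n + 1) powr - \<beta>)
        + 2 powr (1 + \<beta>) / \<beta> * ((real n + 1) powr - \<beta> - (real n + 1 + 1) powr - \<beta>)"
      using step.IH powr_step[of \<beta> "real n + 1"] assms by (intro add_mono) (auto simp: add.commute)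
    finally show ?case by (simp add: algebra_simps)
  qed
  also have "\<dots> \<le> 2 powr (1 + \<beta>) / \<beta> * real m powr - \<beta>"
    using assms by (intro mult_left_mono) auto
  finally show ?thesis .
qed (use assms in auto)

text \<open>Nonnegative and negative integers are counted separately; on each part the map
  \<open>a \<mapsto> 1 + \<bar>a\<bar>\<close> is injective.\<close>

lemma sum_powr_int_tail:
  fixes \<beta> :: real
  assumes \<beta>: "0 < \<beta>"
  shows "\<exists>C>0. \<forall>A>0. \<forall>F :: int set. finite F \<longrightarrow>
    (\<Sum>a | a \<in> F \<and> A \<le> 1 + \<bar>real_of_int a\<bar>. (1 + \<bar>real_of_int a\<bar>) powr (- 1 - \<beta>)) \<le> C * A powr - \<beta>"
proof (intro exI[of _ "2 * (2 powr (1 + \<beta>) / \<beta>)"] conjI allI impI)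
  let ?K = "2 powr (1 + \<beta>) / \<beta>"
  show "0 < 2 * ?K" using \<beta> by simp
  fix A :: real and F :: "int set" assume A: "0 < A" and F: "finite F"
  define m where "m = max 1 (nat \<lceil>A\<rceil>)"
  define \<phi> where "\<phi> a = nat (1 + \<bar>a\<bar>)" for a :: int
  have \<phi>r: "real (\<phi> a) = 1 + \<bar>real_of_int a\<bar>" for a
    unfolding \<phi>_def by (subst of_nat_nat) simp_all
  define F' where "F' = {a \<in> F. A \<le> 1 + \<bar>real_of_int a\<bar>}"
  have F': "finite F'" using F by (simp add: F'_def)
  define n where "n = Max (\<phi> ` F')"
  have n: "\<phi> a \<le> n" if "a \<in> F'" for a unfolding n_def using F' that by (intro Max_ge) auto
  have \<phi>m: "m \<le> \<phi> a" if "a \<in> F'" for a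
  proof -
    have "\<lceil>A\<rceil> \<le> 1 + \<bar>a\<bar>" using that unfolding F'_def by (intro ceiling_le) simp
    hence "nat \<lceil>A\<rceil> \<le> nat (1 + \<bar>a\<bar>)" by (rule nat_mono)
    moreover have "1 \<le> nat (1 + \<bar>a\<bar>)" by linarith
    ultimately show ?thesis unfolding m_def \<phi>_def by (rule max.boundedI[rotated])
  qed
  have part: "(\<Sum>a\<in>X. (1 + \<bar>real_of_int a\<bar>) powr (- 1 - \<beta>)) \<le> ?K * A powr - \<beta>"
    if X: "X \<subseteq> F'" "inj_on \<phi> X" for X
  proof -
    have "(\<Sum>a\<in>X. (1 + \<bar>real_of_int a\<bar>) powr (- 1 - \<beta>)) = (\<Sum>a\<in>X. real (\<phi> a) powr (- 1 - \<beta>))"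
      by (simp only: \<phi>r)
    also have "\<dots> = (\<Sum>i\<in>\<phi> ` X. real i powr (- 1 - \<beta>))"
      using X(2) by (rule sum.reindex_cong[OF _ refl refl, symmetric])
    also have "\<dots> \<le> (\<Sum>i=m..n. real i powr (- 1 - \<beta>))"
      using X(1) by (intro sum_mono2) (auto intro!: n \<phi>m)
    also have "\<dots> \<le> ?K * real m powr - \<beta>" using \<beta> by (intro sum_powr_nat_tail) (auto simp: m_def)
    also have "\<dots> \<le> ?K * A powr - \<beta>"
    proof (intro mult_left_mono powr_mono2')
      show "A \<le> real m" unfolding m_def using real_nat_ceiling_ge[of A] by (simp add: le_max_iff_disj)
    qed (use A \<beta> in auto)
    finally show ?thesis .
  qed
  have "(\<Sum>a\<in>F'. (1 + \<bar>real_of_int a\<bar>) powr (- 1 - \<beta>))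
      = (\<Sum>a\<in>{a \<in> F'. 0 \<le> a} \<union> {a \<in> F'. a < 0}. (1 + \<bar>real_of_int a\<bar>) powr (- 1 - \<beta>))"
    by (intro sum.cong) auto
  also have "\<dots> = (\<Sum>a | a \<in> F' \<and> 0 \<le> a. (1 + \<bar>real_of_int a\<bar>) powr (- 1 - \<beta>))
      + (\<Sum>a | a \<in> F' \<and> a < 0. (1 + \<bar>real_of_int a\<bar>) powr (- 1 - \<beta>))"
    using F' by (intro sum.union_disjoint) auto
  also have "\<dots> \<le> ?K * A powr - \<beta> + ?K * A powr - \<beta>"
    by (intro add_mono part) (auto simp: inj_on_def \<phi>_def)
  finally show "(\<Sum>a | a \<in> F \<and> A \<le> 1 + \<bar>real_of_int a\<bar>. (1 + \<bar>real_of_int a\<bar>) powr (- 1 - \<beta>))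
      \<le> 2 * ?K * A powr - \<beta>"
    unfolding F'_def mem_Collect_eq by (simp only: mult.assoc mult_2 distrib_right)
qed

lemma summable_powr_int:
  fixes \<beta> :: real
  assumes "0 < \<beta>"
  shows "(\<lambda>a::int. (1 + \<bar>real_of_int a\<bar>) powr (- 1 - \<beta>)) summable_on UNIV"
proof -
  obtain C where C: "0 < C" "\<forall>A>0. \<forall>F :: int set. finite F \<longrightarrow>
    (\<Sum>a | a \<in> F \<and> A \<le> 1 + \<bar>real_of_int a\<bar>. (1 + \<bar>real_of_int a\<bar>) powr (- 1 - \<beta>)) \<le> C * A powr - \<beta>"
    using sum_powr_int_tail[OF assms] by blast
  show ?thesis
  proof (rule nonneg_bounded_partial_sums_imp_summable_on)
    show "\<forall>\<^sub>F X in finite_subsets_at_top UNIV. (\<Sum>a\<in>X. (1 + \<bar>real_of_int a\<bar>) powr (- 1 - \<beta>)) \<le> C"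
      using C(2)[rule_format, of 1] by (intro eventually_finite_subsets_at_top_weakI) simp
  qed auto
qed

lemma finite_int_interval: "finite {k::int. \<bar>real_of_int k\<bar> \<le> r}"
proof (rule finite_subset)
  show "{k::int. \<bar>real_of_int k\<bar> \<le> r} \<subseteq> {- \<lfloor>r\<rfloor>..\<lfloor>r\<rfloor>}"
  proof
    fix k :: int assume "k \<in> {k. \<bar>real_of_int k\<bar> \<le> r}"
    hence "real_of_int k \<le> r" "real_of_int (- k) \<le> r" by auto
    hence "k \<le> \<lfloor>r\<rfloor>" "- k \<le> \<lfloor>r\<rfloor>" by (simp_all only: le_floor_iff)
    thus "k \<in> {- \<lfloor>r\<rfloor>..\<lfloor>r\<rfloor>}" by simp
  qed
qed simp

section \<open>Energies of translations\<close>

context group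
begin

text \<open>The squared \<open>\<ell>\<^sup>2\<close>-norm of the increment of \<open>f\<close> under right translation by \<open>g\<close>.\<close>

definition translation_energy :: "('a \<Rightarrow> real) \<Rightarrow> 'a \<Rightarrow> real" where
  "translation_energy f g = (\<Sum>\<^sub>\<infinity>x\<in>carrier G. (f (x \<otimes> g) - f x)\<^sup>2)"

lemma right_translation_bij: "g \<in> carrier G \<Longrightarrow> bij_betw (\<lambda>x. x \<otimes> g) (carrier G) (carrier G)"
  by (rule bij_betwI[of _ _ _ "\<lambda>x. x \<otimes> inv g"]) (auto simp: m_assoc)

lemma finite_translated_support:
  assumes "f \<in> finitely_supported G" "g \<in> carrier G"
  shows "finite {x \<in> carrier G. f (x \<otimes> g) \<noteq> 0}"
proof -
  have "{x \<in> carrier G. f (x \<otimes> g) \<noteq> 0} \<subseteq> (\<lambda>y. y \<otimes> inv g) ` {x \<in> carrier G. f x \<noteq> 0}"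
  proof
    fix x assume "x \<in> {x \<in> carrier G. f (x \<otimes> g) \<noteq> 0}"
    thus "x \<in> (\<lambda>y. y \<otimes> inv g) ` {x \<in> carrier G. f x \<noteq> 0}"
      using assms(2) by (intro image_eqI[of _ _ "x \<otimes> g"]) (auto simp: m_assoc)
  qed
  thus ?thesis using assms(1) finite_surj by (auto simp: finitely_supported_def)
qed

lemma translation_energy_summable:
  assumes f: "f \<in> finitely_supported G" and g: "g \<in> carrier G"
  shows "(\<lambda>x. (f (x \<otimes> g) - f x)\<^sup>2) summable_on carrier G"
proof (rule finite_nonzero_values_imp_summable_on)
  have "{x \<in> carrier G. (f (x \<otimes> g) - f x)\<^sup>2 \<noteq> 0}
      \<subseteq> {x \<in> carrier G. f (x \<otimes> g) \<noteq> 0} \<union> {x \<in> carrier G. f x \<noteq> 0}" by auto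
  thus "finite {x \<in> carrier G. (f (x \<otimes> g) - f x)\<^sup>2 \<noteq> 0}"
    by (rule finite_subset)
      (use finite_translated_support[OF f g] f in \<open>auto simp: finitely_supported_def\<close>)
qed

lemma translation_energy_nonneg: "0 \<le> translation_energy f g"
  unfolding translation_energy_def by (rule infsum_nonneg) auto

lemma translation_energy_one: "translation_energy f \<one> = 0"
proof -
  have "translation_energy f \<one> = (\<Sum>\<^sub>\<infinity>x\<in>carrier G. 0)"
    unfolding translation_energy_def by (intro infsum_cong) auto
  thus ?thesis by simp
qed

lemma square_add_le: "((x::real) + y)\<^sup>2 \<le> 2 * x\<^sup>2 + 2 * y\<^sup>2"
  using sum_squares_ge_zero[of "x - y" 0] by (simp add: power2_eq_square algebra_simps)

lemma translation_energy_mult: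
  assumes f: "f \<in> finitely_supported G" and g: "g \<in> carrier G" and h: "h \<in> carrier G"
  shows "translation_energy f (g \<otimes> h) \<le> 2 * translation_energy f g + 2 * translation_energy f h"
proof -
  note s = translation_energy_summable[OF f]
  have reidx: "(\<lambda>x. (f (x \<otimes> g \<otimes> h) - f (x \<otimes> g))\<^sup>2) summable_on carrier G"
      "(\<Sum>\<^sub>\<infinity>x\<in>carrier G. (f (x \<otimes> g \<otimes> h) - f (x \<otimes> g))\<^sup>2) = translation_energy f h"
    unfolding translation_energy_def
    using summable_on_reindex_bij_betw[OF right_translation_bij[OF g], of "\<lambda>x. (f (x \<otimes> h) - f x)\<^sup>2"]
      infsum_reindex_bij_betw[OF right_translation_bij[OF g], of "\<lambda>x. (f (x \<otimes> h) - f x)\<^sup>2"] s[OF h] by auto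
  have "translation_energy f (g \<otimes> h)
      \<le> (\<Sum>\<^sub>\<infinity>x\<in>carrier G. 2 * (f (x \<otimes> g \<otimes> h) - f (x \<otimes> g))\<^sup>2 + 2 * (f (x \<otimes> g) - f x)\<^sup>2)"
    unfolding translation_energy_def
  proof (rule infsum_mono)
    fix x assume "x \<in> carrier G"
    thus "(f (x \<otimes> (g \<otimes> h)) - f x)\<^sup>2 \<le> 2 * (f (x \<otimes> g \<otimes> h) - f (x \<otimes> g))\<^sup>2 + 2 * (f (x \<otimes> g) - f x)\<^sup>2"
      using square_add_le[of "f (x \<otimes> g \<otimes> h) - f (x \<otimes> g)" "f (x \<otimes> g) - f x"] g h by (simp add: m_assoc)
  qed (use s g h reidx in \<open>auto intro!: summable_on_add summable_on_cmult_right\<close>)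
  also have "\<dots> = (\<Sum>\<^sub>\<infinity>x\<in>carrier G. 2 * (f (x \<otimes> g \<otimes> h) - f (x \<otimes> g))\<^sup>2)
      + (\<Sum>\<^sub>\<infinity>x\<in>carrier G. 2 * (f (x \<otimes> g) - f x)\<^sup>2)"
    by (intro infsum_add summable_on_cmult_right reidx s g)
  also have "\<dots> = 2 * translation_energy f h + 2 * translation_energy f g"
    by (simp add: infsum_cmult_right' reidx(2)) (simp add: translation_energy_def)
  finally show ?thesis by simp
qed

lemma translation_energy_bound:
  assumes f: "f \<in> finitely_supported G" and g: "g \<in> carrier G"
  shows "translation_energy f g \<le> 4 * (\<Sum>\<^sub>\<infinity>x\<in>carrier G. (f x)\<^sup>2)"
proof -
  have s: "(\<lambda>x. (f x)\<^sup>2) summable_on carrier G"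
    using f by (intro finite_nonzero_values_imp_summable_on) (auto simp: finitely_supported_def)
  have s': "(\<lambda>x. (f (x \<otimes> g))\<^sup>2) summable_on carrier G"
      "(\<Sum>\<^sub>\<infinity>x\<in>carrier G. (f (x \<otimes> g))\<^sup>2) = (\<Sum>\<^sub>\<infinity>x\<in>carrier G. (f x)\<^sup>2)"
    using summable_on_reindex_bij_betw[OF right_translation_bij[OF g], of "\<lambda>x. (f x)\<^sup>2"]
      infsum_reindex_bij_betw[OF right_translation_bij[OF g], of "\<lambda>x. (f x)\<^sup>2"] s by auto
  have "translation_energy f g \<le> (\<Sum>\<^sub>\<infinity>x\<in>carrier G. 2 * (f (x \<otimes> g))\<^sup>2 + 2 * (f x)\<^sup>2)"
    unfolding translation_energy_def
  proof (rule infsum_mono)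
    fix x
    show "(f (x \<otimes> g) - f x)\<^sup>2 \<le> 2 * (f (x \<otimes> g))\<^sup>2 + 2 * (f x)\<^sup>2"
      using square_add_le[of "f (x \<otimes> g)" "- f x"] by simp
  qed (use translation_energy_summable[OF f g] s s' in \<open>auto intro!: summable_on_add summable_on_cmult_right\<close>)
  also have "\<dots> = (\<Sum>\<^sub>\<infinity>x\<in>carrier G. 2 * (f (x \<otimes> g))\<^sup>2) + (\<Sum>\<^sub>\<infinity>x\<in>carrier G. 2 * (f x)\<^sup>2)"
    by (intro infsum_add summable_on_cmult_right s s')
  also have "\<dots> = 4 * (\<Sum>\<^sub>\<infinity>x\<in>carrier G. (f x)\<^sup>2)" by (simp add: infsum_cmult_right' s'(2))
  finally show ?thesis .
qed

text \<open>Up to a constant, the energy of a power is at most the average energy of the powers of comparable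
  exponent: write \<open>t ^ b = t ^ (b - a) t ^ a\<close> and average over \<open>0 \<le> a \<le> r\<close>.\<close>

lemma translation_energy_power:
  fixes b :: int
  assumes f: "f \<in> finitely_supported G" and t: "t \<in> carrier G" and r: "0 < r" "\<bar>real_of_int b\<bar> \<le> r"
  shows "translation_energy f (t [^] b)
    \<le> 4 / r * (\<Sum>k | \<bar>real_of_int k\<bar> \<le> 2 * r. translation_energy f (t [^] (k::int)))"
proof -
  let ?K = "{k::int. \<bar>real_of_int k\<bar> \<le> 2 * r}" and ?D = "\<lambda>k::int. translation_energy f (t [^] k)"
  let ?A = "{0..\<lfloor>r\<rfloor>}"
  have K: "finite ?K" by (rule finite_int_interval)
  have A: "r \<le> real (card ?A)" using r by simp
  have "real (card ?A) * ?D b = (\<Sum>a\<in>?A. ?D b)" by simp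
  also have "\<dots> \<le> (\<Sum>a\<in>?A. 2 * ?D (b - a) + 2 * ?D a)"
  proof (rule sum_mono)
    fix a :: int
    have "t [^] b = t [^] (b - a) \<otimes> t [^] a" using t by (simp flip: int_pow_mult)
    thus "?D b \<le> 2 * ?D (b - a) + 2 * ?D a"
      using translation_energy_mult[OF f, of "t [^] (b - a)" "t [^] a"] t by simp
  qed
  also have "\<dots> = 2 * (\<Sum>a\<in>?A. ?D (b - a)) + 2 * (\<Sum>a\<in>?A. ?D a)"
    by (simp add: sum.distrib sum_distrib_left)
  also have "(\<Sum>a\<in>?A. ?D (b - a)) = (\<Sum>k\<in>(\<lambda>a. b - a) ` ?A. ?D k)"
    by (subst sum.reindex) (auto simp: inj_on_def)
  also have "\<dots> \<le> (\<Sum>k\<in>?K. ?D k)"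
  proof (intro sum_mono2 K translation_energy_nonneg subsetI)
    fix k assume "k \<in> (\<lambda>a. b - a) ` ?A"
    then obtain a where "k = b - a" "a \<in> ?A" by (rule imageE)
    moreover from this have "0 \<le> a" "real_of_int a \<le> r" by (simp_all add: le_floor_iff)
    ultimately show "k \<in> ?K" using r(2) by auto
  qed
  also have "(\<Sum>a\<in>?A. ?D a) \<le> (\<Sum>k\<in>?K. ?D k)"
    using r by (intro sum_mono2 K translation_energy_nonneg) (auto simp: le_floor_iff)
  finally have "real (card ?A) * ?D b \<le> 4 * (\<Sum>k\<in>?K. ?D k)" by simp
  moreover have "r * ?D b \<le> real (card ?A) * ?D b"
    using A translation_energy_nonneg by (rule mult_right_mono)
  ultimately show ?thesis using r(1) by (simp add: field_simps)
qed

lemma translation_energy_list: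
  assumes f: "f \<in> finitely_supported G" and B: "0 \<le> B"
    and gs: "set gs \<subseteq> carrier G" "\<And>g. g \<in> set gs \<Longrightarrow> translation_energy f g \<le> B"
  shows "translation_energy f (foldr (\<otimes>) gs \<one>) \<le> 4 ^ length gs * B"
  using gs
proof (induction gs)
  case Nil thus ?case using B by (simp add: translation_energy_one)
next
  case (Cons g gs)
  have "foldr (\<otimes>) gs \<one> \<in> carrier G" using Cons.prems(1) by (induction gs) auto
  hence "translation_energy f (foldr (\<otimes>) (g # gs) \<one>)
      \<le> 2 * translation_energy f g + 2 * translation_energy f (foldr (\<otimes>) gs \<one>)"
    using translation_energy_mult[OF f] Cons.prems(1) by simp
  also have "\<dots> \<le> 2 * B + 2 * (4 ^ length gs * B)"
    using Cons by (intro add_mono mult_left_mono) auto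
  also have "\<dots> \<le> 4 ^ length (g # gs) * B"
    using mult_right_mono[of 1 "4 ^ length gs" B] B by (simp add: mult.commute)
  finally show ?case .
qed

text \<open>The Dirichlet form of the (not normalised) measure \<open>power_law G T \<alpha>\<close>, up to the factor \<open>1 / 2\<close>.\<close>

definition power_energy :: "'a list \<Rightarrow> real list \<Rightarrow> ('a \<Rightarrow> real) \<Rightarrow> real" where
  "power_energy T \<alpha> f = (\<Sum>j<length T. \<Sum>\<^sub>\<infinity>a\<in>(UNIV :: int set).
     translation_energy f (T ! j [^] a) * (1 + \<bar>real_of_int a\<bar>) powr (- 1 - \<alpha> ! j))"

lemma power_energy_summable:
  assumes f: "f \<in> finitely_supported G" and t: "t \<in> carrier G" and \<alpha>: "0 < (\<alpha>::real)"
  shows "(\<lambda>a::int. translation_energy f (t [^] a) * (1 + \<bar>real_of_int a\<bar>) powr (- 1 - \<alpha>)) summable_on UNIV"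
proof (rule summable_on_comparison_test)
  let ?K = "4 * (\<Sum>\<^sub>\<infinity>x\<in>carrier G. (f x)\<^sup>2)"
  show "(\<lambda>a::int. ?K * (1 + \<bar>real_of_int a\<bar>) powr (- 1 - \<alpha>)) summable_on UNIV"
    by (intro summable_on_cmult_right summable_powr_int \<alpha>)
  fix a :: int
  show "translation_energy f (t [^] a) * (1 + \<bar>real_of_int a\<bar>) powr (- 1 - \<alpha>)
      \<le> ?K * (1 + \<bar>real_of_int a\<bar>) powr (- 1 - \<alpha>)"
    using t by (intro mult_right_mono translation_energy_bound f) auto
qed (auto simp: translation_energy_nonneg)

lemma has_sum_finite_sum:
  fixes F :: "'i \<Rightarrow> 'c \<Rightarrow> real"
  assumes "finite J" "\<And>j. j \<in> J \<Longrightarrow> (F j has_sum s j) A"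
  shows "((\<lambda>x. \<Sum>j\<in>J. F j x) has_sum (\<Sum>j\<in>J. s j)) A"
  using assms by (induction J rule: finite_induct) (auto intro: has_sum_add)

text \<open>Each coordinate of the power law is a sum of point masses on the graph of \<open>a \<mapsto> T ! j [^] a\<close>; the
  identity is an interchange of the sums over \<open>a\<close> and over the group.\<close>

lemma power_law_energy:
  assumes f: "f \<in> finitely_supported G" and T: "set T \<subseteq> carrier G"
    and \<alpha>: "length \<alpha> = length T" "\<And>x. x \<in> set \<alpha> \<Longrightarrow> 0 < x"
  shows "((\<lambda>h. translation_energy f h * power_law G T \<alpha> h) has_sum power_energy T \<alpha> f) (carrier G)"
proof -
  let ?D = "translation_energy f" and ?\<kappa> = "\<lambda>j a::int. (1 + \<bar>real_of_int a\<bar>) powr (- 1 - \<alpha> ! j)"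
  have "((\<lambda>h. ?D h * (\<Sum>\<^sub>\<infinity>a\<in>UNIV. indicat_real {T ! j [^] a} h * ?\<kappa> j a))
      has_sum (\<Sum>\<^sub>\<infinity>a\<in>UNIV. ?D (T ! j [^] a) * ?\<kappa> j a)) (carrier G)" if j: "j < length T" for j
  proof -
    have t: "T ! j \<in> carrier G" using T j nth_mem by blast
    have \<alpha>j: "0 < \<alpha> ! j" using \<alpha> j by simp
    let ?\<Phi> = "\<lambda>(a::int, h). ?D h * (indicat_real {T ! j [^] a} h * ?\<kappa> j a)"
    have row: "((\<lambda>h. ?\<Phi> (a, h)) has_sum ?D (T ! j [^] a) * ?\<kappa> j a) (carrier G)" for a
    proof -
      have "((\<lambda>h. ?\<Phi> (a, h)) has_sum (\<Sum>h\<in>{T ! j [^] a}. ?\<Phi> (a, h))) {T ! j [^] a}"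
        by (rule has_sum_finite) simp
      moreover have "((\<lambda>h. ?\<Phi> (a, h)) has_sum x) {T ! j [^] a} \<longleftrightarrow>
          ((\<lambda>h. ?\<Phi> (a, h)) has_sum x) (carrier G)" for x
        using t by (intro has_sum_cong_neutral) (auto simp: indicator_def)
      ultimately show ?thesis by simp
    qed
    have summ: "(\<lambda>a. ?D (T ! j [^] a) * ?\<kappa> j a) summable_on UNIV"
      by (rule power_energy_summable[OF f t \<alpha>j])
    have \<Phi>: "?\<Phi> summable_on (UNIV \<times> carrier G)"
      by (rule summable_on_SigmaI[OF row summ]) (auto simp: translation_energy_nonneg)
    hence "(?\<Phi> has_sum (\<Sum>\<^sub>\<infinity>a\<in>UNIV. ?D (T ! j [^] a) * ?\<kappa> j a)) (UNIV \<times> carrier G)"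
      by (intro has_sum_SigmaI[OF row] has_sum_infsum summ)
    hence hs: "((\<lambda>(h, a). ?\<Phi> (a, h)) has_sum (\<Sum>\<^sub>\<infinity>a\<in>UNIV. ?D (T ! j [^] a) * ?\<kappa> j a)) (carrier G \<times> UNIV)"
      by (subst (asm) has_sum_swap)
    show ?thesis
    proof (rule has_sum_SigmaD[OF hs])
      fix h
      have "(\<lambda>a. indicat_real {T ! j [^] a} h * ?\<kappa> j a) summable_on UNIV"
        by (rule summable_on_comparison_test[OF summable_powr_int[OF \<alpha>j]]) (auto simp: indicator_def)
      hence "((\<lambda>a. ?D h * (indicat_real {T ! j [^] a} h * ?\<kappa> j a))
          has_sum ?D h * (\<Sum>\<^sub>\<infinity>a\<in>UNIV. indicat_real {T ! j [^] a} h * ?\<kappa> j a)) UNIV"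
        by (intro has_sum_cmult_right has_sum_infsum)
      thus "((\<lambda>a. case (h, a) of (h, a) \<Rightarrow> ?\<Phi> (a, h))
          has_sum ?D h * (\<Sum>\<^sub>\<infinity>a\<in>UNIV. indicat_real {T ! j [^] a} h * ?\<kappa> j a)) UNIV" by simp
    qed
  qed
  hence "((\<lambda>h. \<Sum>j<length T. ?D h * (\<Sum>\<^sub>\<infinity>a\<in>UNIV. indicat_real {T ! j [^] a} h * ?\<kappa> j a))
      has_sum power_energy T \<alpha> f) (carrier G)"
    unfolding power_energy_def by (intro has_sum_finite_sum) auto
  thus ?thesis by (simp add: power_law_def sum_distrib_left)
qed

lemma dirichlet_form_eq:
  assumes f: "f \<in> finitely_supported G"
  shows "(\<lambda>h. translation_energy f h * pmf \<mu> h) summable_on carrier G"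
    and "dirichlet_form G \<mu> f = 1 / 2 * (\<Sum>\<^sub>\<infinity>h\<in>carrier G. translation_energy f h * pmf \<mu> h)"
proof -
  let ?D = "translation_energy f"
  let ?K = "4 * (\<Sum>\<^sub>\<infinity>x\<in>carrier G. (f x)\<^sup>2)"
  have K: "0 \<le> ?K" by (simp add: infsum_nonneg)
  show summ: "(\<lambda>h. ?D h * pmf \<mu> h) summable_on carrier G"
  proof (rule nonneg_bounded_partial_sums_imp_summable_on)
    show "\<forall>\<^sub>F X in finite_subsets_at_top (carrier G). (\<Sum>h\<in>X. ?D h * pmf \<mu> h) \<le> ?K"
    proof (rule eventually_finite_subsets_at_top_weakI)
      fix X assume X: "finite X" "X \<subseteq> carrier G"
      have "(\<Sum>h\<in>X. ?D h * pmf \<mu> h) \<le> (\<Sum>h\<in>X. ?K * pmf \<mu> h)"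
        using X by (intro sum_mono mult_right_mono translation_energy_bound f) auto
      also have "\<dots> = ?K * measure_pmf.prob \<mu> X"
        using X by (simp add: measure_measure_pmf_finite sum_distrib_left)
      also have "\<dots> \<le> ?K * 1" by (intro mult_left_mono K) simp
      finally show "(\<Sum>h\<in>X. ?D h * pmf \<mu> h) \<le> ?K" by simp
    qed
  qed (simp add: translation_energy_nonneg)
  let ?\<Phi> = "\<lambda>(h, g). \<bar>f (g \<otimes> h) - f g\<bar>\<^sup>2 * pmf \<mu> h"
  have row: "((\<lambda>g. ?\<Phi> (h, g)) has_sum ?D h * pmf \<mu> h) (carrier G)" if "h \<in> carrier G" for h
    using has_sum_cmult_left[OF has_sum_infsum[OF translation_energy_summable[OF f that]], of "pmf \<mu> h"]
    by (simp add: translation_energy_def)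
  have "?\<Phi> summable_on (carrier G \<times> carrier G)"
    by (rule summable_on_SigmaI[OF row summ]) auto
  hence "(?\<Phi> has_sum (\<Sum>\<^sub>\<infinity>h\<in>carrier G. ?D h * pmf \<mu> h)) (carrier G \<times> carrier G)"
    by (intro has_sum_SigmaI[OF row] has_sum_infsum summ)
  hence "((\<lambda>(g, h). ?\<Phi> (h, g)) has_sum (\<Sum>\<^sub>\<infinity>h\<in>carrier G. ?D h * pmf \<mu> h)) (carrier G \<times> carrier G)"
    by (subst (asm) has_sum_swap)
  from infsumI[OF this] show "dirichlet_form G \<mu> f = 1 / 2 * (\<Sum>\<^sub>\<infinity>h\<in>carrier G. ?D h * pmf \<mu> h)"
    by (simp add: dirichlet_form_def)
qed

lemma dirichlet_form_power_energy:
  assumes \<mu>: "is_stable_like G T \<alpha> \<mu>" and T: "set T \<subseteq> carrier G"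
    and \<alpha>: "length \<alpha> = length T" "\<And>x. x \<in> set \<alpha> \<Longrightarrow> 0 < x"
  shows "comparable_on (finitely_supported G) (dirichlet_form G \<mu>) (power_energy T \<alpha>)"
proof -
  obtain c C where c: "0 < c" "0 < C"
    "\<And>h. h \<in> carrier G \<Longrightarrow> c * power_law G T \<alpha> h \<le> pmf \<mu> h"
    "\<And>h. h \<in> carrier G \<Longrightarrow> pmf \<mu> h \<le> C * power_law G T \<alpha> h"
    using \<mu> by (auto simp: is_stable_like_def comparable_on_def)
  have "c / 2 * power_energy T \<alpha> f \<le> dirichlet_form G \<mu> f \<and>
      dirichlet_form G \<mu> f \<le> C / 2 * power_energy T \<alpha> f" if f: "f \<in> finitely_supported G" for f
  proof -
    let ?D = "translation_energy f"
    note hs = power_law_energy[OF f T \<alpha>]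
    have "c * power_energy T \<alpha> f \<le> (\<Sum>\<^sub>\<infinity>h\<in>carrier G. ?D h * pmf \<mu> h)"
    proof (rule has_sum_mono[OF has_sum_cmult_right[OF hs] has_sum_infsum[OF dirichlet_form_eq(1)[OF f]]])
      fix h assume "h \<in> carrier G"
      from mult_left_mono[OF c(3)[OF this] translation_energy_nonneg[of f h]]
      show "c * (?D h * power_law G T \<alpha> h) \<le> ?D h * pmf \<mu> h" by (simp add: mult_ac)
    qed
    moreover have "(\<Sum>\<^sub>\<infinity>h\<in>carrier G. ?D h * pmf \<mu> h) \<le> C * power_energy T \<alpha> f"
    proof (rule has_sum_mono[OF has_sum_infsum[OF dirichlet_form_eq(1)[OF f]] has_sum_cmult_right[OF hs]])
      fix h assume "h \<in> carrier G"
      from mult_left_mono[OF c(4)[OF this] translation_energy_nonneg[of f h]]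
      show "?D h * pmf \<mu> h \<le> C * (?D h * power_law G T \<alpha> h)" by (simp add: mult_ac)
    qed
    ultimately show ?thesis by (simp add: dirichlet_form_eq(2)[OF f])
  qed
  thus ?thesis using c(1,2) unfolding comparable_on_def
    by (intro exI[of _ "c / 2"] exI[of _ "C / 2"]) auto
qed

end

section \<open>Comparison of energies along powers of an element\<close>

text \<open>After interchanging the sums, \<open>D k\<close> is weighted by the sum over those \<open>a\<close> whose window contains \<open>k\<close>,
  that is \<open>1 + \<bar>a\<bar> \<ge> A\<close> with \<open>A\<close> of order \<open>\<bar>k\<bar> powr (w / v)\<close>. The summand is
  \<open>(1 + \<bar>a\<bar>) powr (- 1 - \<beta>)\<close> with \<open>\<beta> = (1 + v) / w\<close>, and the tail estimate gives \<open>A powr - \<beta>\<close>, which is of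
  order \<open>\<bar>k\<bar> powr (- 1 - 1 / v)\<close>.\<close>

lemma sum_powr_weighted_swap:
  fixes D :: "int \<Rightarrow> real"
  assumes v: "0 < v" and w: "0 < w" and M: "1 \<le> M"
  shows "\<exists>C>0. \<forall>D X. (\<forall>k. 0 \<le> D k) \<longrightarrow> finite X \<longrightarrow>
    (\<lambda>k. D k * (1 + \<bar>real_of_int k\<bar>) powr (- 1 - 1 / v)) summable_on UNIV \<longrightarrow>
    (\<Sum>a\<in>X. (1 + \<bar>real_of_int a\<bar>) powr (- 1 - 1 / w) *
        (4 / (M * (1 + \<bar>real_of_int a\<bar>) powr (v / w)) *
         (\<Sum>k | \<bar>real_of_int k\<bar> \<le> 2 * (M * (1 + \<bar>real_of_int a\<bar>) powr (v / w)). D k)))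
    \<le> C * (\<Sum>\<^sub>\<infinity>k. D k * (1 + \<bar>real_of_int k\<bar>) powr (- 1 - 1 / v))"
proof -
  define \<beta> where "\<beta> = (1 + v) / w"
  have \<beta>: "0 < \<beta>" using v w by (simp add: \<beta>_def)
  obtain C where C: "0 < C" "\<forall>A>0. \<forall>F :: int set. finite F \<longrightarrow>
    (\<Sum>a | a \<in> F \<and> A \<le> 1 + \<bar>real_of_int a\<bar>. (1 + \<bar>real_of_int a\<bar>) powr (- 1 - \<beta>)) \<le> C * A powr - \<beta>"
    using sum_powr_int_tail[OF \<beta>] by blast
  define C' where "C' = 4 / M * (C * (3 * M) powr (1 + 1 / v))"
  have C': "0 < C'" using C(1) M by (simp add: C'_def)
  show ?thesis
  proof (intro exI[of _ C'] conjI C' allI impI)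
    fix D :: "int \<Rightarrow> real" and X :: "int set"
    assume D: "\<forall>k. 0 \<le> D k" and X: "finite X"
      and summ: "(\<lambda>k. D k * (1 + \<bar>real_of_int k\<bar>) powr (- 1 - 1 / v)) summable_on UNIV"
    define N where "N a = 1 + \<bar>real_of_int a\<bar>" for a :: int
    have N: "1 \<le> N a" for a by (simp add: N_def)
    define K where "K a = {k::int. \<bar>real_of_int k\<bar> \<le> 2 * (M * N a powr (v / w))}" for a
    have finK: "finite (K a)" for a unfolding K_def by (rule finite_int_interval)
    define KK where "KK = (\<Union>a\<in>X. K a)"
    have KK: "finite KK" using X finK by (simp add: KK_def)
    have summand: "N a powr (- 1 - 1 / w) * (4 / (M * N a powr (v / w)) * (\<Sum>k\<in>K a. D k))
        = 4 / M * (\<Sum>k\<in>K a. D k * N a powr (- 1 - \<beta>))" for a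
    proof -
      have "- 1 - \<beta> = - 1 - 1 / w - v / w" by (simp add: \<beta>_def add_divide_distrib)
      hence "N a powr (- 1 - 1 / w) / N a powr (v / w) = N a powr (- 1 - \<beta>)" by (simp only: powr_diff)
      moreover have "p * (4 / (M * q) * s) = 4 / M * (s * (p / q))" for p q s :: real by (simp add: mult_ac)
      ultimately have "N a powr (- 1 - 1 / w) * (4 / (M * N a powr (v / w)) * (\<Sum>k\<in>K a. D k))
          = 4 / M * ((\<Sum>k\<in>K a. D k) * N a powr (- 1 - \<beta>))" by (simp only:)
      thus ?thesis by (simp only: sum_distrib_right)
    qed
    have tail: "(\<Sum>a | a \<in> X \<and> k \<in> K a. N a powr (- 1 - \<beta>))
        \<le> C * (3 * M) powr (1 + 1 / v) * N k powr (- 1 - 1 / v)" for k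
    proof -
      define A where "A = (N k / (3 * M)) powr (w / v)"
      have q: "0 < N k / (3 * M)" using N[of k] M by simp
      have A: "0 < A" using q N[of k] M by (simp add: A_def)
      have "A \<le> N a" if "k \<in> K a" for a
      proof -
        have "1 * 1 \<le> M * N a powr (v / w)"
          using M N[of a] v w by (intro mult_mono ge_one_powr_ge_zero) auto
        hence "N k \<le> 3 * M * N a powr (v / w)" using that by (simp add: K_def N_def)
        hence "N k / (3 * M) \<le> N a powr (v / w)" using M by (simp add: divide_le_eq mult.commute)
        hence "A \<le> (N a powr (v / w)) powr (w / v)"
          unfolding A_def using q v w by (intro powr_mono2) auto
        also have "\<dots> = N a" using N[of a] v w by (simp add: powr_powr)
        finally show ?thesis .
      qed
      hence "{a \<in> X. k \<in> K a} \<subseteq> {a \<in> X. A \<le> 1 + \<bar>real_of_int a\<bar>}" by (auto simp: N_def)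
      hence "(\<Sum>a | a \<in> X \<and> k \<in> K a. N a powr (- 1 - \<beta>))
          \<le> (\<Sum>a | a \<in> X \<and> A \<le> 1 + \<bar>real_of_int a\<bar>. N a powr (- 1 - \<beta>))"
        using X by (intro sum_mono2) auto
      also have "\<dots> \<le> C * A powr - \<beta>" using C(2) A X by (simp add: N_def)
      also have "A powr - \<beta> = (3 * M) powr (1 + 1 / v) * N k powr (- 1 - 1 / v)"
      proof -
        have "w / v * - \<beta> = - (1 + 1 / v)" using v w by (simp add: \<beta>_def field_simps)
        hence "A powr - \<beta> = (N k / (3 * M)) powr (- (1 + 1 / v))" by (simp add: A_def powr_powr)
        also have "\<dots> = N k powr (- (1 + 1 / v)) / (3 * M) powr (- (1 + 1 / v))"
          by (rule powr_divide)
        also have "\<dots> = (3 * M) powr (1 + 1 / v) * N k powr (- (1 + 1 / v))"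
          unfolding powr_minus_divide[of "3 * M"] by (simp add: mult.commute)
        finally show ?thesis by simp
      qed
      finally show ?thesis by (simp add: mult.assoc)
    qed
    have outer: "(\<Sum>a\<in>X. N a powr (- 1 - 1 / w) * (4 / (M * N a powr (v / w)) * (\<Sum>k\<in>K a. D k)))
        = 4 / M * (\<Sum>a\<in>X. \<Sum>k\<in>K a. D k * N a powr (- 1 - \<beta>))"
      unfolding summand by (simp only: sum_distrib_left)
    have "(\<Sum>a\<in>X. \<Sum>k\<in>K a. D k * N a powr (- 1 - \<beta>))
        = (\<Sum>a\<in>X. \<Sum>k | k \<in> KK \<and> k \<in> K a. D k * N a powr (- 1 - \<beta>))"
      by (intro sum.cong refl) (auto simp: KK_def)
    also have "\<dots> = (\<Sum>k\<in>KK. \<Sum>a | a \<in> X \<and> k \<in> K a. D k * N a powr (- 1 - \<beta>))"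
      by (rule sum.swap_restrict[OF X KK])
    also have "\<dots> \<le> (\<Sum>k\<in>KK. D k * (C * (3 * M) powr (1 + 1 / v) * N k powr (- 1 - 1 / v)))"
      unfolding sum_distrib_left[symmetric] using D tail by (intro sum_mono mult_left_mono) auto
    also have "\<dots> = C * (3 * M) powr (1 + 1 / v) * (\<Sum>k\<in>KK. D k * N k powr (- 1 - 1 / v))"
      by (simp only: sum_distrib_left mult.left_commute mult.assoc)
    also have "\<dots> \<le> C * (3 * M) powr (1 + 1 / v) * (\<Sum>\<^sub>\<infinity>k. D k * N k powr (- 1 - 1 / v))"
      using C(1) D summ KK by (intro mult_left_mono finite_sum_le_infsum) (auto simp: N_def)
    finally have "(\<Sum>a\<in>X. \<Sum>k\<in>K a. D k * N a powr (- 1 - \<beta>))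
        \<le> C * (3 * M) powr (1 + 1 / v) * (\<Sum>\<^sub>\<infinity>k. D k * N k powr (- 1 - 1 / v))" .
    hence "(\<Sum>a\<in>X. N a powr (- 1 - 1 / w) * (4 / (M * N a powr (v / w)) * (\<Sum>k\<in>K a. D k)))
        \<le> 4 / M * (C * (3 * M) powr (1 + 1 / v) * (\<Sum>\<^sub>\<infinity>k. D k * N k powr (- 1 - 1 / v)))"
      unfolding outer using M by (intro mult_left_mono) auto
    thus "(\<Sum>a\<in>X. (1 + \<bar>real_of_int a\<bar>) powr (- 1 - 1 / w) *
        (4 / (M * (1 + \<bar>real_of_int a\<bar>) powr (v / w)) *
         (\<Sum>k | \<bar>real_of_int k\<bar> \<le> 2 * (M * (1 + \<bar>real_of_int a\<bar>) powr (v / w)). D k)))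
      \<le> C' * (\<Sum>\<^sub>\<infinity>k. D k * (1 + \<bar>real_of_int k\<bar>) powr (- 1 - 1 / v))"
      unfolding N_def K_def C'_def by (simp only: mult.assoc)
  qed
qed

context group
begin

text \<open>Energies of products are bounded by energies of the factors, so the energy of \<open>g [^] a\<close> is bounded by
  averages of energies of powers of the \<open>S ! i\<close> over windows of the size that the preceding weighted sum
  can absorb.\<close>

lemma power_energy_domination:
  assumes S: "set S \<subseteq> carrier G" and v: "length v = length S" "\<And>x. x \<in> set v \<Longrightarrow> 0 < x"
    and w: "0 < w" and g: "g \<in> carrier G" and M: "1 \<le> M"
    and pow: "\<And>a::int. g [^] a \<in> short_products
      {S ! i [^] b | i b. i < length S \<and> \<bar>real_of_int b\<bar> \<le> M * (1 + \<bar>real_of_int a\<bar>) powr (v ! i / w)} M"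
  shows "\<exists>C>0. \<forall>f\<in>finitely_supported G.
    (\<Sum>\<^sub>\<infinity>a\<in>(UNIV::int set). translation_energy f (g [^] a) * (1 + \<bar>real_of_int a\<bar>) powr (- 1 - 1 / w))
      \<le> C * power_energy S (map (\<lambda>x. 1 / x) v) f"
proof -
  have vi: "0 < v ! i" if "i < length S" for i using v that by simp
  have Si: "S ! i \<in> carrier G" if "i < length S" for i using S that nth_mem by blast
  let ?N = "\<lambda>a::int. 1 + \<bar>real_of_int a\<bar>"
  let ?r = "\<lambda>i a. M * ?N a powr (v ! i / w)"
  have "\<forall>i\<in>{..<length S}. \<exists>C>0. \<forall>D X. (\<forall>k. 0 \<le> D k) \<longrightarrow> finite X \<longrightarrow>
    (\<lambda>k. D k * ?N k powr (- 1 - 1 / v ! i)) summable_on UNIV \<longrightarrow>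
    (\<Sum>a\<in>X. ?N a powr (- 1 - 1 / w) * (4 / ?r i a * (\<Sum>k | \<bar>real_of_int k\<bar> \<le> 2 * ?r i a. D k)))
    \<le> C * (\<Sum>\<^sub>\<infinity>k. D k * ?N k powr (- 1 - 1 / v ! i))"
    using sum_powr_weighted_swap[OF vi w M] by simp
  from bchoice[OF this] obtain C where CC: "\<forall>i\<in>{..<length S}. 0 < C i \<and> (\<forall>D X. (\<forall>k. 0 \<le> D k) \<longrightarrow>
    finite X \<longrightarrow> (\<lambda>k. D k * ?N k powr (- 1 - 1 / v ! i)) summable_on UNIV \<longrightarrow>
    (\<Sum>a\<in>X. ?N a powr (- 1 - 1 / w) * (4 / ?r i a * (\<Sum>k | \<bar>real_of_int k\<bar> \<le> 2 * ?r i a. D k)))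
    \<le> C i * (\<Sum>\<^sub>\<infinity>k. D k * ?N k powr (- 1 - 1 / v ! i)))"
    by (elim exE)
  have C: "0 < C i" if "i < length S" for i using conjunct1[OF bspec[OF CC, of i]] that by simp
  have C': "(\<Sum>a\<in>X. ?N a powr (- 1 - 1 / w) * (4 / ?r i a * (\<Sum>k | \<bar>real_of_int k\<bar> \<le> 2 * ?r i a. D k)))
      \<le> C i * (\<Sum>\<^sub>\<infinity>k. D k * ?N k powr (- 1 - 1 / v ! i))"
    if "i < length S" "\<And>k. 0 \<le> D k" "finite X" "(\<lambda>k. D k * ?N k powr (- 1 - 1 / v ! i)) summable_on UNIV"
    for i D X
    by (rule conjunct2[OF bspec[OF CC], rule_format]) (use that in auto)
  define C0 where "C0 = 1 + (\<Sum>i<length S. C i)"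
  have C0: "0 < C0" "C i \<le> C0" if "i < length S" for i
    using member_le_sum[of i "{..<length S}" C] that less_imp_le[OF C]
      sum_nonneg[of "{..<length S}" C] by (auto simp: C0_def add_pos_nonneg)
  have C00: "0 < C0" using sum_nonneg[of "{..<length S}" C] less_imp_le[OF C] by (auto simp: C0_def add_pos_nonneg)
  define L where "L = nat \<lceil>M\<rceil>"
  show ?thesis
  proof (intro exI[of _ "4 ^ L * C0"] conjI ballI)
    show "0 < 4 ^ L * C0" using C00 by simp
    fix f assume f: "f \<in> finitely_supported G"
    let ?D = "\<lambda>t (k::int). translation_energy f (t [^] k)"
    \<comment> \<open>\<open>B i a\<close> bounds the energy of every power of \<open>S ! i\<close> that may occur in the word for \<open>g [^] a\<close>\<close>
    define B where "B i a = 4 / ?r i a * (\<Sum>k | \<bar>real_of_int k\<bar> \<le> 2 * ?r i a. ?D (S ! i) k)" for i a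
    have r: "0 < ?r i a" for i a using M by simp
    have B0: "0 \<le> B i a" for i a
      unfolding B_def using r[of a i] by (intro mult_nonneg_nonneg sum_nonneg translation_energy_nonneg) auto
    have g_le: "?D g a \<le> 4 ^ L * (\<Sum>i<length S. B i a)" for a
    proof -
      obtain gs where gs: "g [^] a = foldr (\<otimes>) gs \<one>" "real (length gs) \<le> M"
        "set gs \<subseteq> {S ! i [^] b | i b. i < length S \<and> \<bar>real_of_int b\<bar> \<le> ?r i a}"
        using pow[of a] by (auto simp: short_products_def)
      have le: "translation_energy f h \<le> (\<Sum>i<length S. B i a)" if h: "h \<in> set gs" for h
      proof -
        obtain i b where i: "h = S ! i [^] b" "i < length S" "\<bar>real_of_int b\<bar> \<le> ?r i a"
          using gs(3) h by blast
        have "translation_energy f h \<le> B i a"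
          unfolding i(1) B_def by (rule translation_energy_power[OF f Si[OF i(2)] r i(3)])
        also have "\<dots> \<le> (\<Sum>i<length S. B i a)" using i(2) B0 by (intro member_le_sum) auto
        finally show ?thesis .
      qed
      have gsc: "set gs \<subseteq> carrier G" using gs(3) Si by auto
      have "?D g a \<le> 4 ^ length gs * (\<Sum>i<length S. B i a)"
        unfolding gs(1) by (rule translation_energy_list[OF f sum_nonneg[OF B0] gsc le])
      also have "length gs \<le> L" using gs(2) unfolding L_def by linarith
      hence "4 ^ length gs * (\<Sum>i<length S. B i a) \<le> 4 ^ L * (\<Sum>i<length S. B i a)"
        by (intro mult_right_mono sum_nonneg B0 power_increasing) auto
      finally show ?thesis .
    qed
    have summ: "(\<lambda>k. ?D (S ! i) k * ?N k powr (- 1 - 1 / v ! i)) summable_on UNIV" if "i < length S" for i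
      by (rule power_energy_summable[OF f Si[OF that]]) (use vi[OF that] in simp)
    show "(\<Sum>\<^sub>\<infinity>a. ?D g a * ?N a powr (- 1 - 1 / w)) \<le> 4 ^ L * C0 * power_energy S (map (\<lambda>x. 1 / x) v) f"
    proof (rule infsum_le_finite_sums)
      show "(\<lambda>a. ?D g a * ?N a powr (- 1 - 1 / w)) summable_on UNIV"
        by (rule power_energy_summable[OF f g]) (use w in simp)
      fix X :: "int set" assume X: "finite X"
      have "(\<Sum>a\<in>X. ?D g a * ?N a powr (- 1 - 1 / w))
          \<le> (\<Sum>a\<in>X. 4 ^ L * (\<Sum>i<length S. B i a) * ?N a powr (- 1 - 1 / w))"
        by (intro sum_mono mult_right_mono g_le) auto
      also have "\<dots> = 4 ^ L * (\<Sum>a\<in>X. \<Sum>i<length S. ?N a powr (- 1 - 1 / w) * B i a)"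
        by (simp add: sum_distrib_left sum_distrib_right mult_ac)
      also have "\<dots> = 4 ^ L * (\<Sum>i<length S. \<Sum>a\<in>X. ?N a powr (- 1 - 1 / w) * B i a)"
        by (subst sum.swap) simp
      also have "(\<Sum>i<length S. \<Sum>a\<in>X. ?N a powr (- 1 - 1 / w) * B i a)
          \<le> (\<Sum>i<length S. C0 * (\<Sum>\<^sub>\<infinity>k. ?D (S ! i) k * ?N k powr (- 1 - 1 / v ! i)))"
      proof (rule sum_mono)
        fix i assume "i \<in> {..<length S}"
        hence i: "i < length S" by simp
        have "(\<Sum>a\<in>X. ?N a powr (- 1 - 1 / w) * B i a)
            \<le> C i * (\<Sum>\<^sub>\<infinity>k. ?D (S ! i) k * ?N k powr (- 1 - 1 / v ! i))"
          unfolding B_def by (rule C'[OF i _ X summ[OF i]]) (simp add: translation_energy_nonneg)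
        also have "\<dots> \<le> C0 * (\<Sum>\<^sub>\<infinity>k. ?D (S ! i) k * ?N k powr (- 1 - 1 / v ! i))"
          by (intro mult_right_mono C0 i infsum_nonneg mult_nonneg_nonneg translation_energy_nonneg) auto
        finally show "(\<Sum>a\<in>X. ?N a powr (- 1 - 1 / w) * B i a)
            \<le> C0 * (\<Sum>\<^sub>\<infinity>k. ?D (S ! i) k * ?N k powr (- 1 - 1 / v ! i))" .
      qed
      also have "(\<Sum>i<length S. C0 * (\<Sum>\<^sub>\<infinity>k. ?D (S ! i) k * ?N k powr (- 1 - 1 / v ! i)))
          = C0 * power_energy S (map (\<lambda>x. 1 / x) v) f"
        using v(1) by (simp add: power_energy_def sum_distrib_left)
      finally show "(\<Sum>a\<in>X. ?D g a * ?N a powr (- 1 - 1 / w))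
          \<le> 4 ^ L * C0 * power_energy S (map (\<lambda>x. 1 / x) v) f"
        by (simp add: mult.assoc)
    qed
  qed
qed

lemma power_energy_comparison:
  assumes S: "set S \<subseteq> carrier G" "generate G (set S) = carrier G" "nilpotent_group G"
    and v: "length v = length S" "\<And>x. x \<in> set v \<Longrightarrow> 0 < x"
    and T: "set T \<subseteq> carrier G" and w: "length w = length T" "\<And>x. x \<in> set w \<Longrightarrow> 0 < x"
    and iso: "\<And>j. j < length T \<Longrightarrow> T ! j \<in> isolator G (weight_subgroup G S v (w ! j))"
  shows "\<exists>C>0. \<forall>f\<in>finitely_supported G.
    power_energy T (map (\<lambda>x. 1 / x) w) f \<le> C * power_energy S (map (\<lambda>x. 1 / x) v) f"
proof -
  obtain n where n: "lower_central_series G n = {\<one>}" using S(3) by (auto simp: nilpotent_group_def)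
  interpret nilpotent_words G S "2 ^ n"
    by unfold_locales (use S(1) fc_eval_long[OF S(1) n] in auto)
  let ?E = "\<lambda>f j. \<Sum>\<^sub>\<infinity>a\<in>(UNIV::int set).
    translation_energy f (T ! j [^] a) * (1 + \<bar>real_of_int a\<bar>) powr (- 1 - 1 / w ! j)"
  have "\<forall>j\<in>{..<length T}. \<exists>C>0. \<forall>f\<in>finitely_supported G. ?E f j \<le> C * power_energy S (map (\<lambda>x. 1 / x) v) f"
  proof
    fix j assume "j \<in> {..<length T}"
    hence j: "j < length T" by simp
    have wj: "0 < w ! j" using w j by simp
    have "\<exists>M\<ge>1. \<forall>a::int. T ! j [^] a \<in> short_products
        {S ! i [^] b | i b. i < length S \<and> \<bar>real_of_int b\<bar> \<le> M * (1 + \<bar>real_of_int a\<bar>) powr (v ! i / w ! j)} M"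
      by (rule isolator_powers[OF S(2) v(1) _ wj iso[OF j]]) (rule v(2))
    then obtain M where M: "1 \<le> M" "\<forall>a::int. T ! j [^] a \<in> short_products
        {S ! i [^] b | i b. i < length S \<and> \<bar>real_of_int b\<bar> \<le> M * (1 + \<bar>real_of_int a\<bar>) powr (v ! i / w ! j)} M"
      by (elim exE conjE)
    show "\<exists>C>0. \<forall>f\<in>finitely_supported G. ?E f j \<le> C * power_energy S (map (\<lambda>x. 1 / x) v) f"
      by (rule power_energy_domination[OF S(1) v(1) _ wj _ M(1) M(2)[rule_format]])
        (use v(2) T j nth_mem in auto)
  qed
  from bchoice[OF this] obtain C where C: "\<And>j. j < length T \<Longrightarrow> 0 < C j"
    "\<And>j f. \<lbrakk>j < length T; f \<in> finitely_supported G\<rbrakk> \<Longrightarrow> ?E f j \<le> C j * power_energy S (map (\<lambda>x. 1 / x) v) f"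
    by auto
  show ?thesis
  proof (intro exI[of _ "1 + (\<Sum>j<length T. C j)"] conjI ballI)
    show "0 < 1 + (\<Sum>j<length T. C j)"
      using C(1) by (intro add_pos_nonneg sum_nonneg) (auto simp: less_imp_le)
    fix f assume f: "f \<in> finitely_supported G"
    have P: "0 \<le> power_energy S (map (\<lambda>x. 1 / x) v) f"
      unfolding power_energy_def
      by (intro sum_nonneg infsum_nonneg mult_nonneg_nonneg translation_energy_nonneg) auto
    have "power_energy T (map (\<lambda>x. 1 / x) w) f = (\<Sum>j<length T. ?E f j)"
      using w(1) by (simp add: power_energy_def)
    also have "\<dots> \<le> (\<Sum>j<length T. C j * power_energy S (map (\<lambda>x. 1 / x) v) f)"
      using C(2) f by (intro sum_mono) auto
    also have "\<dots> \<le> (1 + (\<Sum>j<length T. C j)) * power_energy S (map (\<lambda>x. 1 / x) v) f"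
      using P by (simp add: sum_distrib_right distrib_right)
    finally show "power_energy T (map (\<lambda>x. 1 / x) w) f
        \<le> (1 + (\<Sum>j<length T. C j)) * power_energy S (map (\<lambda>x. 1 / x) v) f" .
  qed
qed

end

section \<open>Weights of formal commutators\<close>

lemma fc_weight_bounds:
  assumes v: "length v = length S" and c: "c \<in> formal_commutators S"
    and lu: "\<And>x. x \<in> set v \<Longrightarrow> l \<le> x \<and> x \<le> (b::real)"
  shows "l * real (fc_length c) \<le> fc_weight v c \<and> fc_weight v c \<le> b * real (fc_length c)"
  using c
proof (induction c)
  case (Letter k)
  hence "v ! fst k \<in> set v" using v by (cases k) (auto simp: formal_commutators_def)
  thus ?case using lu by simp
next
  case (Bracket c d)
  thus ?case by (simp add: algebra_simps)
qed

lemma weight_subgroup_antimono: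
  "w \<le> w' \<Longrightarrow> weight_subgroup G S v w' \<subseteq> weight_subgroup G S v w" if "group G"
  using group.mono_generate[OF that] unfolding weight_subgroup_def
  by (smt (verit, best) Collect_mono image_mono order_trans)

text \<open>Positive weights of a nonempty tuple form a locally finite, unbounded set of commutator weights, so
  that \<open>weight_enum\<close> really enumerates it.\<close>

locale positive_weights =
  fixes S :: "'a list" and v :: "real list"
  assumes length_eq: "length v = length S" and pos: "\<And>x. x \<in> set v \<Longrightarrow> 0 < x" and nonempty: "S \<noteq> []"
begin

definition lo :: real where "lo = Min (set v)"
definition hi :: real where "hi = Max (set v)"

lemma v_nonempty: "v \<noteq> []"
  using length_eq nonempty by auto

lemma lo_pos: "0 < lo"
  unfolding lo_def using v_nonempty pos by simp

lemma weight_bounds: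
  "c \<in> formal_commutators S \<Longrightarrow> lo * real (fc_length c) \<le> fc_weight v c"
  "c \<in> formal_commutators S \<Longrightarrow> fc_weight v c \<le> hi * real (fc_length c)"
  using fc_weight_bounds[OF length_eq, of c lo hi] by (auto simp: lo_def hi_def)

lemma finite_weights_le: "finite {x \<in> weight_values S v. x \<le> B}"
proof (rule finite_subset)
  show "{x \<in> weight_values S v. x \<le> B}
      \<subseteq> fc_weight v ` {c \<in> formal_commutators S. fc_length c \<le> nat \<lceil>B / lo\<rceil>}"
  proof
    fix x assume "x \<in> {x \<in> weight_values S v. x \<le> B}"
    then obtain c where c: "x = fc_weight v c" "c \<in> formal_commutators S" "x \<le> B"
      by (auto simp: weight_values_def)
    have "lo * real (fc_length c) \<le> B" using weight_bounds(1)[OF c(2)] c by simp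
    hence "real (fc_length c) \<le> B / lo" using lo_pos by (simp add: pos_le_divide_eq mult.commute)
    hence "fc_length c \<le> nat \<lceil>B / lo\<rceil>" by linarith
    thus "x \<in> fc_weight v ` {c \<in> formal_commutators S. fc_length c \<le> nat \<lceil>B / lo\<rceil>}" using c by blast
  qed
qed (simp add: finite_formal_commutators_length)

lemma weights_unbounded: "\<exists>x\<in>weight_values S v. B < x"
proof -
  have "\<exists>c\<in>formal_commutators S. n \<le> fc_length c" for n
  proof (induction n)
    case 0
    show ?case using nonempty by (intro bexI[of _ "Letter (0, True)"]) (auto simp: formal_commutators_def)
  next
    case (Suc n)
    then obtain c where c: "c \<in> formal_commutators S" "n \<le> fc_length c" by blast
    thus ?case using fc_length_pos[of c] by (intro bexI[of _ "Bracket c c"]) auto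
  qed
  then obtain c where c: "c \<in> formal_commutators S" "nat \<lceil>B / lo\<rceil> + 1 \<le> fc_length c" by blast
  hence "B / lo < real (fc_length c)" by linarith
  hence "B < lo * real (fc_length c)" using lo_pos by (simp add: pos_divide_less_eq mult.commute)
  also have "\<dots> \<le> fc_weight v c" by (rule weight_bounds(1)[OF c(1)])
  finally show ?thesis using c(1) by (auto simp: weight_values_def)
qed

text \<open>A least value above the previous one exists because only finitely many weights lie below a given
  one.\<close>

lemma weight_enum_Suc:
  "weight_enum S v (Suc j) \<in> weight_values S v" "weight_enum S v j < weight_enum S v (Suc j)"
  "\<lbrakk>x \<in> weight_values S v; weight_enum S v j < x\<rbrakk> \<Longrightarrow> weight_enum S v (Suc j) \<le> x"
proof -
  let ?w = "weight_enum S v j"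
  obtain x0 where x0: "x0 \<in> weight_values S v" "?w < x0" using weights_unbounded by blast
  define F where "F = {x \<in> weight_values S v. x \<le> x0} \<inter> {x. ?w < x}"
  have F: "finite F" "x0 \<in> F" using finite_weights_le x0 by (auto simp: F_def)
  have min: "Min F \<le> y" if "y \<in> weight_values S v" "?w < y" for y
  proof (cases "y \<le> x0")
    case True thus ?thesis using that F by (intro Min_le) (auto simp: F_def)
  next
    case False thus ?thesis using Min_le[OF F] by simp
  qed
  have "Min F \<in> F" using F by (intro Min_in) auto
  hence "(LEAST x. x \<in> weight_values S v \<and> ?w < x) = Min F"
    using min by (intro Least_equality) (auto simp: F_def)
  hence eq: "weight_enum S v (Suc j) = Min F" by simp
  show "weight_enum S v (Suc j) \<in> weight_values S v" "?w < weight_enum S v (Suc j)"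
    "\<lbrakk>x \<in> weight_values S v; ?w < x\<rbrakk> \<Longrightarrow> weight_enum S v (Suc j) \<le> x"
    unfolding eq using \<open>Min F \<in> F\<close> min by (auto simp: F_def)
qed

lemma weight_enum_strict_mono: "strict_mono (weight_enum S v)"
  using weight_enum_Suc(2) by (rule strict_mono_Suc_iff[THEN iffD2, OF allI])

lemma weight_enum_surj:
  assumes x: "x \<in> weight_values S v"
  obtains p where "1 \<le> p" "weight_enum S v p = x"
proof -
  have "0 < x"
  proof -
    obtain c where c: "x = fc_weight v c" "c \<in> formal_commutators S" using x by (auto simp: weight_values_def)
    have "0 < lo * real (fc_length c)" using lo_pos fc_length_pos[of c] by simp
    thus ?thesis using weight_bounds(1)[OF c(2)] c(1) by simp
  qed
  have "\<exists>p. weight_enum S v p = x"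
  proof (rule ccontr)
    assume no: "\<nexists>p. weight_enum S v p = x"
    have lt: "weight_enum S v j < x" for j
    proof (induction j)
      case 0 show ?case using \<open>0 < x\<close> by simp
    next
      case (Suc j)
      have "weight_enum S v (Suc j) \<noteq> x" using no by blast
      thus ?case using weight_enum_Suc(3)[OF x Suc] by linarith
    qed
    have "range (\<lambda>j. weight_enum S v (Suc j)) \<subseteq> {y \<in> weight_values S v. y \<le> x}"
      using lt weight_enum_Suc(1) less_imp_le by blast
    hence "finite (range (\<lambda>j. weight_enum S v (Suc j)))" using finite_weights_le finite_subset by blast
    moreover have "inj (\<lambda>j. weight_enum S v (Suc j))"
      using strict_mono_eq[OF weight_enum_strict_mono] by (auto simp: inj_def simp del: weight_enum.simps)
    ultimately show False using finite_imageD infinite_UNIV_nat by blast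
  qed
  then obtain p where p: "weight_enum S v p = x" by blast
  moreover have "1 \<le> p" using p \<open>0 < x\<close> by (cases p) auto
  ultimately show thesis using that by blast
qed

lemma eventually_trivial:
  assumes G: "group G" "set S \<subseteq> carrier G" and n: "lower_central_series G n = {\<one>\<^bsub>G\<^esub>}"
  shows "weight_subgroup G S v (weight_enum S v (last_index G S v + 1)) = {\<one>\<^bsub>G\<^esub>}"
proof -
  interpret group G by fact
  obtain x where x: "x \<in> weight_values S v" "hi * 2 ^ n < x" using weights_unbounded by blast
  obtain p where p: "1 \<le> p" "weight_enum S v p = x" using weight_enum_surj[OF x(1)] by blast
  have hi: "0 < hi" unfolding hi_def using v_nonempty pos by (simp add: Max_gr_iff) (meson last_in_set)
  have "fc_eval G S c = \<one>\<^bsub>G\<^esub>" if c: "c \<in> formal_commutators S" "x \<le> fc_weight v c" for c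
  proof (rule fc_eval_long[OF G(2) n c(1)])
    have "hi * 2 ^ n < hi * real (fc_length c)" using weight_bounds(2)[OF c(1)] c(2) x(2) by linarith
    hence "real (2 ^ n) < real (fc_length c)" using hi by simp
    thus "2 ^ n < fc_length c" by (simp only: of_nat_less_iff)
  qed
  hence "weight_subgroup G S v x \<subseteq> {\<one>\<^bsub>G\<^esub>}"
    unfolding weight_subgroup_def by (intro generate_subgroup_incl triv_subgroup) auto
  moreover have "\<one>\<^bsub>G\<^esub> \<in> weight_subgroup G S v x" unfolding weight_subgroup_def by (rule generate.one)
  ultimately have "weight_subgroup G S v (weight_enum S v ((p - 1) + 1)) = {\<one>\<^bsub>G\<^esub>}" using p by auto
  thus ?thesis unfolding last_index_def by (rule LeastI)
qed

end

section \<open>The reduced series\<close>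

lemma reduced_series_memD:
  assumes "(x, J) \<in> set (reduced_series G S v)"
  shows "J = isolator G (weight_subgroup G S v x)"
  using assms by (auto simp: reduced_series_def Let_def)

lemma isolator_one: "isolator G {\<one>\<^bsub>G\<^esub>} = torsion G"
  by (auto simp: isolator_def torsion_def)

text \<open>Every letter lies in the isolator attached to its own weight. If that term is dropped from the series,
  it either equals the torsion or reappears at the last index with the same isolator, where the weight is
  larger; beyond the last index the letter is trivial.\<close>

lemma reduced_series_covers:
  assumes G: "group G" "set S \<subseteq> carrier G" and n: "lower_central_series G n = {\<one>\<^bsub>G\<^esub>}"
    and v: "length v = length S" "\<And>x. x \<in> set v \<Longrightarrow> 0 < x" and i: "i < length S"
  shows "S ! i \<in> torsion G \<or> (\<exists>x J. (x, J) \<in> set (reduced_series G S v) \<and> v ! i \<le> x \<and> S ! i \<in> J)"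
proof -
  interpret positive_weights S v using v i by unfold_locales auto
  interpret group G by fact
  have Si: "S ! i \<in> carrier G" using G(2) i nth_mem by blast
  let ?w = "weight_enum S v" and ?k = "last_index G S v"
  let ?J = "\<lambda>j. isolator G (weight_subgroup G S v (?w j))"
  have letter: "Letter (i, True) \<in> formal_commutators S" using i by (simp add: formal_commutators_def)
  have "fc_weight v (Letter (i, True)) \<in> weight_values S v"
    unfolding weight_values_def using letter by (rule imageI)
  then obtain p where p: "1 \<le> p" "?w p = v ! i" using weight_enum_surj by auto
  have "fc_eval G S (Letter (i, True)) \<in> weight_subgroup G S v (?w p)"
    unfolding weight_subgroup_def using letter p(2) by (intro generate.incl imageI) simp
  hence mem: "S ! i \<in> weight_subgroup G S v (?w p)" by simp
  hence SJ: "S ! i \<in> ?J p" using Si by (auto simp: isolator_def intro!: exI[of _ 1])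
  show ?thesis
  proof (cases "p \<le> ?k")
    case False
    hence "?k + 1 \<le> p" by simp
    hence "?w (?k + 1) \<le> ?w p" by (rule strict_mono_less_eq[OF weight_enum_strict_mono, THEN iffD2])
    from weight_subgroup_antimono[OF G(1) this] have "S ! i \<in> {\<one>\<^bsub>G\<^esub>}"
      using eventually_trivial[OF G n] mem by blast
    thus ?thesis using Si by (auto simp: torsion_def)
  next
    case True
    \<comment> \<open>the last index with the same isolator survives the reduction\<close>
    define X where "X = {j \<in> {..?k}. ?J j = ?J p}"
    define q where "q = Max X"
    have X: "finite X" "p \<in> X" using True by (auto simp: X_def)
    have q: "q \<in> X" "p \<le> q" unfolding q_def using X by (auto intro: Max_in Max_ge)
    have Jq: "?J q = ?J p" "q \<le> ?k" using q(1) by (auto simp: X_def)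
    have last: "?J j \<noteq> ?J q" if "j \<in> {q<..?k}" for j
    proof
      assume "?J j = ?J q"
      hence "j \<in> X" using that Jq by (auto simp: X_def)
      hence "j \<le> q" unfolding q_def using X by (intro Max_ge)
      thus False using that by simp
    qed
    show ?thesis
    proof (cases "?J q = isolator G {\<one>\<^bsub>G\<^esub>}")
      case True
      thus ?thesis using SJ Jq by (simp add: isolator_one)
    next
      case False
      have "(?w q, ?J q) \<in> set (reduced_series G S v)"
        unfolding reduced_series_def Let_def set_map set_filter
      proof (rule image_eqI[of _ _ q])
        show "q \<in> {x \<in> set [1..<?k + 1]. (\<forall>j'\<in>{x<..?k}. ?J j' \<noteq> ?J x) \<and> isolator G {\<one>\<^bsub>G\<^esub>} \<noteq> ?J x}"
          using last False q p Jq by auto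
      qed simp
      moreover have "v ! i \<le> ?w q" using strict_mono_less_eq[OF weight_enum_strict_mono] q p by metis
      ultimately show ?thesis using SJ Jq by blast
    qed
  qed
qed

section \<open>Generation of the layers by formal commutators\<close>

context group
begin

text \<open>The quotient by \<open>J\<close> is abelian, so \<open>K\<close> is normal in it and the composite of the two projections is a
  homomorphism; the image of \<open>h\<close> is therefore the image of some \<open>x\<close> generated by \<open>X\<close>.\<close>

lemma double_quotient_generation:
  assumes J: "J \<lhd> G" and ab: "\<And>x y. \<lbrakk>x \<in> carrier G; y \<in> carrier G\<rbrakk> \<Longrightarrow> commutator G x y \<in> J"
    and C: "subgroup C G" and X: "X \<subseteq> carrier G"
    and K_def: "K = (\<lambda>x. J #> x) ` (C <#> J)"
    and gen: "generate ((G Mod J) Mod K) ((\<lambda>x. K #>\<^bsub>G Mod J\<^esub> (J #> x)) ` X) = carrier ((G Mod J) Mod K)"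
    and h: "h \<in> carrier G"
  shows "\<exists>j\<in>J. \<exists>c\<in>C. \<exists>x\<in>generate G X. h = j \<otimes> (c \<otimes> x)"
proof -
  interpret J: normal J G by fact
  let ?Q = "G Mod J" and ?\<pi> = "\<lambda>x. J #> x"
  interpret Q: group ?Q by (rule J.factorgroup_is_group)
  have \<pi>: "?\<pi> \<in> hom G ?Q" by (rule J.r_coset_hom_Mod)
  interpret \<pi>: group_hom G ?Q ?\<pi> by unfold_locales (rule \<pi>)
  have QE: "\<exists>a\<in>carrier G. q = ?\<pi> a" if "q \<in> carrier ?Q" for q
    using that by (auto simp: FactGroup_def RCOSETS_def)
  \<comment> \<open>the quotient by \<open>J\<close> is abelian\<close>
  have swap: "?\<pi> (a \<otimes> b) = ?\<pi> (b \<otimes> a)" if "a \<in> carrier G" "b \<in> carrier G" for a b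
  proof -
    have "a \<otimes> b = commutator G a b \<otimes> (b \<otimes> a)" using that by (simp add: word_simps)
    moreover have "?\<pi> (commutator G a b \<otimes> (b \<otimes> a)) = (J #> commutator G a b) #> (b \<otimes> a)"
      using that J.subset by (simp add: coset_mult_assoc)
    ultimately show ?thesis using coset_join2[OF _ J.is_subgroup ab] that by simp
  qed
  have comm: "comm_group ?Q"
  proof (rule Q.group_comm_groupI)
    fix x y assume x: "x \<in> carrier ?Q" and y: "y \<in> carrier ?Q"
    from QE[OF x] obtain a where a: "a \<in> carrier G" "x = ?\<pi> a" by (elim bexE)
    from QE[OF y] obtain b where b: "b \<in> carrier G" "y = ?\<pi> b" by (elim bexE)
    show "x \<otimes>\<^bsub>?Q\<^esub> y = y \<otimes>\<^bsub>?Q\<^esub> x"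
      unfolding a(2) b(2) using swap[OF a(1) b(1)] \<pi>.hom_mult a(1) b(1) by simp
  qed
  have K: "K = ?\<pi> ` C"
  proof -
    have eq: "?\<pi> (c \<otimes> j) = ?\<pi> c" if "c \<in> C" "j \<in> J" for c j
    proof -
      have cc: "c \<in> carrier G" "j \<in> carrier G" using that subgroup.subset[OF C] J.subset by auto
      have "?\<pi> (c \<otimes> j) = ?\<pi> (j \<otimes> c)" using swap cc by blast
      also have "\<dots> = (J #> j) #> c" using cc J.subset by (simp add: coset_mult_assoc)
      finally show ?thesis using coset_join2[OF cc(2) J.is_subgroup that(2)] by simp
    qed
    show ?thesis
    proof
      show "K \<subseteq> ?\<pi> ` C" unfolding K_def set_mult_def using eq by auto
      show "?\<pi> ` C \<subseteq> K"
      proof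
        fix q assume "q \<in> ?\<pi> ` C"
        then obtain c where c: "c \<in> C" "q = ?\<pi> c" by blast
        hence "q = ?\<pi> (c \<otimes> \<one>)" using subgroup.subset[OF C] by auto
        moreover have "c \<otimes> \<one> \<in> C <#> J" unfolding set_mult_def using c J.one_closed by blast
        ultimately show "q \<in> K" unfolding K_def by blast
      qed
    qed
  qed
  have KQ: "subgroup K ?Q" unfolding K by (rule \<pi>.subgroup_img_is_subgroup[OF C])
  interpret K: normal K ?Q by (rule comm_group.subgroup_imp_normal[OF comm KQ])
  interpret P: group "?Q Mod K" by (rule K.factorgroup_is_group)
  let ?\<phi> = "\<lambda>x. K #>\<^bsub>?Q\<^esub> ?\<pi> x"
  have \<phi>: "?\<phi> \<in> hom G (?Q Mod K)"
    by (rule homI) (use \<pi>.hom_mult \<pi>.hom_closed hom_mult[OF K.r_coset_hom_Mod]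
      hom_in_carrier[OF K.r_coset_hom_Mod] in simp_all)
  interpret \<phi>: group_hom G "?Q Mod K" ?\<phi> by unfold_locales (rule \<phi>)
  have "?\<phi> h \<in> ?\<phi> ` generate G X" using \<phi>.generate_img[OF X] gen \<phi>.hom_closed[OF h] by simp
  then obtain x where x: "x \<in> generate G X" "?\<phi> h = ?\<phi> x" by blast
  have xc: "x \<in> carrier G" using x(1) X generate_in_carrier by blast
  have "?\<pi> h \<in> ?\<phi> x" using Q.rcos_self[OF \<pi>.hom_closed[OF h] KQ] x(2) by simp
  then obtain c where c: "c \<in> C" "?\<pi> h = ?\<pi> c \<otimes>\<^bsub>?Q\<^esub> ?\<pi> x" unfolding K r_coset_def by blast
  have cc: "c \<in> carrier G" using c subgroup.subset[OF C] by blast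
  have "h \<in> ?\<pi> (c \<otimes> x)" using rcos_self[OF h J.is_subgroup] c(2) \<pi>.hom_mult[OF cc xc] by simp
  then obtain j where "j \<in> J" "h = j \<otimes> (c \<otimes> x)" unfolding r_coset_def by blast
  thus ?thesis using c x by blast
qed

text \<open>Modulo \<open>M\<close> the commutator is multiplicative in its first argument, because its values lie in \<open>Z\<close>,
  which is central modulo \<open>M\<close>. Hence it suffices to check generators.\<close>

lemma commutator_generate_left:
  assumes M: "subgroup M G" and X: "X \<subseteq> carrier G" and y: "y \<in> carrier G" and Z: "subgroup Z G"
    and XZ: "\<And>x. x \<in> generate G X \<Longrightarrow> commutator G x y \<in> Z"
    and central: "\<And>g z. \<lbrakk>g \<in> carrier G; z \<in> Z\<rbrakk> \<Longrightarrow> commutator G g z \<in> M"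
    and base: "\<And>x. x \<in> X \<Longrightarrow> commutator G x y \<in> M" and x: "x \<in> generate G X"
  shows "commutator G x y \<in> M"
  using x
proof induction
  case one
  show ?case using y subgroup.one_closed[OF M] by simp
next
  case (incl h) thus ?case by (rule base)
next
  case (inv h)
  have h: "h \<in> carrier G" using inv X by blast
  have "commutator G (inv h) y = commutator G (inv h) (inv (commutator G h y)) \<otimes> inv (commutator G h y)"
    using h y by (simp add: word_simps)
  moreover have "inv (commutator G h y) \<in> Z"
    using XZ[OF generate.incl[OF inv]] subgroup.m_inv_closed[OF Z] by blast
  moreover have "inv (commutator G h y) \<in> M" using base[OF inv] subgroup.m_inv_closed[OF M] by blast
  ultimately show ?case using central[OF inv_closed[OF h]] subgroup.m_closed[OF M] by simp
next
  case (eng h k)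
  have hk: "h \<in> carrier G" "k \<in> carrier G" using eng.hyps X generate_in_carrier by blast+
  have "commutator G (h \<otimes> k) y
      = commutator G h (commutator G k y) \<otimes> commutator G k y \<otimes> commutator G h y"
    using hk y by (simp add: word_simps)
  moreover have "commutator G h (commutator G k y) \<in> M" by (rule central[OF hk(1) XZ[OF eng.hyps(2)]])
  ultimately show ?case using eng.IH subgroup.m_closed[OF M] by simp
qed

end

locale admissible = group G for G (structure) +
  fixes u :: "nat \<Rightarrow> real" and m :: nat and I :: "real \<Rightarrow> 'a set"
  assumes weights: "weight_semigroup u" and series: "admissible_series G u m I"
begin

lemma I_subgroup: "1 \<le> i \<Longrightarrow> subgroup (I (u i)) G"
  and I_Suc: "1 \<le> i \<Longrightarrow> I (u (i + 1)) \<subseteq> I (u i)"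
  and I_central_subgroup: "1 \<le> i \<Longrightarrow> commutator_subgroup G (carrier G) (I (u i)) \<subseteq> I (u (i + 1))"
  using series unfolding admissible_series_def central_series_def by blast+

lemma I_torsion: "I (u (m + 1)) = torsion G"
  using series unfolding admissible_series_def by blast

lemma I_trivial: "I (u (m + 2)) = {\<one>}"
  using series unfolding admissible_series_def by blast

lemma I_antimono:
  assumes "1 \<le> i" "i \<le> j"
  shows "I (u j) \<subseteq> I (u i)"
  using assms(2)
proof (induction rule: dec_induct)
  case (step k)
  have "I (u (Suc k)) \<subseteq> I (u k)" using I_Suc[of k] step assms(1) by simp
  thus ?case using step.IH by (rule subset_trans)
qed simp

lemma I_closed: "\<lbrakk>1 \<le> i; x \<in> I (u i)\<rbrakk> \<Longrightarrow> x \<in> carrier G"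
  using I_subgroup subgroup.subset by blast

lemma I_commutator_central:
  assumes "1 \<le> i" "g \<in> carrier G" "x \<in> I (u i)"
  shows "commutator G g x \<in> I (u (i + 1))"
proof -
  have "commutator G g x \<in> commutator_subgroup G (carrier G) (I (u i))"
    unfolding commutator_subgroup_def using assms by (intro generate.incl) blast
  thus ?thesis using I_central_subgroup[OF assms(1)] by blast
qed

lemma I_commutator:
  assumes "1 \<le> i" "1 \<le> j" "x \<in> I (u i)" "y \<in> I (u j)"
  shows "commutator G x y \<in> I (u i + u j)"
proof -
  have "commutator G x y \<in> commutator_subgroup G (I (u i)) (I (u j))"
    unfolding commutator_subgroup_def using assms by (intro generate.incl) blast
  moreover have "commutator_subgroup G (I (u i)) (I (u j)) \<subseteq> I (u i + u j)"
    using series assms(1,2) unfolding admissible_series_def by blast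
  ultimately show ?thesis by blast
qed

lemma u_less: "\<lbrakk>1 \<le> i; 1 \<le> j\<rbrakk> \<Longrightarrow> u i < u j \<longleftrightarrow> i < j"
  using weights strict_mono_on_less[of "{1..}" u i j] by (simp add: weight_semigroup_def)

lemma I_commutator_beyond:
  assumes "1 \<le> i" "1 \<le> a" "1 \<le> b" "u i < u a + u b" "x \<in> I (u a)" "y \<in> I (u b)"
  shows "commutator G x y \<in> I (u (i + 1))"
proof -
  have "u a + u b \<in> u ` {1..}" using weights assms(2,3) by (auto simp: weight_semigroup_def)
  then obtain j where j: "1 \<le> j" "u a + u b = u j" by auto
  hence "i < j" using u_less[of i j] assms by simp
  thus ?thesis using I_commutator[OF assms(2,3,5,6)] I_antimono[of "i + 1" j] j by auto
qed

text \<open>In the central series, the torsion is followed by the trivial group.\<close>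

lemma torsion_central: "\<lbrakk>t \<in> torsion G; g \<in> carrier G\<rbrakk> \<Longrightarrow> g \<otimes> t = t \<otimes> g"
proof -
  assume t: "t \<in> torsion G" and g: "g \<in> carrier G"
  have tc: "t \<in> carrier G" using t by (simp add: torsion_def)
  have "commutator G g t = \<one>"
    using I_commutator_central[of "m + 1" g t] t g I_torsion I_trivial by (simp add: numeral_2_eq_2)
  moreover have "g \<otimes> t = commutator G g t \<otimes> (t \<otimes> g)" using tc g by (simp add: word_simps)
  ultimately show ?thesis using tc g by simp
qed

lemma series_commutators_subset: "1 \<le> i \<Longrightarrow> series_commutators G u I i \<subseteq> I (u i)"
proof -
  assume i: "1 \<le> i"
  have "commutator_subgroup G (I (u a)) (I (u b)) \<subseteq> I (u i)"
    if "a \<in> {1..<i}" "b \<in> {1..<i}" "u a + u b = u i" for a b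
    unfolding commutator_subgroup_def
    using I_commutator[of a b] that by (intro generate_subgroup_incl I_subgroup i) auto
  thus ?thesis unfolding series_commutators_def by (intro generate_subgroup_incl I_subgroup i) blast
qed

lemma layer_decomposition:
  assumes i: "i \<in> {1..m}" and gen: "generates_double_quotient G (I (u i)) (I (u (i + 1))) (series_commutators G u I i) X"
    and X: "X \<subseteq> I (u i)" and h: "h \<in> I (u i)"
  shows "\<exists>j\<in>I (u (i + 1)). \<exists>c\<in>series_commutators G u I i. \<exists>x\<in>generate G X. h = j \<otimes> (c \<otimes> x)"
proof -
  have i1: "1 \<le> i" using i by simp
  let ?H = "I (u i)" and ?J = "I (u (i + 1))" and ?C = "series_commutators G u I i"
  let ?GH = "G\<lparr>carrier := ?H\<rparr>"
  note H = I_subgroup[OF i1]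
  interpret H: group ?GH by (rule subgroup.subgroup_is_group[OF H is_group])
  have JG: "subgroup ?J G" using I_subgroup[of "i + 1"] by simp
  have JH: "?J \<subseteq> ?H" by (rule I_Suc[OF i1])
  have J: "subgroup ?J ?GH" using subgroup_incl[OF JG H JH] .
  have comm: "commutator ?GH x y = commutator G x y" if "x \<in> ?H" "y \<in> ?H" for x y
    using that m_inv_consistent[OF H] by (simp add: commutator_def)
  have ab: "commutator ?GH x y \<in> ?J" if "x \<in> carrier ?GH" "y \<in> carrier ?GH" for x y
    using that comm I_commutator_central[OF i1, of x y] I_closed[OF i1] by simp
  have "?J \<lhd> ?GH"
  proof (rule H.normal_invI[OF J])
    fix x j assume x: "x \<in> carrier ?GH" and j: "j \<in> ?J"
    have jH: "j \<in> ?H" using j JH by blast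
    have "x \<otimes>\<^bsub>?GH\<^esub> j \<otimes>\<^bsub>?GH\<^esub> inv\<^bsub>?GH\<^esub> x = commutator ?GH x j \<otimes>\<^bsub>?GH\<^esub> j"
      by (rule H.conj_eq_commutator_mult) (use x jH in auto)
    thus "x \<otimes>\<^bsub>?GH\<^esub> j \<otimes>\<^bsub>?GH\<^esub> inv\<^bsub>?GH\<^esub> x \<in> ?J"
      using ab[of x j] x jH j subgroup.m_closed[OF JG] by simp
  qed
  have CG: "subgroup ?C G"
  proof -
    have "\<Union> {commutator_subgroup G (I (u a)) (I (u b)) |a b. a \<in> {1..<i} \<and> b \<in> {1..<i} \<and> u a + u b = u i}
        \<subseteq> series_commutators G u I i"
      unfolding series_commutators_def by (auto intro: generate.incl)
    also have "\<dots> \<subseteq> carrier G" using series_commutators_subset[OF i1] I_closed[OF i1] by blast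
    finally show ?thesis unfolding series_commutators_def by (rule generate_is_subgroup)
  qed
  have C: "subgroup ?C ?GH" using subgroup_incl[OF CG H series_commutators_subset[OF i1]] .
  let ?K = "(\<lambda>x. ?J #>\<^bsub>?GH\<^esub> x) ` (?C <#>\<^bsub>?GH\<^esub> ?J)"
  have "generate ((?GH Mod ?J) Mod ?K) ((\<lambda>x. ?K #>\<^bsub>?GH Mod ?J\<^esub> (?J #>\<^bsub>?GH\<^esub> x)) ` X)
      = carrier ((?GH Mod ?J) Mod ?K)"
    using gen unfolding generates_double_quotient_def Let_def by (simp add: r_coset_def set_mult_def)
  from H.double_quotient_generation[OF \<open>?J \<lhd> ?GH\<close> ab C _ refl this, of h]
  have "\<exists>j\<in>?J. \<exists>c\<in>?C. \<exists>x\<in>generate ?GH X. h = j \<otimes> (c \<otimes> x)" using X h by simp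
  thus ?thesis using generate_consistent[OF X H] by simp
qed

text \<open>For an arbitrary weighted tuple, a commutator of weight \<open>u i\<close> need not have its value in
  \<open>I (u i)\<close>; hence the intersection.\<close>

definition exact_values :: "'a list \<Rightarrow> real list \<Rightarrow> nat \<Rightarrow> 'a set" where
  "exact_values T w i = {fc_eval G T c | c. c \<in> formal_commutators T \<and> fc_weight w c = u i} \<inter> I (u i)"

lemma exact_values_commutator:
  assumes "x \<in> exact_values T w a" "y \<in> exact_values T w b" "1 \<le> a" "1 \<le> b" "u a + u b = u i"
  shows "commutator G x y \<in> exact_values T w i"
proof -
  obtain c d where c: "x = fc_eval G T c" "c \<in> formal_commutators T" "fc_weight w c = u a"
    and d: "y = fc_eval G T d" "d \<in> formal_commutators T" "fc_weight w d = u b"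
    using assms(1,2) by (auto simp: exact_values_def)
  have "commutator G x y = fc_eval G T (Bracket c d)" "Bracket c d \<in> formal_commutators T"
    "fc_weight w (Bracket c d) = u i"
    using c d assms(5) by auto
  moreover have "commutator G x y \<in> I (u i)"
    using I_commutator[OF assms(3,4), of x y] assms by (simp add: exact_values_def)
  ultimately show ?thesis unfolding exact_values_def by blast
qed

text \<open>Strong induction on the layer. The only generators of \<open>I (u i)\<close> not yet of the right form are
  commutators of \<open>I (u a)\<close> and \<open>I (u b)\<close> with \<open>u a + u b = u i\<close>. By bilinearity these reduce to commutators
  of exact values of weights \<open>u a\<close> and \<open>u b\<close>; a factor from the next layer pushes the commutator beyond
  \<open>u i\<close>.\<close>

lemma layer_generated_by_exact_values:
  assumes layers: "\<And>i. i \<in> {1..m} \<Longrightarrow>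
      generates_double_quotient G (I (u i)) (I (u (i + 1))) (series_commutators G u I i) (X i)"
    and X: "\<And>i. i \<in> {1..m} \<Longrightarrow> X i \<subseteq> exact_values T w i"
    and i: "i \<in> {1..m}"
  shows "I (u i) \<subseteq> generate G (exact_values T w i \<union> I (u (i + 1)))"
  using i
proof (induction i rule: less_induct)
  case (less i)
  hence i: "1 \<le> i" "i \<le> m" by auto
  let ?M = "generate G (exact_values T w i \<union> I (u (i + 1)))"
  have E: "exact_values T w k \<subseteq> I (u k)" for k by (auto simp: exact_values_def)
  have gens: "exact_values T w k \<union> I (u (k + 1)) \<subseteq> I (u k)" if "1 \<le> k" for k
    using E I_Suc[OF that] by blast
  have gens_closed: "exact_values T w k \<union> I (u (k + 1)) \<subseteq> carrier G" if "1 \<le> k" for k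
    using gens[OF that] I_closed[OF that] by blast
  have gen_sub: "generate G (exact_values T w k \<union> I (u (k + 1))) \<subseteq> I (u k)" if "1 \<le> k" for k
    by (rule generate_subgroup_incl[OF gens[OF that] I_subgroup[OF that]])
  have M: "subgroup ?M G" by (rule generate_is_subgroup[OF gens_closed[OF i(1)]])
  have IM: "I (u (i + 1)) \<subseteq> ?M" by (auto intro: generate.incl)
  have central: "commutator G g z \<in> ?M" if "g \<in> carrier G" "z \<in> I (u i)" for g z
    using I_commutator_central[OF i(1) that] IM by blast
  have comm: "commutator G x y \<in> ?M"
    if ab: "a \<in> {1..<i}" "b \<in> {1..<i}" "u a + u b = u i" and x: "x \<in> I (u a)" and y: "y \<in> I (u b)" for a b x y
  proof -
    have ab1: "1 \<le> a" "1 \<le> b" "a \<in> {1..m}" "b \<in> {1..m}" "a < i" "b < i" using ab i by auto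
    have beyond: "u i < u (a + 1) + u b" "u i < u a + u (b + 1)"
      using u_less[of a "a + 1"] u_less[of b "b + 1"] ab1 ab(3) by auto
    have xg: "x \<in> generate G (exact_values T w a \<union> I (u (a + 1)))" using less.IH[OF ab1(5,3)] x by blast
    have yg: "y \<in> generate G (exact_values T w b \<union> I (u (b + 1)))" using less.IH[OF ab1(6,4)] y by blast
    have left: "commutator G x' y \<in> ?M" if x': "x' \<in> exact_values T w a \<union> I (u (a + 1))" for x'
    proof (cases "x' \<in> I (u (a + 1))")
      case True
      have "commutator G x' y \<in> I (u (i + 1))"
        by (rule I_commutator_beyond[OF i(1) _ ab1(2) beyond(1) True y]) simp
      thus ?thesis using IM by blast
    next
      case False
      hence x'E: "x' \<in> exact_values T w a" using x' by blast
      have x'I: "x' \<in> I (u a)" using x'E E by blast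
      have x'c: "x' \<in> carrier G" by (rule I_closed[OF ab1(1) x'I])
      have "commutator G y x' \<in> ?M"
      proof (rule commutator_generate_left[OF M gens_closed[OF ab1(2)] x'c I_subgroup[OF i(1)] _ central _ yg])
        fix y' assume "y' \<in> generate G (exact_values T w b \<union> I (u (b + 1)))"
        hence "y' \<in> I (u b)" using gen_sub[OF ab1(2)] by blast
        from I_commutator[OF ab1(2,1) this x'I] show "commutator G y' x' \<in> I (u i)"
          using ab(3) by (simp add: add.commute)
      next
        fix y' assume y': "y' \<in> exact_values T w b \<union> I (u (b + 1))"
        show "commutator G y' x' \<in> ?M"
        proof (cases "y' \<in> I (u (b + 1))")
          case True
          have "commutator G y' x' \<in> I (u (i + 1))"
            by (rule I_commutator_beyond[OF i(1) _ ab1(1) _ True x'I]) (use beyond(2) in \<open>simp_all add: add.commute\<close>)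
          thus ?thesis using IM by blast
        next
          case False
          hence "y' \<in> exact_values T w b" using y' by blast
          from exact_values_commutator[OF this x'E ab1(2,1), of i] ab(3)
          have "commutator G y' x' \<in> exact_values T w i" by (simp add: add.commute)
          thus ?thesis by (auto intro: generate.incl)
        qed
      qed
      moreover have "commutator G x' y = inv (commutator G y x')"
        using inv_commutator[OF I_closed[OF ab1(2) y] x'c] by simp
      ultimately show ?thesis using subgroup.m_inv_closed[OF M] by simp
    qed
    show ?thesis
    proof (rule commutator_generate_left[OF M gens_closed[OF ab1(1)] I_closed[OF ab1(2) y] I_subgroup[OF i(1)] _ central left xg])
      fix x' assume "x' \<in> generate G (exact_values T w a \<union> I (u (a + 1)))"
      hence "x' \<in> I (u a)" using gen_sub[OF ab1(1)] by blast
      from I_commutator[OF ab1(1,2) this y] show "commutator G x' y \<in> I (u i)" using ab(3) by simp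
    qed
  qed
  have "commutator_subgroup G (I (u a)) (I (u b)) \<subseteq> ?M"
    if "a \<in> {1..<i}" "b \<in> {1..<i}" "u a + u b = u i" for a b
    unfolding commutator_subgroup_def using comm[OF that] by (intro generate_subgroup_incl M) blast
  hence CM: "series_commutators G u I i \<subseteq> ?M"
    unfolding series_commutators_def by (intro generate_subgroup_incl M) blast
  have XM: "generate G (X i) \<subseteq> ?M"
    using X[OF less.prems] by (intro mono_generate) blast
  show ?case
  proof
    fix h assume h: "h \<in> I (u i)"
    have "X i \<subseteq> I (u i)" using X[OF less.prems] E by blast
    then obtain j c x where "j \<in> I (u (i + 1))" "c \<in> series_commutators G u I i" "x \<in> generate G (X i)"
      "h = j \<otimes> (c \<otimes> x)"
      using layer_decomposition[OF less.prems layers[OF less.prems] _ h] by blast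
    thus "h \<in> ?M" using IM CM XM subgroup.m_closed[OF M] by blast
  qed
qed

text \<open>By descending induction, \<open>I (u i)\<close> is the product of the weight subgroup and the torsion. Since the
  torsion is central, a suitable power of such a product has no torsion part and lies in the weight
  subgroup.\<close>

lemma series_subset_isolator:
  assumes T: "set T \<subseteq> carrier G"
    and layers: "\<And>i. i \<in> {1..m} \<Longrightarrow>
      generates_double_quotient G (I (u i)) (I (u (i + 1))) (series_commutators G u I i) (X i)"
    and X: "\<And>i. i \<in> {1..m} \<Longrightarrow> X i \<subseteq> exact_values T w i"
    and i: "i \<in> {1..m}"
  shows "I (u i) \<subseteq> isolator G (weight_subgroup G T w (u i))"
proof -
  let ?W = "\<lambda>i. weight_subgroup G T w (u i)"
  have W: "subgroup (?W k) G" for k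
    unfolding weight_subgroup_def using fc_eval_closed[OF T] by (intro generate_is_subgroup) auto
  have tor: "subgroup (torsion G) G" using I_subgroup[of "m + 1"] I_torsion by simp
  have tc: "t \<in> carrier G" if "t \<in> torsion G" for t using that by (simp add: torsion_def)
  have decomp: "\<exists>k\<in>?W i. \<exists>t\<in>torsion G. x = k \<otimes> t" if "x \<in> I (u i)" "1 \<le> i" "i \<le> m + 1" for i x
    using that(3,2,1)
  proof (induction i arbitrary: x rule: inc_induct)
    case base
    thus ?case using I_torsion subgroup.one_closed[OF W] tc by (intro bexI[of _ \<one>] bexI[of _ x]) auto
  next
    case (step k)
    have "u k < u (Suc k)" using u_less[of k "Suc k"] step.prems by simp
    hence mono: "?W (Suc k) \<subseteq> ?W k" by (intro weight_subgroup_antimono is_group) simp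
    have kc: "y \<in> carrier G" if "y \<in> ?W k" for y using that subgroup.subset[OF W] by blast
    have gens: "\<exists>y\<in>?W k. \<exists>t\<in>torsion G. h = y \<otimes> t" if "h \<in> exact_values T w k \<union> I (u (k + 1))" for h
      using that
    proof
      assume "h \<in> exact_values T w k"
      then obtain c where c: "h = fc_eval G T c" "c \<in> formal_commutators T" "fc_weight w c = u k"
        by (auto simp: exact_values_def)
      hence "h \<in> ?W k" unfolding weight_subgroup_def by (intro generate.incl) auto
      thus ?thesis using kc subgroup.one_closed[OF tor] by (intro bexI[of _ h] bexI[of _ \<one>]) auto
    next
      assume "h \<in> I (u (k + 1))"
      thus ?thesis using step.IH[of h] mono by auto
    qed
    have "x \<in> generate G (exact_values T w k \<union> I (u (k + 1)))"
      using layer_generated_by_exact_values[OF layers X, of k] step by auto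
    thus ?case
    proof induction
      case one
      show ?case using subgroup.one_closed[OF W] subgroup.one_closed[OF tor]
        by (intro bexI[of _ \<one>]) auto
    next
      case (incl h)
      thus ?case by (rule gens)
    next
      case (inv h)
      hence "\<exists>y\<in>?W k. \<exists>t\<in>torsion G. h = y \<otimes> t" by (rule gens)
      then obtain y t where y: "y \<in> ?W k" "t \<in> torsion G" "h = y \<otimes> t" by blast
      have "inv h = inv y \<otimes> inv t"
        using y kc tc torsion_central[of "inv t" "inv y"] subgroup.m_inv_closed[OF tor]
        by (simp add: inv_mult_group)
      thus ?case using y subgroup.m_inv_closed[OF tor] subgroup.m_inv_closed[OF W] by blast
    next
      case (eng h1 h2)
      then obtain y1 t1 y2 t2 where y: "y1 \<in> ?W k" "t1 \<in> torsion G" "h1 = y1 \<otimes> t1"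
        "y2 \<in> ?W k" "t2 \<in> torsion G" "h2 = y2 \<otimes> t2" by blast
      have "h1 \<otimes> h2 = (y1 \<otimes> y2) \<otimes> (t1 \<otimes> t2)"
      proof -
        have "h1 \<otimes> h2 = y1 \<otimes> (t1 \<otimes> y2) \<otimes> t2" using y kc tc by (simp add: m_assoc)
        also have "t1 \<otimes> y2 = y2 \<otimes> t1" using torsion_central[OF y(2) kc[OF y(4)]] by simp
        finally show ?thesis using y kc tc by (simp add: m_assoc)
      qed
      thus ?case using y subgroup.m_closed[OF tor] subgroup.m_closed[OF W] by blast
    qed
  qed
  show ?thesis
  proof
    fix x assume x: "x \<in> I (u i)"
    then obtain k t where k: "k \<in> ?W i" "t \<in> torsion G" "x = k \<otimes> t" using decomp[of x i] i by auto
    obtain n :: nat where n: "1 \<le> n" "t [^] n = \<one>" using k(2) by (auto simp: torsion_def)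
    have kc: "k \<in> carrier G" using k(1) subgroup.subset[OF W] by blast
    have "x [^] n = k [^] n \<otimes> t [^] n"
      unfolding k(3) using torsion_central[OF k(2) kc] kc tc[OF k(2)] by (intro pow_mult_distrib) auto
    also have "\<dots> = k [^] n" using n kc by simp
    also have "\<dots> \<in> ?W i"
      using k(1) by (induction n) (auto intro: subgroup.one_closed[OF W] subgroup.m_closed[OF W])
    finally show "x \<in> isolator G (?W i)" using n(1) k(3) kc tc[OF k(2)] unfolding isolator_def by auto
  qed
qed

end

section \<open>Comparison of the two forms\<close>

lemma comparable_on_sym:
  assumes "comparable_on X p q"
  shows "comparable_on X q p"
proof -
  obtain c C where c: "0 < c" "0 < C" "\<And>x. x \<in> X \<Longrightarrow> c * q x \<le> p x" "\<And>x. x \<in> X \<Longrightarrow> p x \<le> C * q x"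
    using assms by (auto simp: comparable_on_def)
  show ?thesis unfolding comparable_on_def
    by (intro exI[of _ "1 / C"] exI[of _ "1 / c"] conjI ballI)
      (use c in \<open>auto simp: field_simps\<close>)
qed

lemma comparable_on_trans:
  assumes "comparable_on X p q" "comparable_on X q r"
  shows "comparable_on X p r"
proof -
  obtain c C where c: "0 < c" "0 < C" "\<And>x. x \<in> X \<Longrightarrow> c * q x \<le> p x" "\<And>x. x \<in> X \<Longrightarrow> p x \<le> C * q x"
    using assms(1) by (auto simp: comparable_on_def)
  obtain d D where d: "0 < d" "0 < D" "\<And>x. x \<in> X \<Longrightarrow> d * r x \<le> q x" "\<And>x. x \<in> X \<Longrightarrow> q x \<le> D * r x"
    using assms(2) by (auto simp: comparable_on_def)
  have "c * d * r x \<le> p x \<and> p x \<le> C * D * r x" if "x \<in> X" for x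
  proof -
    have "c * (d * r x) \<le> c * q x" "C * q x \<le> C * (D * r x)"
      using d(3,4)[OF that] c(1,2) by (intro mult_left_mono; simp)+
    thus ?thesis using c(3,4)[OF that] unfolding mult.assoc by linarith
  qed
  thus ?thesis unfolding comparable_on_def
    by (intro exI[of _ "c * d"] exI[of _ "C * D"] conjI ballI) (use c d in auto)
qed

lemma comparable_onI:
  assumes "\<exists>C>0. \<forall>x\<in>X. p x \<le> C * (q x::real)" "\<exists>C>0. \<forall>x\<in>X. q x \<le> C * p x"
  shows "comparable_on X p q"
proof -
  obtain C D where C: "0 < C" "\<And>x. x \<in> X \<Longrightarrow> p x \<le> C * q x" "0 < D" "\<And>x. x \<in> X \<Longrightarrow> q x \<le> D * p x"
    using assms by auto
  show ?thesis unfolding comparable_on_def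
    by (intro exI[of _ "1 / D"] exI[of _ C] conjI ballI) (use C in \<open>auto simp: field_simps\<close>)
qed

lemma set_zip_concat_replicate:
  "set (zip (concat (map X L) @ Y) (concat (map (\<lambda>i. replicate (length (X i)) (u i)) L) @ a))
    = {(x, u i) | x i. i \<in> set L \<and> x \<in> set (X i)} \<union> set (zip Y a)"
proof -
  have len: "length (concat (map X L)) = length (concat (map (\<lambda>i. replicate (length (X i)) (u i)) L))"
    by (induction L) auto
  have "set (zip (concat (map X L)) (concat (map (\<lambda>i. replicate (length (X i)) (u i)) L)))
      = {(x, u i) | x i. i \<in> set L \<and> x \<in> set (X i)}"
  proof (induction L)
    case (Cons i L)
    have "set (zip (X i) (replicate (length (X i)) (u i))) = {(x, u i) | x. x \<in> set (X i)}"
      by (auto simp: zip_replicate2 image_iff)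
    thus ?case using Cons by auto
  qed simp
  thus ?thesis using len by simp
qed

theorem theorem14:
  fixes N :: "('a, 'b) monoid_scheme"
    and u :: "nat \<Rightarrow> real" and m :: nat and I :: "real \<Rightarrow> 'a set"
    and Xi :: "nat \<Rightarrow> 'a list" and Xi0 :: "'a list" and a :: "real list"
    and S :: "'a list" and v :: "real list"
    and \<mu> \<nu> :: "'a pmf"
  defines "Xi_all \<equiv> concat (map Xi [1..<m + 1]) @ Xi0"
    and "u_all \<equiv> concat (map (\<lambda>i. replicate (length (Xi i)) (u i)) [1..<m + 1]) @ a"
  assumes "nilpotent_group N" and "finitely_generated_group N"
    and "weight_semigroup u"
    and "admissible_series N u m I"
    and "layer_generators N u m I Xi"
    and "set Xi0 \<subseteq> carrier N"
    and "generate N (set Xi_all) = carrier N"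
    and "length a = length Xi0"
    and "\<forall>i<length Xi0. a ! i > 1 / 2 \<and> ereal (a ! i) \<le> series_weight N u m I (Xi0 ! i)"
    and "set S \<subseteq> carrier N" and "generate N (set S) = carrier N"
    and "length v = length S" and "\<forall>x\<in>set v. x > 1 / 2"
    and "reduced_series N S v = map (\<lambda>i. (u i, I (u i))) [1..<m + 1]"
    and "is_stable_like N S (map (\<lambda>x. 1 / x) v) \<mu>"
    and "is_stable_like N Xi_all (map (\<lambda>x. 1 / x) u_all) \<nu>"
  shows "comparable_on (finitely_supported N) (dirichlet_form N \<mu>) (dirichlet_form N \<nu>)"
proof -
  have gN: "group N" using assms(3) by (simp add: nilpotent_group_def)
  interpret admissible N u m I by (intro_locales) (use gN assms(5,6) in \<open>auto simp: admissible_axioms_def group_def\<close>)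
  obtain n where n: "lower_central_series N n = {\<one>\<^bsub>N\<^esub>}" using assms(3) by (auto simp: nilpotent_group_def)
  have idx: "set [1..<m + 1] = {1..m}" by auto
  have upos: "0 < u i" if "1 \<le> i" for i
  proof -
    have "1 / 2 < u i" using assms(5) that by (simp add: weight_semigroup_def)
    thus ?thesis by linarith
  qed
  have vpos: "0 < x" if "x \<in> set v" for x
  proof -
    have "1 / 2 < x" using assms(15) that by blast
    thus ?thesis by linarith
  qed
  have Xi: "set (Xi i) \<subseteq> I (u i)"
    "generates_double_quotient N (I (u i)) (I (u (i + 1))) (series_commutators N u I i) (set (Xi i))"
    if "i \<in> {1..m}" for i
    using assms(7) that unfolding layer_generators_def by blast+
  have Xi_closed: "x \<in> carrier N" if "i \<in> {1..m}" "x \<in> set (Xi i)" for i x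
    using Xi(1)[OF that(1)] that I_closed[of i x] by auto
  have zip: "set (zip Xi_all u_all) = {(x, u i) | x i. i \<in> {1..m} \<and> x \<in> set (Xi i)} \<union> set (zip Xi0 a)"
    unfolding Xi_all_def u_all_def set_zip_concat_replicate idx ..
  have len: "length u_all = length Xi_all"
    unfolding Xi_all_def u_all_def using assms(10) by (simp add: length_concat comp_def)
  have Xi_all: "set Xi_all \<subseteq> carrier N"
    unfolding Xi_all_def set_append set_concat set_map idx using Xi_closed assms(8) by blast
  have entry: "(Xi_all ! j, u_all ! j) \<in> set (zip Xi_all u_all)" if "j < length Xi_all" for j
    using that len by (auto simp: set_zip)
  have Xi0: "0 < a ! l" "Xi0 ! l \<in> torsion N \<or> (\<exists>k\<in>{1..m}. a ! l \<le> u k \<and> Xi0 ! l \<in> I (u k))"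
    if l: "l < length Xi0" for l
  proof -
    have al: "1 / 2 < a ! l" "ereal (a ! l) \<le> series_weight N u m I (Xi0 ! l)" using assms(11) l by auto
    show "0 < a ! l" using al(1) by linarith
    show "Xi0 ! l \<in> torsion N \<or> (\<exists>k\<in>{1..m}. a ! l \<le> u k \<and> Xi0 ! l \<in> I (u k))"
    proof (cases "Xi0 ! l \<in> torsion N")
      case False
      let ?Y = "{k \<in> {1..m}. Xi0 ! l \<in> I (u k)}"
      have le: "ereal (a ! l) \<le> (SUP k\<in>?Y. ereal (u k))" using al(2) False by (simp add: series_weight_def)
      have ne: "?Y \<noteq> {}"
      proof
        assume e: "?Y = {}"
        show False using le unfolding e by (simp add: bot_ereal_def)
      qed
      have "(SUP k\<in>?Y. ereal (u k)) \<in> (\<lambda>k. ereal (u k)) ` ?Y"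
      proof -
        have fin: "finite ((\<lambda>k. ereal (u k)) ` ?Y)" and ne': "(\<lambda>k. ereal (u k)) ` ?Y \<noteq> {}" using ne by simp_all
        show ?thesis using Max_in[OF fin ne'] unfolding Max_Sup[OF fin ne'] .
      qed
      then obtain k where "k \<in> ?Y" "(SUP k\<in>?Y. ereal (u k)) = ereal (u k)" by auto
      thus ?thesis using le by auto
    qed simp
  qed
  have entry_cases: "0 < u_all ! j \<and> (Xi_all ! j \<in> torsion N \<or>
      (\<exists>k\<in>{1..m}. u_all ! j \<le> u k \<and> Xi_all ! j \<in> I (u k)))" if j: "j < length Xi_all" for j
    using entry[OF j] unfolding zip
  proof
    assume "(Xi_all ! j, u_all ! j) \<in> {(x, u i) | x i. i \<in> {1..m} \<and> x \<in> set (Xi i)}"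
    then obtain i where i: "i \<in> {1..m}" "u_all ! j = u i" "Xi_all ! j \<in> set (Xi i)" by auto
    hence "Xi_all ! j \<in> I (u i)" using Xi(1) by blast
    thus ?thesis using i upos[of i] by auto
  next
    assume "(Xi_all ! j, u_all ! j) \<in> set (zip Xi0 a)"
    then obtain l where "l < length Xi0" "Xi_all ! j = Xi0 ! l" "u_all ! j = a ! l" by (auto simp: set_zip)
    thus ?thesis using Xi0[of l] by simp
  qed
  have in_iso: "x \<in> isolator N (weight_subgroup N T w b)"
    if x: "x \<in> torsion N \<or> (\<exists>k\<in>{1..m}. b \<le> u k \<and> x \<in> I (u k))"
      and iso: "\<And>k. k \<in> {1..m} \<Longrightarrow> I (u k) \<subseteq> isolator N (weight_subgroup N T w (u k))" for x T w b
    using x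
  proof
    assume "x \<in> torsion N"
    moreover have "\<one>\<^bsub>N\<^esub> \<in> weight_subgroup N T w b" unfolding weight_subgroup_def by (rule generate.one)
    ultimately show ?thesis unfolding isolator_def torsion_def by auto
  next
    assume "\<exists>k\<in>{1..m}. b \<le> u k \<and> x \<in> I (u k)"
    then obtain k where k: "k \<in> {1..m}" "b \<le> u k" "x \<in> I (u k)" by blast
    have "isolator N (weight_subgroup N T w (u k)) \<subseteq> isolator N (weight_subgroup N T w b)"
      using weight_subgroup_antimono[OF gN k(2)] unfolding isolator_def by blast
    thus ?thesis using iso[OF k(1)] k(3) by blast
  qed
  have u_all_pos: "0 < x" if "x \<in> set u_all" for x
    using that entry_cases len by (auto simp: in_set_conv_nth)
  have I_iso_S: "I (u k) \<subseteq> isolator N (weight_subgroup N S v (u k))" if "k \<in> {1..m}" for k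
  proof -
    have "(u k, I (u k)) \<in> set (reduced_series N S v)" unfolding assms(16) set_map idx using that by blast
    thus ?thesis using reduced_series_memD by blast
  qed
  have I_iso_Xi: "I (u k) \<subseteq> isolator N (weight_subgroup N Xi_all u_all (u k))" if "k \<in> {1..m}" for k
  proof (rule series_subset_isolator[OF Xi_all Xi(2) _ that])
    fix i assume i: "i \<in> {1..m}"
    show "set (Xi i) \<subseteq> exact_values Xi_all u_all i"
    proof
      fix x assume x: "x \<in> set (Xi i)"
      hence "(x, u i) \<in> set (zip Xi_all u_all)" unfolding zip using i by blast
      then obtain j where j: "j < length Xi_all" "x = Xi_all ! j" "u i = u_all ! j" by (auto simp: set_zip)
      hence "fc_eval N Xi_all (Letter (j, True)) = x" "fc_weight u_all (Letter (j, True)) = u i"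
        "Letter (j, True) \<in> formal_commutators Xi_all"
        by (auto simp: formal_commutators_def)
      thus "x \<in> exact_values Xi_all u_all i" using Xi(1)[OF i] x unfolding exact_values_def by blast
    qed
  qed
  have S_cases: "S ! i \<in> torsion N \<or> (\<exists>k\<in>{1..m}. v ! i \<le> u k \<and> S ! i \<in> I (u k))" if "i < length S" for i
    using reduced_series_covers[OF gN assms(12) n assms(14) vpos that] unfolding assms(16) set_map idx by blast
  have 1: "\<exists>C>0. \<forall>f\<in>finitely_supported N.
      power_energy Xi_all (map (\<lambda>x. 1 / x) u_all) f \<le> C * power_energy S (map (\<lambda>x. 1 / x) v) f"
  proof (rule power_energy_comparison[OF assms(12,13,3,14) vpos Xi_all len u_all_pos])
    fix j assume "j < length Xi_all"
    thus "Xi_all ! j \<in> isolator N (weight_subgroup N S v (u_all ! j))"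
      using entry_cases I_iso_S by (intro in_iso) auto
  qed
  have 2: "\<exists>C>0. \<forall>f\<in>finitely_supported N.
      power_energy S (map (\<lambda>x. 1 / x) v) f \<le> C * power_energy Xi_all (map (\<lambda>x. 1 / x) u_all) f"
  proof (rule power_energy_comparison[OF Xi_all assms(9,3) len u_all_pos assms(12,14) vpos])
    fix i assume "i < length S"
    thus "S ! i \<in> isolator N (weight_subgroup N Xi_all u_all (v ! i))"
      using S_cases I_iso_Xi by (intro in_iso) auto
  qed
  have "comparable_on (finitely_supported N) (dirichlet_form N \<mu>) (power_energy S (map (\<lambda>x. 1 / x) v))"
    using vpos assms(14) by (intro dirichlet_form_power_energy[OF assms(17,12)]) auto
  moreover
  have "comparable_on (finitely_supported N) (dirichlet_form N \<nu>) (power_energy Xi_all (map (\<lambda>x. 1 / x) u_all))"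
    using u_all_pos len by (intro dirichlet_form_power_energy[OF assms(18) Xi_all]) auto
  ultimately show ?thesis
    using comparable_on_trans[OF _ comparable_on_trans[OF comparable_onI[OF 2 1] comparable_on_sym]] by blast
qed

end
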